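(* Let $s\in(0,1]$, let $\varphi\in\ell^\infty(\mathbb{R}^d)\cap\mathcal{L}_2(\mathbb{R}^d)\cap\mathcal{P}$, let $f_0\in\mathcal{W}^{s,2}(\mathbb{R}^d)\cap\mathcal{P}$, and let $X_1,X_2,\dots$ be i.i.d. with density $f_0$. Assume that, for each $\nu>0$, the fixed-scale class $\mathcal{P}_{\varphi,\nu}$ is pointwise measurable, and suppose that $\operatorname{VC}(\mathcal{P}_\varphi)<\infty$ and $\int_{\mathbb{R}^d}\|x\|_2^s\varphi(x)\,dx\le K_1$ for a finite constant $K_1$. Then there exist constants $M,N>0$ and a sequence $(\epsilon_n)_n$ with $\epsilon_n\lesssim n^{-\frac{s}{2s+d}}$ such that, if $$m_n=\lceil Mn^{1/2}\rceil\qquad\text{and}\qquad\nu_n=Nn^{1/(2(2s+d))},$$ and if, for each $n\in\mathbb{N}$, $\hat f_n\in\mathrm{co}_{m_n}(\mathcal{P}_{\varphi,\nu_n})\subset\mathrm{co}_{m_n}(\mathcal{P}_\varphi)$ is measurable (with respect to the sample) and satisfies $$\int_{\mathbb{R}^d}\hat f_n^2(x)\,dx-2P_n\hat f_n\le\inf_{f\in\mathrm{co}_{m_n}(\mathcal{P}_{\varphi,\nu_n})}\left[\int_{\mathbb{R}^d}f^2(x)\,dx-2P_nf\right]+\epsilon_n,$$ then $$\mathrm{E}\|\hat f_n-f_0\|_2^2\lesssim n^{-\frac{s}{2s+d}} .$$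
   Context: $\mathcal{P}$ is the set of all probability density functions on $\mathbb{R}^d$; $\ell^\infty(\mathbb{R}^d)$ is the space of (everywhere) bounded real functions on $\mathbb{R}^d$. $\varphi_\nu(x)=\nu^d\varphi(\nu x)$, $\mathcal{P}_{\varphi,\nu}=\{x\mapsto\varphi_\nu(x-\mu) : \mu\in\mathbb{R}^d\}$, and $\mathcal{P}_\varphi=\bigcup_{\nu>0}\mathcal{P}_{\varphi,\nu}$. $\mathrm{co}_m(\mathcal{Q})=\{\sum_{j=1}^m\pi_jq_j : q_j\in\mathcal{Q},\ \pi_j\ge0,\ \sum_{j=1}^m\pi_j=1\}$. $P_nf=n^{-1}\sum_{i=1}^nf(X_i)$. For a class $\mathcal{F}$ of bounded functions on $\mathbb{R}^d$, $\operatorname{VC}(\mathcal{F})$ is the Vapnik--Chervonenkis dimension of the family of subgraphs $\{(x,t)\in\mathbb{R}^d\times\mathbb{R} : t\le f(x)\}$, $f\in\mathcal{F}$. $\mathcal{F}$ is pointwise measurable if there is a countable $\mathcal{F}_0\subset\mathcal{F}$ such that every $f\in\mathcal{F}$ is the pointwise limit (at every $x\in\mathbb{R}^d$) of a sequence in $\mathcal{F}_0$. $\mathcal{W}^{1,2}$ is the space of $f\in\mathcal{L}_2$ with first-order weak derivatives in $\mathcal{L}_2$; for $s\in(0,1)$, $\mathcal{W}^{s,2}$ is the space of $f\in\mathcal{L}_2$ with $\int_{\mathbb{R}^d}\int_{\mathbb{R}^d}|f(x)-f(y)|^2\|x-y\|_2^{-d-2s}\,dx\,dy<\infty$; for $s=1$,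 $\mathcal{W}^{s,2}$ means $\mathcal{W}^{1,2}$. $a_n\lesssim b_n$ means $a_n\le C'b_n$ for all $n$, with a finite constant $C'>0$ independent of $n$. The $\epsilon_n$ are nonnegative. *)

theory Defs
  imports "HOL-Probability.Probability"
begin

definition L2_functions :: "('a::euclidean_space \<Rightarrow> real) set" where
  "L2_functions = {f. f \<in> borel_measurable borel \<and> integrable lborel (\<lambda>x. (f x)\<^sup>2)}"

definition L2_norm :: "('a::euclidean_space \<Rightarrow> real) \<Rightarrow> real" where
  "L2_norm f = sqrt (LINT x|lborel. (f x)\<^sup>2)"

definition prob_densities :: "('a::euclidean_space \<Rightarrow> real) set" where
  "prob_densities = {p. p \<in> borel_measurable borel \<and> (\<forall>x. 0 \<le> p x)
     \<and> integrable lborel p \<and> (LINT x|lborel. p x) = 1}"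

definition bounded_functions :: "('a \<Rightarrow> real) set" where
  "bounded_functions = {f. bounded (range f)}"

definition rescale :: "('a::euclidean_space \<Rightarrow> real) \<Rightarrow> real \<Rightarrow> 'a \<Rightarrow> real" where
  "rescale \<phi> \<nu> x = \<nu> ^ DIM('a) * \<phi> (\<nu> *\<^sub>R x)"

definition fixed_scale_class ::
    "('a::euclidean_space \<Rightarrow> real) \<Rightarrow> real \<Rightarrow> ('a \<Rightarrow> real) set" where
  "fixed_scale_class \<phi> \<nu> = {(\<lambda>x. rescale \<phi> \<nu> (x - \<mu>)) | \<mu>. True}"

definition scale_class :: "('a::euclidean_space \<Rightarrow> real) \<Rightarrow> ('a \<Rightarrow> real) set" where
  "scale_class \<phi> = (\<Union>\<nu>\<in>{0<..}. fixed_scale_class \<phi> \<nu>)"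

definition mixtures :: "nat \<Rightarrow> ('a \<Rightarrow> real) set \<Rightarrow> ('a \<Rightarrow> real) set" where
  "mixtures m Q = {(\<lambda>x. \<Sum>j=1..m. \<pi> j * q j x) | \<pi> q.
     (\<forall>j\<in>{1..m}. q j \<in> Q \<and> 0 \<le> \<pi> j) \<and> (\<Sum>j=1..m. \<pi> j) = 1}"

definition shatters :: "'b set set \<Rightarrow> 'b set \<Rightarrow> bool" where
  "shatters \<C> A \<longleftrightarrow> (\<forall>B\<subseteq>A. \<exists>S\<in>\<C>. S \<inter> A = B)"

definition VC_dim_sets :: "'b set set \<Rightarrow> enat" where
  "VC_dim_sets \<C> = (SUP A\<in>{A. finite A \<and> shatters \<C> A}. enat (card A))"

definition subgraph :: "('a \<Rightarrow> real) \<Rightarrow> ('a \<times> real) set" where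
  "subgraph f = {(x, t). t \<le> f x}"

definition VC_dim :: "('a \<Rightarrow> real) set \<Rightarrow> enat" where
  "VC_dim F = VC_dim_sets (subgraph ` F)"

definition pointwise_measurable :: "('a \<Rightarrow> real) set \<Rightarrow> bool" where
  "pointwise_measurable F \<longleftrightarrow> (\<exists>F0\<subseteq>F. countable F0 \<and>
     (\<forall>f\<in>F. \<exists>g. (\<forall>k::nat. g k \<in> F0) \<and> (\<forall>x. (\<lambda>k. g k x) \<longlonglongrightarrow> f x)))"

text \<open>Membership in the space of \<open>k\<close> times continuously differentiable functions; it suffices
  to recurse on the partial derivatives.\<close>

primrec C_class :: "nat \<Rightarrow> ('a::euclidean_space \<Rightarrow> real) \<Rightarrow> bool" where
  "C_class 0 f \<longleftrightarrow> continuous_on UNIV f"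
| "C_class (Suc k) f \<longleftrightarrow> (\<forall>x. f differentiable (at x)) \<and>
     (\<forall>b\<in>Basis. C_class k (\<lambda>x. frechet_derivative f (at x) b))"

definition test_functions :: "('a::euclidean_space \<Rightarrow> real) set" where
  "test_functions = {\<psi>. (\<forall>k. C_class k \<psi>) \<and> compact (closure {x. \<psi> x \<noteq> 0})}"

text \<open>The weak partial derivative is only used for square-integrable \<open>f\<close> and \<open>g\<close>, so both
  integrals below exist.\<close>

definition is_weak_partial ::
    "('a::euclidean_space \<Rightarrow> real) \<Rightarrow> 'a \<Rightarrow> ('a \<Rightarrow> real) \<Rightarrow> bool" where
  "is_weak_partial f b g \<longleftrightarrow> (\<forall>\<psi>\<in>test_functions.
     (LINT x|lborel. f x * frechet_derivative \<psi> (at x) b) = - (LINT x|lborel. g x * \<psi> x))"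

definition sobolev_W12 :: "('a::euclidean_space \<Rightarrow> real) set" where
  "sobolev_W12 = {f \<in> L2_functions. \<forall>b\<in>Basis. \<exists>g\<in>L2_functions. is_weak_partial f b g}"

definition sobolev_frac :: "real \<Rightarrow> ('a::euclidean_space \<Rightarrow> real) set" where
  "sobolev_frac s = {f \<in> L2_functions.
     (\<integral>\<^sup>+x. (\<integral>\<^sup>+y. ennreal (\<bar>f x - f y\<bar>\<^sup>2 * norm (x - y) powr (- real DIM('a) - 2 * s)) \<partial>lborel) \<partial>lborel)
       < \<infinity>}"

definition sobolev :: "real \<Rightarrow> ('a::euclidean_space \<Rightarrow> real) set" where
  "sobolev s = (if s = 1 then sobolev_W12 else sobolev_frac s)"

definition empirical :: "(nat \<Rightarrow> 'w \<Rightarrow> 'a) \<Rightarrow> nat \<Rightarrow> 'w \<Rightarrow> ('a \<Rightarrow> real) \<Rightarrow> real" where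
  "empirical X n \<omega> f = (\<Sum>i=1..n. f (X i \<omega>)) / real n"

definition sample_algebra ::
    "'w measure \<Rightarrow> (nat \<Rightarrow> 'w \<Rightarrow> 'a::euclidean_space) \<Rightarrow> nat \<Rightarrow> 'w measure" where
  "sample_algebra P X n =
     vimage_algebra (space P) (\<lambda>\<omega>. \<lambda>i\<in>{1..n}. X i \<omega>) (PiM {1..n} (\<lambda>_. borel))"

definition L2_risk ::
    "(nat \<Rightarrow> 'w \<Rightarrow> 'a) \<Rightarrow> nat \<Rightarrow> 'w \<Rightarrow> ('a::euclidean_space \<Rightarrow> real) \<Rightarrow> real" where
  "L2_risk X n \<omega> f = (LINT x|lborel. (f x)\<^sup>2) - 2 * empirical X n \<omega> f"

definition lesssim :: "(nat \<Rightarrow> real) \<Rightarrow> (nat \<Rightarrow> real) \<Rightarrow> bool"  (infix "\<lesssim>" 50) where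
  "a \<lesssim> b \<longleftrightarrow> (\<exists>C>0. \<forall>n\<ge>1. a n \<le> C * b n)"

text \<open>Measurability is joint in the sample and the argument, so that \<open>L2_risk\<close> and the
  squared distance of \<open>fhat n\<close> to a fixed function are random variables. The infimum is taken in
  the reals; it is the true one whenever \<open>F n\<close> is nonempty and uniformly bounded, as is the case
  for mixtures of at least one component at a fixed scale of a bounded density.\<close>

definition approx_L2_minimizer ::
    "'w measure \<Rightarrow> (nat \<Rightarrow> 'w \<Rightarrow> 'a::euclidean_space) \<Rightarrow> (nat \<Rightarrow> ('a \<Rightarrow> real) set) \<Rightarrow>
     (nat \<Rightarrow> real) \<Rightarrow> (nat \<Rightarrow> 'w \<Rightarrow> 'a \<Rightarrow> real) \<Rightarrow> bool" where
  "approx_L2_minimizer P X F \<epsilon> fhat \<longleftrightarrow> (\<forall>n\<ge>1.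
     (\<lambda>(\<omega>, x). fhat n \<omega> x) \<in> borel_measurable (sample_algebra P X n \<Otimes>\<^sub>M borel) \<and>
     (\<forall>\<omega>\<in>space P. fhat n \<omega> \<in> F n) \<and>
     (AE \<omega> in P. L2_risk X n \<omega> (fhat n \<omega>) \<le> (INF f\<in>F n. L2_risk X n \<omega> f) + \<epsilon> n))"

end

theory Submission
  imports Defs
begin

text \<open>Up to the constant \<open>L2_sq f\<^sub>0\<close>, the squared distance of \<open>f\<close> to \<open>f\<^sub>0\<close> is \<open>L2_sq f\<close> minus twice the
  mean of \<open>f\<close> under the sampling law \<open>D\<close>, and the estimator minimizes this quantity with the
  empirical mean in place of the mean. Comparing it with any fixed competitor \<open>q\<close> in the mixture
  class therefore gives (\<open>basic_inequality\<close>)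
  \<open>dist\<^sup>2 (fhat, f\<^sub>0) \<le> dist\<^sup>2 (q, f\<^sub>0) + 4 Z + \<epsilon>\<close>, where \<open>Z\<close> is the largest deviation between
  empirical and true means over the class. Three terms of order \<open>n powr (- s / (2 s + d))\<close> remain.

  The competitor is built in two steps (\<open>mixture_approximation\<close>). Smoothing \<open>f\<^sub>0\<close> with the kernel
  rescaled by \<open>\<nu>\<close> costs \<open>O(\<nu> powr (-2 s))\<close>: a Sobolev function moves by \<open>O(|h| powr s)\<close> in mean
  square under translation by \<open>h\<close> (\<open>shift_modulus_sobolev\<close>), and a weighted
  Cauchy--Schwarz inequality turns this into a bound that uses only the moment of order \<open>s\<close> of the
  kernel (\<open>smoothing_bias\<close>). The smoothed density is an average of translates of the kernel, so
  Maurey's argument replaces it by a mixture of \<open>m\<close> of them at squared distance at most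
  \<open>\<nu> ^ d L2_sq \<phi> / m\<close> (\<open>maurey_translates\<close>).

  The deviation of a mixture is at most the worst deviation of its components. For the class of
  translates of a kernel bounded by \<open>\<nu> ^ d B\<close>, the expected supremum is \<open>O(\<nu> ^ d B / sqrt n)\<close>
  with a constant that depends only on the VC dimension (\<open>expected_sup_deviation\<close>). No logarithm
  may be lost here. Symmetrization and the layer-cake formula reduce the claim to a combinatorial
  one about signed sums over a family of subsets of a finite set, which is proved by chaining with
  the packing numbers of a VC family in the Hamming metric (\<open>rademacher_VC_family\<close>).

  With \<open>\<nu> = n powr (1 / (2 (2 s + d)))\<close> and \<open>m\<close> at least \<open>sqrt n\<close>, the three bounds have the
  same order.\<close>

section \<open>Vapnik--Chervonenkis combinatorics\<close>

lemma shatters_mono: "\<C> \<subseteq> \<D> \<Longrightarrow> shatters \<C> S \<Longrightarrow> shatters \<D> S"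
  unfolding shatters_def by (meson subsetD)

text \<open>Pajor's form of the Sauer--Shelah lemma. Split off a point \<open>y\<close>: the sets that occur with or
  without \<open>y\<close> (\<open>\<D>0\<close>) and those that occur both with and without it (\<open>\<D>1\<close>) together are as many as
  the members of \<open>\<D>\<close>, and a set shattered by \<open>\<D>1\<close> stays shattered by \<open>\<D>\<close> when \<open>y\<close> is added.\<close>

lemma card_le_card_shattered:
  fixes Y :: "'b set"
  assumes "finite Y" "\<D> \<subseteq> Pow Y"
  shows "card \<D> \<le> card {S. S \<subseteq> Y \<and> shatters \<D> S}"
  using assms
proof (induction Y arbitrary: \<D> rule: finite_induct)
  case empty
  then have "\<D> \<subseteq> {{}}" by simp
  then have "\<D> = {} \<or> \<D> = {{}}" by (rule subset_singletonD)
  moreover have "shatters {{}} ({} :: 'b set)" by (simp add: shatters_def)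
  then have "{S :: 'b set. S = {} \<and> shatters {{}} S} = {{}}" by auto
  ultimately show ?case by (elim disjE) simp_all
next
  case (insert y Y)
  let ?N = "{A \<in> \<D>. y \<notin> A}" and ?Y = "(\<lambda>A. A - {y}) ` {A \<in> \<D>. y \<in> A}"
  define \<D>0 \<D>1 where "\<D>0 = ?N \<union> ?Y" and "\<D>1 = ?N \<inter> ?Y"
  have fin: "finite \<D>"
    using insert.prems insert.hyps by (meson finite_Pow_iff finite_insert finite_subset)
  have sub0: "\<D>0 \<subseteq> Pow Y" and sub1: "\<D>1 \<subseteq> Pow Y" using insert.prems by (auto simp: \<D>0_def \<D>1_def)
  have card\<D>: "card \<D> = card \<D>0 + card \<D>1"
  proof -
    have "\<D> = ?N \<union> {A \<in> \<D>. y \<in> A}" by blast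
    then have "card \<D> = card ?N + card {A \<in> \<D>. y \<in> A}"
      using fin by (metis (no_types, lifting) card_Un_disjoint disjoint_iff finite_Un mem_Collect_eq)
    also have "card {A \<in> \<D>. y \<in> A} = card ?Y" by (intro card_image[symmetric] inj_onI) blast
    also have "card ?N + card ?Y = card \<D>0 + card \<D>1"
      unfolding \<D>0_def \<D>1_def using fin by (intro card_Un_Int) auto
    finally show ?thesis .
  qed
  let ?S0 = "{S. S \<subseteq> Y \<and> shatters \<D>0 S}" and ?S1 = "{S. S \<subseteq> Y \<and> shatters \<D>1 S}"
  have fS: "finite ?S0" "finite ?S1" "finite {S. S \<subseteq> insert y Y \<and> shatters \<D> S}"
    using insert.hyps by auto
  have "?S0 \<subseteq> {S. S \<subseteq> insert y Y \<and> shatters \<D> S}"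
  proof clarsimp
    fix S assume S: "S \<subseteq> Y" "shatters \<D>0 S"
    have yS: "y \<notin> S" using S insert.hyps by auto
    have "shatters \<D> S" unfolding shatters_def
    proof (intro allI impI)
      fix B assume "B \<subseteq> S"
      then have "\<exists>T\<in>\<D>0. T \<inter> S = B" using S unfolding shatters_def by simp
      then obtain A where "A \<in> \<D>" "A \<inter> S = B \<or> (A - {y}) \<inter> S = B" unfolding \<D>0_def by blast
      then show "\<exists>A\<in>\<D>. A \<inter> S = B" using yS by (intro bexI[of _ A]) auto
    qed
    then show "S \<subseteq> insert y Y \<and> shatters \<D> S" using S by auto
  qed
  moreover have "insert y ` ?S1 \<subseteq> {S. S \<subseteq> insert y Y \<and> shatters \<D> S}"
  proof (intro subsetI, elim imageE)
    fix T S assume S: "T = insert y S" "S \<in> ?S1"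
    have yS: "y \<notin> S" using S insert.hyps by auto
    have "shatters \<D> T" unfolding shatters_def
    proof (intro allI impI)
      fix B assume B: "B \<subseteq> T"
      then have "B - {y} \<subseteq> S" using S by auto
      then obtain A where A: "A \<in> \<D>1" "A \<inter> S = B - {y}"
        using S unfolding shatters_def by blast
      have mem: "A \<in> \<D>" "y \<notin> A" "insert y A \<in> \<D>" using A(1) by (auto simp: \<D>1_def insert_absorb)
      show "\<exists>A\<in>\<D>. A \<inter> T = B"
      proof (cases "y \<in> B")
        case True
        have "insert y A \<inter> T = B" using A True S B by auto
        then show ?thesis using mem by blast
      next
        case False
        have "A \<inter> T = B" using A False S B mem by auto
        then show ?thesis using mem by blast
      qed
    qed
    then show "T \<in> {S. S \<subseteq> insert y Y \<and> shatters \<D> S}" using S by auto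
  qed
  ultimately have "card (insert y ` ?S1 \<union> ?S0) \<le> card {S. S \<subseteq> insert y Y \<and> shatters \<D> S}"
    using fS by (intro card_mono) auto
  moreover have "card (insert y ` ?S1 \<union> ?S0) = card ?S1 + card ?S0"
  proof -
    have "card (insert y ` ?S1) = card ?S1"
      using insert.hyps by (intro card_image inj_onI) auto
    then show ?thesis
      using fS insert.hyps by (subst card_Un_disjoint) auto
  qed
  moreover have "card \<D>0 \<le> card ?S0" "card \<D>1 \<le> card ?S1"
    using insert.IH[OF sub0] insert.IH[OF sub1] by auto
  ultimately show ?case using card\<D> by linarith
qed

lemma card_subsets_le:
  assumes "finite Y" "card Y \<le> q"
  shows "card {S. S \<subseteq> Y \<and> card S \<le> V} \<le> (q + 1) ^ V"
proof -
  have "{S. S \<subseteq> Y \<and> card S \<le> V} = (\<Union>i\<le>V. {S. S \<subseteq> Y \<and> card S = i})" by auto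
  then have "card {S. S \<subseteq> Y \<and> card S \<le> V} \<le> (\<Sum>i\<le>V. card {S. S \<subseteq> Y \<and> card S = i})"
    by (simp add: card_UN_le)
  also have "\<dots> = (\<Sum>i\<le>V. card Y choose i)"
    using assms by (simp add: n_subsets)
  also have "\<dots> \<le> (\<Sum>i\<le>V. (V choose i) * q ^ i * 1 ^ (V - i))"
  proof (rule sum_mono)
    fix i assume "i \<in> {..V}"
    have "card Y choose i \<le> card Y ^ i"
      by (metis binomial_eq_0 binomial_le_pow not_le zero_le)
    also have "\<dots> \<le> q ^ i" using assms by (intro power_mono) auto
    also have "\<dots> \<le> (V choose i) * q ^ i"
      using \<open>i \<in> {..V}\<close> by (simp add: Suc_le_eq)
    finally show "card Y choose i \<le> (V choose i) * q ^ i * 1 ^ (V - i)" by simp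
  qed
  also have "\<dots> = (q + 1) ^ V"
    using binomial[of q 1 V] by simp
  finally show ?thesis .
qed

lemma card_traces_le:
  assumes Y: "finite Y" "card Y \<le> q"
    and VC: "\<And>S. S \<subseteq> Y \<Longrightarrow> shatters \<D> S \<Longrightarrow> card S \<le> V"
  shows "card ((\<lambda>A. A \<inter> Y) ` \<D>) \<le> (q + 1) ^ V"
proof -
  let ?T = "(\<lambda>A. A \<inter> Y) ` \<D>"
  have "shatters \<D> S" if "S \<subseteq> Y" "shatters ?T S" for S
    unfolding shatters_def
  proof (intro allI impI)
    fix B assume "B \<subseteq> S"
    then have "\<exists>T\<in>?T. T \<inter> S = B" using that unfolding shatters_def by blast
    then obtain A where "A \<in> \<D>" "A \<inter> Y \<inter> S = B" by blast
    then show "\<exists>A\<in>\<D>. A \<inter> S = B" using that by (intro bexI[of _ A]) auto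
  qed
  then have *: "{S. S \<subseteq> Y \<and> shatters ?T S} \<subseteq> {S. S \<subseteq> Y \<and> card S \<le> V}"
    using VC by auto
  have "card ?T \<le> card {S. S \<subseteq> Y \<and> shatters ?T S}"
    by (rule card_le_card_shattered) (use Y in auto)
  also have "\<dots> \<le> card {S. S \<subseteq> Y \<and> card S \<le> V}"
    using Y * by (intro card_mono) auto
  also have "\<dots> \<le> (q + 1) ^ V" by (rule card_subsets_le[OF Y])
  finally show ?thesis .
qed

text \<open>Dudley's argument: choose \<open>q\<close> points independently and uniformly. They miss the symmetric
  difference of a given pair with probability less than \<open>exp (- \<epsilon> q)\<close>, so for this \<open>q\<close> some choice
  hits the symmetric differences of all pairs. Probabilities are written as counts of functions
  from \<open>1..q\<close> to \<open>I\<close>.\<close>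

lemma exists_separating_points:
  fixes \<epsilon> :: real
  assumes I: "finite I" "I \<noteq> {}" and \<D>: "finite \<D>" "\<D> \<noteq> {}" "\<D> \<subseteq> Pow I"
    and sep: "\<And>A B. A \<in> \<D> \<Longrightarrow> B \<in> \<D> \<Longrightarrow> A \<noteq> B \<Longrightarrow> \<epsilon> * card I < card (sym_diff A B)"
    and \<epsilon>: "0 < \<epsilon>"
    and q: "2 * ln (card \<D>) \<le> \<epsilon> * q"
  shows "\<exists>Y\<subseteq>I. card Y \<le> q \<and> inj_on (\<lambda>A. A \<inter> Y) \<D>"
proof (rule ccontr)
  assume neg: "\<not> ?thesis"
  let ?G = "{1..q} \<rightarrow>\<^sub>E I"
  let ?P = "{(A, B). A \<in> \<D> \<and> B \<in> \<D> \<and> A \<noteq> B}"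
  let ?M = "\<lambda>(A, B). {1..q} \<rightarrow>\<^sub>E (I - sym_diff A B)"
  let ?n = "card I" and ?N = "card \<D>"
  have n: "0 < ?n" using I by (simp add: card_gt_0_iff)
  have N: "0 < ?N" using \<D> by (simp add: card_gt_0_iff)
  have "finite (\<D> \<times> \<D>)" using \<D> by simp
  then have finP: "finite ?P" by (rule finite_subset[rotated]) auto
  have P_less: "card ?P < ?N * ?N"
  proof -
    obtain A where "A \<in> \<D>" using \<D> by auto
    then have "?P \<subset> \<D> \<times> \<D>" by blast
    then have "card ?P < card (\<D> \<times> \<D>)" by (intro psubset_card_mono) (use \<D> in auto)
    then show ?thesis by (simp add: card_cartesian_product)
  qed
  have sub: "?G \<subseteq> (\<Union>p\<in>?P. ?M p)"
  proof
    fix g assume g: "g \<in> ?G"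
    let ?Y = "g ` {1..q}"
    have "?Y \<subseteq> I" "card ?Y \<le> q"
      using g card_image_le[of "{1..q}" g] by (auto simp: PiE_iff)
    then have "\<not> inj_on (\<lambda>A. A \<inter> ?Y) \<D>" using neg by blast
    then obtain A B where "A \<in> \<D>" "B \<in> \<D>" "A \<noteq> B" "A \<inter> ?Y = B \<inter> ?Y"
      unfolding inj_on_def by blast
    moreover have "g \<in> ?M (A, B)"
      using g \<open>A \<inter> ?Y = B \<inter> ?Y\<close> by (auto simp: PiE_iff)
    ultimately show "g \<in> (\<Union>p\<in>?P. ?M p)" by blast
  qed
  have M: "real (card (?M p)) \<le> (?n * exp (- \<epsilon>)) ^ q" if "p \<in> ?P" for p
  proof -
    obtain A B where "p = (A, B)" by (cases p)
    then have p: "p = (A, B)" "A \<in> \<D>" "B \<in> \<D>" "A \<noteq> B" using that by simp_all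
    have subI: "sym_diff A B \<subseteq> I" using p \<D> by auto
    have "card (I - sym_diff A B) = ?n - card (sym_diff A B)"
      using I subI by (meson card_Diff_subset finite_subset)
    moreover have "card (sym_diff A B) \<le> ?n" using I(1) subI by (rule card_mono)
    ultimately have "real (card (I - sym_diff A B)) = ?n - real (card (sym_diff A B))"
      by simp
    also have "\<dots> \<le> ?n * (1 - \<epsilon>)"
      using sep[of A B] p by (simp add: algebra_simps)
    also have "\<dots> \<le> ?n * exp (- \<epsilon>)"
      using exp_ge_add_one_self[of "- \<epsilon>"] by (intro mult_left_mono) auto
    finally have "real (card (I - sym_diff A B)) ^ q \<le> (?n * exp (- \<epsilon>)) ^ q"
      by (intro power_mono) auto
    then show ?thesis using p by (simp add: card_PiE)
  qed
  have "real ?n ^ q = card ?G" by (simp add: card_PiE)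
  also have "\<dots> \<le> card (\<Union>p\<in>?P. ?M p)"
    using finP sub I by (intro of_nat_mono card_mono finite_UN_I) (auto intro!: finite_PiE)
  also have "\<dots> \<le> (\<Sum>p\<in>?P. real (card (?M p)))"
    using card_UN_le[OF finP, of ?M] by (simp flip: of_nat_sum)
  also have "\<dots> \<le> real (card ?P) * (?n * exp (- \<epsilon>)) ^ q"
    using sum_bounded_above[of ?P "\<lambda>p. real (card (?M p))", OF M] by simp
  also have "\<dots> < real (?N * ?N) * (?n * exp (- \<epsilon>)) ^ q"
    using P_less n by (intro mult_strict_right_mono) (auto simp flip: of_nat_mult)
  also have "\<dots> = real ?n ^ q * (real ?N ^ 2 * exp (- (\<epsilon> * q)))"
    by (simp add: power_mult_distrib power2_eq_square exp_of_nat_mult[symmetric] mult_ac)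
  also have "\<dots> \<le> real ?n ^ q * 1"
  proof (intro mult_left_mono)
    have "real ?N ^ 2 = exp (2 * ln ?N)"
      using N by (simp add: exp_double[of "ln (real ?N)"])
    then show "real ?N ^ 2 * exp (- (\<epsilon> * q)) \<le> 1"
      using q by (simp flip: exp_add)
  qed auto
  finally show False by simp
qed

text \<open>The value solves the self-bounding inequality \<open>L \<le> W ln (2 (L + 1) 4 ^ k)\<close> for \<open>W = V + 1\<close> after
  \<open>ln (L + 1)\<close> is replaced by its tangent of slope \<open>1 / (2 W)\<close>. Taking \<open>V + 1\<close> in place of \<open>V\<close> avoids
  a case distinction for \<open>V = 0\<close>.\<close>

definition packing_constant :: "nat \<Rightarrow> real" where
  "packing_constant V = 2 * real (Suc V) * (ln 2 + ln 4 + ln (2 * real (Suc V))) + 1"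

lemma packing_constant_ge_1: "1 \<le> packing_constant V"
  by (simp add: packing_constant_def)

text \<open>A family separated at scale \<open>card I / 4 ^ k\<close> is determined by its traces on about
  \<open>2 * 4 ^ k * ln (card \<D>)\<close> points, and there are only polynomially many traces. The cardinality
  thus bounds itself through its own logarithm.\<close>

lemma ln_card_packing_le:
  assumes I: "finite I" "I \<noteq> {}" and \<D>: "finite \<D>" "\<D> \<noteq> {}" "\<D> \<subseteq> Pow I"
    and sep: "\<And>A B. A \<in> \<D> \<Longrightarrow> B \<in> \<D> \<Longrightarrow> A \<noteq> B \<Longrightarrow> card I / 4 ^ k < card (sym_diff A B)"
    and VC: "\<And>S. S \<subseteq> I \<Longrightarrow> shatters \<D> S \<Longrightarrow> card S \<le> V"
  shows "ln (card \<D>) \<le> packing_constant V * (real k + 1)"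
proof -
  define W where "W = real (Suc V)"
  define L where "L = ln (card \<D>)"
  define q where "q = nat \<lceil>2 * L * 4 ^ k\<rceil>"
  have N: "1 \<le> card \<D>" using \<D> by (simp add: Suc_leI card_gt_0_iff)
  have L: "0 \<le> L" using N by (simp add: L_def)
  have W: "1 \<le> W" by (simp add: W_def)
  have qL: "2 * L * 4 ^ k \<le> q" by (simp add: q_def of_nat_nat L)
  have "\<exists>Y\<subseteq>I. card Y \<le> q \<and> inj_on (\<lambda>A. A \<inter> Y) \<D>"
  proof (rule exists_separating_points[OF I \<D>, where \<epsilon> = "1 / 4 ^ k"])
    show "2 * ln (card \<D>) \<le> 1 / 4 ^ k * q"
      using qL by (simp add: L_def field_simps)
  qed (use sep in auto)
  then obtain Y where Y: "Y \<subseteq> I" "card Y \<le> q" "inj_on (\<lambda>A. A \<inter> Y) \<D>" by blast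
  have "card \<D> = card ((\<lambda>A. A \<inter> Y) ` \<D>)" using Y by (simp add: card_image)
  also have "\<dots> \<le> (q + 1) ^ V"
    using Y I VC by (intro card_traces_le) (auto intro: finite_subset)
  also have "\<dots> \<le> (q + 1) ^ Suc V" by (intro power_increasing) auto
  finally have "real (card \<D>) \<le> real (q + 1) ^ Suc V"
    by (metis of_nat_mono of_nat_power)
  then have "L \<le> ln (real (q + 1) ^ Suc V)"
    using N unfolding L_def by (subst ln_le_cancel_iff) auto
  also have "\<dots> = W * ln (real q + 1)" unfolding W_def by (subst ln_realpow) (auto simp: add.commute)
  also have "\<dots> \<le> W * ln (2 * (L + 1) * 4 ^ k)"
  proof (intro mult_left_mono)
    have "real q \<le> 2 * L * 4 ^ k + 1" unfolding q_def using of_int_ceiling_le_add_one[of "2 * L * 4 ^ k"] L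
      by (simp add: of_nat_nat)
    moreover have "(1::real) \<le> 4 ^ k" by simp
    moreover have "2 * (L + 1) * 4 ^ k = 2 * L * 4 ^ k + 2 * 4 ^ k" by (simp add: algebra_simps)
    ultimately have "real q + 1 \<le> 2 * (L + 1) * 4 ^ k" by linarith
    then show "ln (real q + 1) \<le> ln (2 * (L + 1) * 4 ^ k)" by (subst ln_le_cancel_iff) (use L in auto)
  qed (use W in auto)
  also have "\<dots> = W * (ln 2 + ln (L + 1) + k * ln 4)"
    using L by (simp only: ln_mult_pos ln_realpow zero_less_power zero_less_numeral mult_pos_pos add_nonneg_pos zero_less_one)
  also have "\<dots> \<le> W * (ln 2 + ((L + 1) / (2 * W) + ln (2 * W)) + k * ln 4)"
  proof -
    have "ln (L + 1) = ln ((L + 1) / (2 * W)) + ln (2 * W)"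
      using L W by (simp add: ln_div)
    also have "ln ((L + 1) / (2 * W)) \<le> (L + 1) / (2 * W) - 1"
      using L W by (intro ln_le_minus_one) auto
    finally show ?thesis using W by (intro mult_left_mono) auto
  qed
  also have "\<dots> = W * (ln 2 + ln (2 * W) + k * ln 4) + (L + 1) / 2"
    using W by (simp add: field_simps)
  finally have "L \<le> 2 * W * (ln 2 + ln (2 * W) + k * ln 4) + 1" by (simp add: field_simps)
  also have "\<dots> \<le> 2 * W * ((ln 2 + ln 4 + ln (2 * W)) * (real k + 1)) + 1 * (real k + 1)"
  proof -
    have "0 \<le> ln 2 * real k" "0 \<le> ln (2 * W) * real k" "0 \<le> ln (4::real)" using W by auto
    then have "ln 2 + ln (2 * W) + k * ln 4 \<le> (ln 2 + ln 4 + ln (2 * W)) * (real k + 1)"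
      by (simp add: algebra_simps)
    then show ?thesis using W by (intro add_mono mult_left_mono) auto
  qed
  also have "\<dots> = packing_constant V * (real k + 1)" by (simp add: packing_constant_def W_def algebra_simps)
  finally show ?thesis by (simp add: L_def)
qed

section \<open>Rademacher averages of a Vapnik--Chervonenkis family\<close>

definition signs :: "'i set \<Rightarrow> ('i \<Rightarrow> real) set" where
  "signs I = (I \<rightarrow>\<^sub>E {-1, 1})"

lemma finite_signs: "finite I \<Longrightarrow> finite (signs I)"
  by (simp add: signs_def finite_PiE)

lemma card_signs: "finite I \<Longrightarrow> card (signs I) = 2 ^ card I"
  by (simp add: signs_def card_PiE card_insert_if numeral_2_eq_2)

lemma abs_sign: "\<sigma> \<in> signs I \<Longrightarrow> i \<in> I \<Longrightarrow> \<bar>\<sigma> i\<bar> = 1"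
  by (fastforce simp: signs_def PiE_iff)

text \<open>This is Hoeffding's lemma for a fair sign.\<close>

lemma exp_add_exp_minus_le: "exp x + exp (- x) \<le> 2 * exp (x\<^sup>2 / 2)" for x :: real
proof -
  have *: "exp y + exp (- y) \<le> 2 * exp (y\<^sup>2 / 2)" if "0 \<le> y" for y :: real
  proof -
    have "- y + ln (1 + 1/2 * (exp (2 * y) - 1)) \<le> y\<^sup>2 / 2"
      using Hoeffdings_lemma_aux[of "2 * y" "1/2"] that by (simp add: power_mult_distrib)
    then have "ln ((1 + exp (2 * y)) / 2) \<le> y\<^sup>2 / 2 + y" by (simp add: field_simps)
    then have "exp (ln ((1 + exp (2 * y)) / 2)) \<le> exp (y\<^sup>2 / 2 + y)" by simp
    moreover have "0 < (1 + exp (2 * y)) / 2" by (simp add: add_pos_pos)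
    then have "exp (ln ((1 + exp (2 * y)) / 2)) = (1 + exp (2 * y)) / 2" by (rule exp_ln)
    ultimately have "(1 + exp (2 * y)) / 2 \<le> exp (y\<^sup>2 / 2 + y)" by simp
    then have "1 + exp (2 * y) \<le> 2 * exp (y\<^sup>2 / 2 + y)" by simp
    then have "(1 + exp (2 * y)) * exp (- y) \<le> 2 * exp (y\<^sup>2 / 2 + y) * exp (- y)"
      by (intro mult_right_mono) auto
    then show ?thesis by (simp add: algebra_simps flip: exp_add)
  qed
  show ?thesis using *[of x] *[of "- x"] by (cases "0 \<le> x") (auto simp: add.commute)
qed

lemma sum_exp_signs_le:
  fixes c :: "'i \<Rightarrow> real"
  assumes "finite I" "(\<Sum>i\<in>I. (c i)\<^sup>2) \<le> v"
  shows "(\<Sum>\<sigma>\<in>signs I. exp (l * (\<Sum>i\<in>I. c i * \<sigma> i))) \<le> 2 ^ card I * exp (l\<^sup>2 * v / 2)"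
proof -
  have "(\<Sum>\<sigma>\<in>signs I. exp (l * (\<Sum>i\<in>I. c i * \<sigma> i))) = (\<Sum>\<sigma>\<in>signs I. \<Prod>i\<in>I. exp (l * c i * \<sigma> i))"
    using assms by (simp add: sum_distrib_left exp_sum mult.assoc)
  also have "\<dots> = (\<Prod>i\<in>I. \<Sum>y\<in>{-1, 1}. exp (l * c i * y))"
    unfolding signs_def using assms by (subst prod_sum_PiE) auto
  also have "\<dots> \<le> (\<Prod>i\<in>I. 2 * exp ((l * c i)\<^sup>2 / 2))"
    using exp_add_exp_minus_le[of "l * c _"] by (intro prod_mono) (auto simp: add.commute add_nonneg_nonneg)
  also have "\<dots> = 2 ^ card I * exp (l\<^sup>2 * (\<Sum>i\<in>I. (c i)\<^sup>2) / 2)"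
    using assms
    by (simp add: prod.distrib exp_sum[symmetric] sum_distrib_left sum_divide_distrib power_mult_distrib)
  also have "\<dots> \<le> 2 ^ card I * exp (l\<^sup>2 * v / 2)"
    using assms by (intro mult_left_mono) (auto intro!: divide_right_mono mult_left_mono)
  finally show ?thesis .
qed

text \<open>The empirical processes below are maxima of absolute values over finite index sets; \<open>max_abs\<close>
  collects the few facts about them.\<close>

definition max_abs :: "'j set \<Rightarrow> ('j \<Rightarrow> real) \<Rightarrow> real" where
  "max_abs J g = Max ((\<lambda>j. \<bar>g j\<bar>) ` J)"

lemma max_abs_ge: "finite J \<Longrightarrow> j \<in> J \<Longrightarrow> \<bar>g j\<bar> \<le> max_abs J g"
  unfolding max_abs_def by (intro Max_ge) auto

lemma max_abs_attained:
  assumes "finite J" "J \<noteq> {}"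
  obtains j where "j \<in> J" "max_abs J g = \<bar>g j\<bar>"
proof -
  have "max_abs J g \<in> (\<lambda>j. \<bar>g j\<bar>) ` J" unfolding max_abs_def using assms by (intro Max_in) auto
  then show ?thesis using that by auto
qed

lemma max_abs_le:
  assumes "finite J" "J \<noteq> {}" "\<And>j. j \<in> J \<Longrightarrow> \<bar>g j\<bar> \<le> c"
  shows "max_abs J g \<le> c"
  using max_abs_attained[OF assms(1,2), of g] assms(3) by metis

lemma max_abs_nonneg: "finite J \<Longrightarrow> J \<noteq> {} \<Longrightarrow> 0 \<le> max_abs J g"
  using max_abs_attained[of J g] abs_ge_zero by metis

lemma max_abs_mono: "finite K \<Longrightarrow> J \<noteq> {} \<Longrightarrow> J \<subseteq> K \<Longrightarrow> max_abs J g \<le> max_abs K g"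
  by (meson finite_subset max_abs_ge max_abs_le subsetD)

lemma max_abs_cong: "(\<And>j. j \<in> J \<Longrightarrow> \<bar>g j\<bar> = \<bar>h j\<bar>) \<Longrightarrow> max_abs J g = max_abs J h"
  unfolding max_abs_def by (intro arg_cong[where f=Max] image_cong) auto

lemma borel_measurable_max_abs:
  "finite J \<Longrightarrow> (\<And>j. j \<in> J \<Longrightarrow> g j \<in> borel_measurable M) \<Longrightarrow> (\<lambda>x. max_abs J (\<lambda>j. g j x)) \<in> borel_measurable M"
  unfolding max_abs_def by (intro borel_measurable_Max borel_measurable_abs)

text \<open>Massart's maximal inequality: exponential moments bound the maximum of \<open>N\<close> sub-Gaussian
  sums by about the logarithm of \<open>N\<close>. The tangent inequality \<open>y \<le> ln L + exp y / L - 1\<close>, used at the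
  value \<open>L\<close> that bounds the exponential moment, takes the place of Jensen's inequality.\<close>

lemma sum_signs_max_abs_le:
  fixes c :: "'j \<Rightarrow> 'i \<Rightarrow> real"
  assumes I: "finite I" and J: "finite J" "J \<noteq> {}"
    and v: "\<And>j. j \<in> J \<Longrightarrow> (\<Sum>i\<in>I. (c j i)\<^sup>2) \<le> v" and l: "0 < l"
  shows "(\<Sum>\<sigma>\<in>signs I. max_abs J (\<lambda>j. \<Sum>i\<in>I. c j i * \<sigma> i))
      \<le> 2 ^ card I * ((ln (2 * card J) + l\<^sup>2 * v / 2) / l)"
proof -
  let ?Z = "\<lambda>\<sigma> j. \<Sum>i\<in>I. c j i * \<sigma> i"
  let ?m = "\<lambda>\<sigma>. max_abs J (?Z \<sigma>)" and ?e = "\<lambda>\<sigma> j. exp (l * ?Z \<sigma> j) + exp ((- l) * ?Z \<sigma> j)"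
  define L where "L = 2 * card J * exp (l\<^sup>2 * v / 2)"
  have cJ: "0 < card J" using J by (simp add: card_gt_0_iff)
  then have L: "0 < L" by (simp add: L_def)
  have tangent: "l * ?m \<sigma> \<le> ln L + exp (l * ?m \<sigma>) / L - 1" for \<sigma>
    using L ln_le_minus_one[of "exp (l * ?m \<sigma>) / L"] by (simp add: ln_div)
  have exp_max: "exp (l * ?m \<sigma>) \<le> (\<Sum>j\<in>J. ?e \<sigma> j)" for \<sigma>
  proof -
    obtain j where j: "j \<in> J" "?m \<sigma> = \<bar>?Z \<sigma> j\<bar>" using max_abs_attained[OF J] .
    have "exp (l * \<bar>?Z \<sigma> j\<bar>) \<le> ?e \<sigma> j"
      by (cases "0 \<le> ?Z \<sigma> j") (auto intro: add_increasing add_increasing2)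
    also have "\<dots> \<le> (\<Sum>j\<in>J. ?e \<sigma> j)"
      using j J by (intro member_le_sum[where f="?e \<sigma>"]) (auto simp: add_nonneg_nonneg)
    finally show ?thesis using j by simp
  qed
  have "(\<Sum>\<sigma>\<in>signs I. exp (l * ?m \<sigma>)) \<le> (\<Sum>\<sigma>\<in>signs I. \<Sum>j\<in>J. ?e \<sigma> j)"
    by (intro sum_mono exp_max)
  also have "\<dots> = (\<Sum>j\<in>J. (\<Sum>\<sigma>\<in>signs I. exp (l * ?Z \<sigma> j)) + (\<Sum>\<sigma>\<in>signs I. exp ((- l) * ?Z \<sigma> j)))"
    by (subst sum.swap) (simp add: sum.distrib)
  also have "\<dots> \<le> (\<Sum>j\<in>J. 2 ^ card I * exp (l\<^sup>2 * v / 2) + 2 ^ card I * exp (l\<^sup>2 * v / 2))"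
  proof (intro sum_mono add_mono)
    fix j assume "j \<in> J"
    then show "(\<Sum>\<sigma>\<in>signs I. exp (l * ?Z \<sigma> j)) \<le> 2 ^ card I * exp (l\<^sup>2 * v / 2)"
      "(\<Sum>\<sigma>\<in>signs I. exp ((- l) * ?Z \<sigma> j)) \<le> 2 ^ card I * exp (l\<^sup>2 * v / 2)"
      using sum_exp_signs_le[OF I v, of j l] sum_exp_signs_le[OF I v, of j "- l"] by simp_all
  qed
  also have "\<dots> = 2 ^ card I * L" by (simp add: L_def)
  finally have avg: "(\<Sum>\<sigma>\<in>signs I. exp (l * ?m \<sigma>)) \<le> 2 ^ card I * L" .
  have "l * (\<Sum>\<sigma>\<in>signs I. ?m \<sigma>) \<le> (\<Sum>\<sigma>\<in>signs I. (ln L - 1) + exp (l * ?m \<sigma>) / L)"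
    unfolding sum_distrib_left using tangent by (intro sum_mono) (simp add: algebra_simps)
  also have "\<dots> = 2 ^ card I * (ln L - 1) + (\<Sum>\<sigma>\<in>signs I. exp (l * ?m \<sigma>)) / L"
    using I by (simp add: sum.distrib card_signs sum_divide_distrib)
  also have "\<dots> \<le> 2 ^ card I * (ln L - 1) + 2 ^ card I"
    using avg L by (simp add: field_simps)
  also have "\<dots> = 2 ^ card I * ln L" by (simp add: algebra_simps)
  also have "ln L = ln (2 * card J) + l\<^sup>2 * v / 2"
    using cJ unfolding L_def by (simp add: ln_mult)
  finally show ?thesis using l by (simp add: field_simps)
qed

text \<open>A maximal \<open>\<delta>\<close>-separated subfamily is at the same time a \<open>\<delta>\<close>-net, so packing numbers bound the
  size of the nets used for chaining.\<close>

definition separated_net :: "real \<Rightarrow> 'i set set \<Rightarrow> 'i set set \<Rightarrow> bool" where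
  "separated_net \<delta> \<A> \<D> \<longleftrightarrow> \<D> \<subseteq> \<A> \<and> \<D> \<noteq> {} \<and>
     (\<forall>A\<in>\<D>. \<forall>B\<in>\<D>. A \<noteq> B \<longrightarrow> \<delta> < real (card (sym_diff A B))) \<and>
     (\<forall>A\<in>\<A>. A \<notin> \<D> \<longrightarrow> (\<exists>B\<in>\<D>. real (card (sym_diff A B)) \<le> \<delta>))"

lemma exists_separated_net:
  assumes "finite \<A>" "\<A> \<noteq> {}"
  shows "\<exists>\<D>. separated_net \<delta> \<A> \<D>"
proof -
  define S where "S = {\<D>. \<D> \<subseteq> \<A> \<and> (\<forall>A\<in>\<D>. \<forall>B\<in>\<D>. A \<noteq> B \<longrightarrow> \<delta> < card (sym_diff A B))}"
  have "finite S" using assms by (auto simp: S_def)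
  moreover have "{} \<in> S" by (auto simp: S_def)
  ultimately obtain \<D> where \<D>: "\<D> \<in> S" "\<And>\<E>. \<E> \<in> S \<Longrightarrow> \<D> \<subseteq> \<E> \<Longrightarrow> \<D> = \<E>"
    using finite_has_maximal[of S] by auto
  have cover: "\<exists>B\<in>\<D>. card (sym_diff A B) \<le> \<delta>" if A: "A \<in> \<A>" "A \<notin> \<D>" for A
  proof (rule ccontr)
    assume "\<not> ?thesis"
    then have far: "\<forall>B\<in>\<D>. \<delta> < card (sym_diff A B)" by force
    moreover have "sym_diff B A = sym_diff A B" for B by blast
    ultimately have "insert A \<D> \<in> S" using \<D>(1) A by (simp add: S_def)
    then show False using \<D>(2)[of "insert A \<D>"] A by auto
  qed
  moreover have "\<D> \<noteq> {}" using cover assms by (cases "\<D> = {}") auto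
  ultimately show ?thesis using \<D>(1) by (intro exI[of _ \<D>]) (simp add: S_def separated_net_def)
qed

definition chaining_constant :: "nat \<Rightarrow> real" where
  "chaining_constant V = 4 * (packing_constant V + ln 2 + 2)"

lemma chaining_constant_pos: "0 < chaining_constant V"
  using packing_constant_ge_1[of V] ln_gt_zero[of "2::real"]
  by (simp add: chaining_constant_def del: ln_gt_zero_iff)

text \<open>Chaining. With nets of \<open>\<A>\<close> at the Hamming scales \<open>n / 4 ^ k\<close>, passing from level \<open>k\<close> to level
  \<open>k + 1\<close> changes a signed sum by a signed sum of at most \<open>n / 4 ^ k\<close> terms, over a number of pairs
  whose logarithm is \<open>O(k)\<close>. The maximal inequality with parameter \<open>2 ^ k / sqrt n\<close> then charges
  \<open>O(k 2^(-k) sqrt n)\<close> to this step, and the sum over \<open>k\<close> converges; a single union bound over \<open>\<A>\<close>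
  would lose a logarithmic factor.\<close>

theorem rademacher_VC_family:
  fixes I :: "'i set"
  assumes I: "finite I" and \<A>: "\<A> \<noteq> {}" "\<A> \<subseteq> Pow I"
    and VC: "\<And>S. S \<subseteq> I \<Longrightarrow> shatters \<A> S \<Longrightarrow> card S \<le> V"
  shows "(\<Sum>\<sigma>\<in>signs I. max_abs \<A> (sum \<sigma>)) \<le> 2 ^ card I * (chaining_constant V * sqrt (card I))"
proof (cases "I = {}")
  case True
  then have "\<A> = {{}}" using \<A> by auto
  then show ?thesis using True by (simp add: signs_def max_abs_def)
next
  case False
  define c where "c = packing_constant V"
  have c: "1 \<le> c" by (simp add: c_def packing_constant_ge_1)
  have fin\<A>: "finite \<A>" using I \<A> by (meson finite_Pow_iff finite_subset)
  define R where "R \<D> = (\<Sum>\<sigma>\<in>signs I. max_abs \<D> (sum \<sigma>))" for \<D>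
  define n where "n = card I"
  have n: "0 < n" using I False by (simp add: n_def card_gt_0_iff)
  define \<D> where "\<D> k = (SOME \<D>. separated_net (n / 4 ^ k) \<A> \<D>)" for k :: nat
  have net: "separated_net (n / 4 ^ k) \<A> (\<D> k)" for k
    unfolding \<D>_def by (rule someI_ex[OF exists_separated_net[OF fin\<A> \<A>(1)]])
  have \<D>: "\<D> k \<subseteq> \<A>" "\<D> k \<noteq> {}"
    "\<And>A B. A \<in> \<D> k \<Longrightarrow> B \<in> \<D> k \<Longrightarrow> A \<noteq> B \<Longrightarrow> n / 4 ^ k < card (sym_diff A B)"
    "\<And>A. A \<in> \<A> \<Longrightarrow> A \<notin> \<D> k \<Longrightarrow> \<exists>B\<in>\<D> k. card (sym_diff A B) \<le> n / 4 ^ k" for k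
    using net[of k] unfolding separated_net_def by simp_all
  have fin\<D>: "finite (\<D> k)" for k using \<D>(1) fin\<A> finite_subset by blast
  have ln\<D>: "ln (card (\<D> k)) \<le> c * (real k + 1)" for k
    unfolding c_def
  proof (rule ln_card_packing_le[OF I False fin\<D> \<D>(2)])
    show "\<D> k \<subseteq> Pow I" using \<D>(1) \<A> by blast
    show "card I / 4 ^ k < card (sym_diff A B)" if "A \<in> \<D> k" "B \<in> \<D> k" "A \<noteq> B" for A B
      using \<D>(3)[OF that] by (simp add: n_def)
    show "card S \<le> V" if "S \<subseteq> I" "shatters (\<D> k) S" for S
      using VC[OF that(1) shatters_mono[OF \<D>(1) that(2)]] .
  qed
  have N: "0 < card (\<D> k)" for k using fin\<D> \<D>(2) by (simp add: card_gt_0_iff)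
  define near where
    "near k A = (if A \<in> \<D> k then A else SOME B. B \<in> \<D> k \<and> card (sym_diff A B) \<le> n / 4 ^ k)" for k A
  have near: "near k A \<in> \<D> k \<and> card (sym_diff A (near k A)) \<le> n / 4 ^ k" if "A \<in> \<A>" for k A
    using \<D>(4)[OF that, of k] someI_ex[of "\<lambda>B. B \<in> \<D> k \<and> card (sym_diff A B) \<le> n / 4 ^ k"]
    by (auto simp: near_def)
  have as_indicator: "sum \<sigma> A = (\<Sum>i\<in>I. indicator A i * \<sigma> i)" if "A \<in> \<A>" for A and \<sigma> :: "'i \<Rightarrow> real"
  proof -
    have "A \<subseteq> I" using that \<A> by blast
    then show ?thesis
      using I by (simp add: sum.inter_restrict[symmetric] indicator_def if_distrib Int_absorb1 cong: if_cong)
  qed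
  define t where "t k = (c * (real k + 1) + ln 2 + 2) / 2 ^ k" for k :: nat
  \<comment> \<open>At scale \<open>n\<close> no two sets are separated, so level \<open>0\<close> is a single signed sum; the generic
    bound on \<open>ln (card (\<D> 0))\<close> is good enough for it.\<close>
  have base: "R (\<D> 0) \<le> 2 ^ n * (sqrt n * t 0)"
  proof -
    let ?c = "\<lambda>A i. indicator A i :: real"
    have "R (\<D> 0) = (\<Sum>\<sigma>\<in>signs I. max_abs (\<D> 0) (\<lambda>A. \<Sum>i\<in>I. ?c A i * \<sigma> i))"
      unfolding R_def using as_indicator \<D>(1)[of 0] by (intro sum.cong refl max_abs_cong) (simp add: subset_eq)
    also have "\<dots> \<le> 2 ^ card I * ((ln (2 * card (\<D> 0)) + (1 / sqrt n)\<^sup>2 * n / 2) / (1 / sqrt n))"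
    proof (rule sum_signs_max_abs_le[OF I fin\<D> \<D>(2)])
      show "(\<Sum>i\<in>I. (?c A i)\<^sup>2) \<le> real n" for A
        using sum_bounded_above[of I "\<lambda>i. (?c A i)\<^sup>2" 1] by (simp add: n_def indicator_def)
    qed (use n in auto)
    also have "\<dots> = 2 ^ n * (sqrt n * (ln 2 + ln (card (\<D> 0)) + 1 / 2))"
      using n N[of 0] by (simp add: n_def power_divide ln_mult)
    also have "\<dots> \<le> 2 ^ n * (sqrt n * t 0)"
      using ln\<D>[of 0] by (intro mult_left_mono) (auto simp: t_def)
    finally show ?thesis .
  qed
  have step: "R (\<D> (Suc k)) \<le> R (\<D> k) + 2 ^ n * (sqrt n * t (Suc k))" for k
  proof -
    let ?c = "\<lambda>A i. indicator A i - indicator (near k A) i :: real"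
    let ?inc = "\<lambda>\<sigma> A. \<Sum>i\<in>I. ?c A i * \<sigma> i"
    have diff: "sum \<sigma> A = sum \<sigma> (near k A) + ?inc \<sigma> A" if "A \<in> \<A>" for A and \<sigma> :: "'i \<Rightarrow> real"
    proof -
      have "near k A \<in> \<A>" using near[OF that] \<D>(1) by blast
      then show ?thesis by (simp add: as_indicator that left_diff_distrib sum_subtractf)
    qed
    have "R (\<D> (Suc k)) \<le> (\<Sum>\<sigma>\<in>signs I. max_abs (\<D> k) (sum \<sigma>) + max_abs (\<D> (Suc k)) (?inc \<sigma>))"
      unfolding R_def
    proof (intro sum_mono max_abs_le)
      fix \<sigma> :: "'i \<Rightarrow> real" and A assume A: "A \<in> \<D> (Suc k)"
      then have "A \<in> \<A>" using \<D>(1) by blast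
      then have "\<bar>sum \<sigma> A\<bar> \<le> \<bar>sum \<sigma> (near k A)\<bar> + \<bar>?inc \<sigma> A\<bar>"
        unfolding diff[OF \<open>A \<in> \<A>\<close>, of \<sigma>] by (intro abs_triangle_ineq)
      also have "\<dots> \<le> max_abs (\<D> k) (sum \<sigma>) + max_abs (\<D> (Suc k)) (?inc \<sigma>)"
        using near[OF \<open>A \<in> \<A>\<close>] A fin\<D> max_abs_ge[of "\<D> k" "near k A" "sum \<sigma>"]
          max_abs_ge[of "\<D> (Suc k)" A "?inc \<sigma>"] by (intro add_mono) auto
      finally show "\<bar>sum \<sigma> A\<bar> \<le> \<dots>" .
    qed (use fin\<D> \<D>(2) in auto)
    also have "\<dots> = R (\<D> k) + (\<Sum>\<sigma>\<in>signs I. max_abs (\<D> (Suc k)) (?inc \<sigma>))"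
      by (simp add: sum.distrib R_def)
    also have "(\<Sum>\<sigma>\<in>signs I. max_abs (\<D> (Suc k)) (?inc \<sigma>))
      \<le> 2 ^ card I * ((ln (2 * card (\<D> (Suc k))) + (2 ^ Suc k / sqrt n)\<^sup>2 * (n / 4 ^ k) / 2) / (2 ^ Suc k / sqrt n))"
    proof (rule sum_signs_max_abs_le[OF I fin\<D> \<D>(2)])
      fix A assume "A \<in> \<D> (Suc k)"
      then have A: "A \<in> \<A>" using \<D>(1) by blast
      have subI: "sym_diff A (near k A) \<subseteq> I" using A near[OF A] \<D>(1) \<A> by blast
      have "(\<Sum>i\<in>I. (?c A i)\<^sup>2) = (\<Sum>i\<in>I. if i \<in> sym_diff A (near k A) then 1 else 0)"
        by (intro sum.cong refl) (auto simp: indicator_def)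
      also have "\<dots> = card (sym_diff A (near k A))"
        using subI I by (subst sum.inter_restrict[symmetric]) (simp_all add: Int_absorb1)
      also have "\<dots> \<le> n / 4 ^ k" using near[OF A] by simp
      finally show "(\<Sum>i\<in>I. (?c A i)\<^sup>2) \<le> n / 4 ^ k" .
    qed (use n in auto)
    also have "\<dots> = 2 ^ n * (sqrt n * ((ln 2 + ln (card (\<D> (Suc k))) + 2) / 2 ^ Suc k))"
    proof -
      have "(2 ^ Suc k / sqrt n)\<^sup>2 * (n / 4 ^ k) / 2 = (2::real)"
        using n by (simp add: power_divide power_mult_distrib power2_eq_square flip: power_mult_distrib)
      moreover have "ln (2 * real (card (\<D> (Suc k)))) = ln 2 + ln (card (\<D> (Suc k)))"
        using N[of "Suc k"] by (simp add: ln_mult)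
      ultimately show ?thesis by (simp add: n_def)
    qed
    also have "\<dots> \<le> 2 ^ n * (sqrt n * t (Suc k))"
      unfolding t_def using ln\<D>[of "Suc k"]
      by (intro mult_left_mono divide_right_mono) (auto simp: algebra_simps)
    finally show ?thesis by simp
  qed
  have chain: "R (\<D> k) \<le> 2 ^ n * (sqrt n * (\<Sum>j\<le>k. t j))" for k
  proof (induction k)
    case (Suc k)
    then show ?case using step[of k] by (simp add: algebra_simps)
  qed (use base in simp)
  have tsum: "(\<Sum>j\<le>k. t j) = c * (4 - (real k + 3) / 2 ^ k) + (ln 2 + 2) * (2 - 1 / 2 ^ k)" for k
  proof (induction k)
    case (Suc k)
    have "(\<Sum>j\<le>Suc k. t j) = c * (4 - (real k + 3) / 2 ^ k) + (ln 2 + 2) * (2 - 1 / 2 ^ k) + t (Suc k)"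
      using Suc.IH by simp
    also have "\<dots> = c * (4 - (real (Suc k) + 3) / 2 ^ Suc k) + (ln 2 + 2) * (2 - 1 / 2 ^ Suc k)"
      by (simp add: t_def field_simps)
    finally show ?case .
  qed (simp add: t_def)
  \<comment> \<open>At level \<open>n\<close> the scale \<open>n / 4 ^ n\<close> is below \<open>1\<close>, and the net is the whole family.\<close>
  have "\<A> = \<D> n"
  proof
    show "\<A> \<subseteq> \<D> n"
    proof (rule ccontr)
      assume "\<not> \<A> \<subseteq> \<D> n"
      then obtain A where A: "A \<in> \<A>" "A \<notin> \<D> n" by auto
      then obtain B where B: "B \<in> \<D> n" "card (sym_diff A B) \<le> n / 4 ^ n" using \<D>(4) by blast
      have "real n < 2 ^ n" by (rule of_nat_less_two_power)
      also have "\<dots> \<le> (4::real) ^ n" by (intro power_mono) auto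
      finally have "n / 4 ^ n < (1::real)" by simp
      then have "card (sym_diff A B) = 0" using B by linarith
      moreover have "finite (sym_diff A B)" using A B \<A> \<D>(1) I
        by (intro finite_subset[OF _ I]) blast
      ultimately have "A = B" by auto
      then show False using A B by simp
    qed
  qed (use \<D> in auto)
  then have "R \<A> \<le> 2 ^ n * (sqrt n * (\<Sum>j\<le>n. t j))" using chain[of n] by simp
  also have "\<dots> \<le> 2 ^ n * (sqrt n * (c * 4 + (ln 2 + 2) * 2))"
    unfolding tsum using c by (intro mult_left_mono add_mono) auto
  also have "\<dots> \<le> 2 ^ n * (sqrt n * chaining_constant V)"
    using c by (intro mult_left_mono) (auto simp: chaining_constant_def c_def)
  finally show ?thesis by (simp add: R_def n_def mult_ac)
qed

section \<open>Rademacher averages of a function class\<close>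

definition VC_at_most :: "nat \<Rightarrow> ('a \<Rightarrow> real) set \<Rightarrow> bool" where
  "VC_at_most V F \<longleftrightarrow> (\<forall>T. finite T \<longrightarrow> shatters (subgraph ` F) T \<longrightarrow> card T \<le> V)"

lemma VC_at_most_subset: "VC_at_most V F \<Longrightarrow> G \<subseteq> F \<Longrightarrow> VC_at_most V G"
  unfolding VC_at_most_def by (meson image_mono shatters_mono)

lemma VC_dim_finiteE:
  assumes "VC_dim F < \<infinity>"
  obtains V where "VC_at_most V F"
proof -
  obtain V where V: "VC_dim F = enat V" using assms by (cases "VC_dim F") auto
  have "card T \<le> V" if "finite T" "shatters (subgraph ` F) T" for T
  proof -
    have "enat (card T) \<le> VC_dim F"
      unfolding VC_dim_def VC_dim_sets_def using that by (intro SUP_upper) auto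
    then show ?thesis by (simp add: V)
  qed
  then show ?thesis by (intro that[of V]) (simp add: VC_at_most_def)
qed

text \<open>Points \<open>x i\<close> shattered by the superlevel sets at height \<open>t\<close> give points \<open>(x i, t)\<close> shattered by the
  subgraphs. Two equal points are never separated by a superlevel set, so \<open>x\<close> is injective on a
  shattered index set and no point is counted twice.\<close>

lemma VC_slices:
  assumes VC: "VC_at_most V F"
    and I: "finite I" and S: "S \<subseteq> I" "shatters ((\<lambda>f. {i\<in>I. t \<le> f (x i)}) ` F) S"
  shows "card S \<le> V"
proof -
  let ?p = "\<lambda>i. (x i, t)"
  have pick: "\<exists>f\<in>F. \<forall>i\<in>S. t \<le> f (x i) \<longleftrightarrow> i \<in> B" if "B \<subseteq> S" for B
  proof -
    have "\<exists>A\<in>(\<lambda>f. {i\<in>I. t \<le> f (x i)}) ` F. A \<inter> S = B"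
      using S(2) that unfolding shatters_def by simp
    then obtain f where f: "f \<in> F" "{i\<in>I. t \<le> f (x i)} \<inter> S = B" by blast
    then have "\<forall>i\<in>S. t \<le> f (x i) \<longleftrightarrow> i \<in> B" using S(1) by blast
    then show ?thesis using f(1) by blast
  qed
  have inj: "inj_on ?p S"
  proof (rule inj_onI)
    fix i j assume ij: "i \<in> S" "j \<in> S" "?p i = ?p j"
    have "{i} \<subseteq> S" using ij(1) by simp
    from pick[OF this] obtain f where "f \<in> F" and f: "\<forall>k\<in>S. t \<le> f (x k) \<longleftrightarrow> k \<in> {i}" by (rule bexE)
    have "x i = x j" using ij(3) by (rule Pair_inject)
    moreover have "t \<le> f (x i)" using bspec[OF f ij(1)] by simp
    ultimately have "t \<le> f (x j)" by (rule subst)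
    then have "j \<in> {i}" using bspec[OF f ij(2)] by (rule iffD1[rotated])
    then show "i = j" by simp
  qed
  have "shatters (subgraph ` F) (?p ` S)"
    unfolding shatters_def
  proof (intro allI impI)
    fix B assume B: "B \<subseteq> ?p ` S"
    have "{i\<in>S. ?p i \<in> B} \<subseteq> S" by simp
    from pick[OF this] obtain f where f: "f \<in> F" "\<forall>i\<in>S. t \<le> f (x i) \<longleftrightarrow> i \<in> {i\<in>S. ?p i \<in> B}"
      by (rule bexE)
    then have "subgraph f \<inter> ?p ` S = B" using B by (auto simp: subgraph_def)
    then show "\<exists>T\<in>subgraph ` F. T \<inter> ?p ` S = B" using f(1) by blast
  qed
  moreover have "finite S" using S(1) I by (rule finite_subset)
  ultimately have "card (?p ` S) \<le> V" using VC unfolding VC_at_most_def by blast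
  then show ?thesis using card_image[OF inj] by simp
qed

text \<open>The layer-cake formula \<open>f = \<integral>\<^sub>0\<^sup>B 1{t \<le> f} dt\<close> reduces functions to sets: for every height \<open>t\<close>
  the superlevel sets form a VC family with the same bound, and the maximum of an integral is at
  most the integral of the maxima.\<close>

lemma rademacher_VC_functions:
  fixes x :: "'i \<Rightarrow> 'a"
  assumes I: "finite I" and F: "finite F" "F \<noteq> {}" and VC: "VC_at_most V F"
    and bd: "\<And>f i. f \<in> F \<Longrightarrow> 0 \<le> f (x i) \<and> f (x i) \<le> B" and B: "0 \<le> B"
  shows "(\<Sum>\<sigma>\<in>signs I. max_abs F (\<lambda>f. \<Sum>i\<in>I. \<sigma> i * f (x i)))
    \<le> 2 ^ card I * (chaining_constant V * B * sqrt (card I))"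
proof -
  define slice where "slice \<sigma> t f = (\<Sum>i\<in>I. \<sigma> i * indicator {..f (x i)} t)"
    for \<sigma> :: "'i \<Rightarrow> real" and t :: real and f :: "'a \<Rightarrow> real"
  define g where "g \<sigma> t = max_abs F (slice \<sigma> t)" for \<sigma> t
  let ?K = "2 ^ card I * (chaining_constant V * sqrt (card I))"
  have g_meas [measurable]: "g \<sigma> \<in> borel_measurable borel" for \<sigma>
    unfolding g_def slice_def using F by (intro borel_measurable_max_abs) auto
  have g_bd: "\<bar>g \<sigma> t\<bar> \<le> card I" if "\<sigma> \<in> signs I" for \<sigma> t
  proof -
    obtain f where f: "f \<in> F" "g \<sigma> t = \<bar>slice \<sigma> t f\<bar>"
      unfolding g_def using max_abs_attained[OF F] .
    have "\<bar>slice \<sigma> t f\<bar> \<le> (\<Sum>i\<in>I. \<bar>\<sigma> i * indicator {..f (x i)} t\<bar>)"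
      unfolding slice_def by (rule sum_abs)
    also have "\<dots> \<le> (\<Sum>i\<in>I. 1)"
      using abs_sign[OF that] by (intro sum_mono) (auto simp: indicator_def)
    finally show ?thesis using f(2) by simp
  qed
  have Bi: "integrable lborel (\<lambda>t. indicator {0<..B} t * a)" for a :: real
    using B by (intro integrable_mult_left integrable_real_indicator) auto
  have g_int: "integrable lborel (\<lambda>t. indicator {0<..B} t * g \<sigma> t)" if "\<sigma> \<in> signs I" for \<sigma>
  proof (rule Bochner_Integration.integrable_bound[OF Bi])
    show "AE t in lborel. norm (indicator {0<..B} t * g \<sigma> t) \<le> norm (indicator {0<..B} t * real (card I))"
      using g_bd[OF that] by (auto simp: indicator_def)
  qed simp
  have layer: "max_abs F (\<lambda>f. \<Sum>i\<in>I. \<sigma> i * f (x i)) \<le> (LINT t|lborel. indicator {0<..B} t * g \<sigma> t)"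
    if \<sigma>: "\<sigma> \<in> signs I" for \<sigma>
  proof (rule max_abs_le[OF F])
    fix f assume f: "f \<in> F"
    have fi: "0 \<le> f (x i)" "f (x i) \<le> B" for i using bd[OF f] by auto
    have ii: "integrable lborel (indicator {0<..f (x i)} :: real \<Rightarrow> real)" for i
      using fi by (intro integrable_real_indicator) auto
    let ?s = "\<lambda>t. \<Sum>i\<in>I. \<sigma> i * indicator {0<..f (x i)} t"
    have "(\<Sum>i\<in>I. \<sigma> i * f (x i)) = (\<Sum>i\<in>I. \<sigma> i * (LINT t|lborel. indicator {0<..f (x i)} t))"
      using fi by (intro sum.cong) auto
    also have "\<dots> = (LINT t|lborel. ?s t)"
      using ii by (simp add: Bochner_Integration.integral_sum)
    finally have "\<bar>\<Sum>i\<in>I. \<sigma> i * f (x i)\<bar> \<le> (LINT t|lborel. \<bar>?s t\<bar>)"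
      by (simp only: integral_abs_bound)
    also have "\<dots> \<le> (LINT t|lborel. indicator {0<..B} t * g \<sigma> t)"
    proof (rule integral_mono)
      show "integrable lborel (\<lambda>t. \<bar>?s t\<bar>)"
        using ii by (intro integrable_abs Bochner_Integration.integrable_sum integrable_mult_right)
      show "\<bar>?s t\<bar> \<le> indicator {0<..B} t * g \<sigma> t" for t
      proof (cases "t \<in> {0<..B}")
        case True
        then have "?s t = slice \<sigma> t f"
          unfolding slice_def by (intro sum.cong) (auto simp: indicator_def)
        then show ?thesis using True max_abs_ge[OF F(1) f, of "slice \<sigma> t"] by (simp add: g_def)
      next
        case False
        then have "indicator {0<..f (x i)} t = (0::real)" for i
          using fi(2)[of i] by (auto simp: indicator_def)
        then have "?s t = 0" by simp
        then show ?thesis using False by simp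
      qed
    qed (rule g_int[OF \<sigma>])
    finally show "\<bar>\<Sum>i\<in>I. \<sigma> i * f (x i)\<bar> \<le> (LINT t|lborel. indicator {0<..B} t * g \<sigma> t)" .
  qed
  have sum_g: "(\<Sum>\<sigma>\<in>signs I. g \<sigma> t) \<le> ?K" for t
  proof -
    let ?A = "\<lambda>f. {i\<in>I. t \<le> f (x i)}"
    have "slice \<sigma> t f = sum \<sigma> (?A f)" for \<sigma> f
      unfolding slice_def sum.inter_filter[OF I] by (intro sum.cong) (auto simp: indicator_def)
    then have "(\<Sum>\<sigma>\<in>signs I. g \<sigma> t) = (\<Sum>\<sigma>\<in>signs I. max_abs (?A ` F) (sum \<sigma>))"
      unfolding g_def max_abs_def by (simp add: image_image)
    also have "\<dots> \<le> ?K"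
      by (rule rademacher_VC_family[OF I]) (use F VC_slices[OF VC I] in auto)
    finally show ?thesis .
  qed
  have "(\<Sum>\<sigma>\<in>signs I. max_abs F (\<lambda>f. \<Sum>i\<in>I. \<sigma> i * f (x i)))
      \<le> (\<Sum>\<sigma>\<in>signs I. LINT t|lborel. indicator {0<..B} t * g \<sigma> t)"
    by (intro sum_mono layer)
  also have "\<dots> = (LINT t|lborel. indicator {0<..B} t * (\<Sum>\<sigma>\<in>signs I. g \<sigma> t))"
    using g_int by (simp add: sum_distrib_left Bochner_Integration.integral_sum)
  also have "\<dots> \<le> (LINT t|lborel. indicator {0<..B} t * ?K)"
  proof (rule integral_mono[OF _ Bi])
    show "integrable lborel (\<lambda>t. indicator {0<..B} t * (\<Sum>\<sigma>\<in>signs I. g \<sigma> t))"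
      using g_int by (simp add: sum_distrib_left)
  qed (intro mult_left_mono sum_g, simp)
  also have "\<dots> = 2 ^ card I * (chaining_constant V * B * sqrt (card I))" using B by simp
  finally show ?thesis .
qed

section \<open>Symmetrization\<close>

text \<open>The means are replaced by an independent second sample, which only increases the expected
  maximum. The sample is indexed by \<open>1..n\<close> and its ghost by \<open>n+1..2n\<close>, and the joint law is
  invariant under exchanging \<open>i\<close> and \<open>i + n\<close>. Performing this exchange exactly where a sign is \<open>-1\<close>
  introduces arbitrary signs, over which one may average.\<close>

lemma symmetrization:
  fixes F :: "('a \<Rightarrow> real) set"
  assumes "prob_space D" and F: "finite F" "F \<noteq> {}" "\<And>f. f \<in> F \<Longrightarrow> f \<in> borel_measurable D"
    and bd: "\<And>f x. f \<in> F \<Longrightarrow> \<bar>f x\<bar> \<le> B"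
    and rad: "\<And>x :: nat \<Rightarrow> 'a. (\<Sum>\<sigma>\<in>signs {1..n}. max_abs F (\<lambda>f. \<Sum>i=1..n. \<sigma> i * f (x i))) \<le> 2 ^ n * R"
  shows "(\<integral>\<^sup>+x. ennreal (max_abs F (\<lambda>f. \<Sum>i=1..n. f (x i) - (LINT y|D. f y))) \<partial>PiM {1..n} (\<lambda>_. D)) \<le> ennreal (2 * R)"
proof -
  interpret D: prob_space D by fact
  interpret P: product_prob_space "\<lambda>_::nat. D" by unfold_locales
  define I J K where "I = {1..n}" and "J = {n+1..2*n}" and "K = I \<union> J"
  have IJ: "finite I" "finite J" "finite K" "I \<inter> J = {}" "card I = n" by (auto simp: I_def J_def K_def)
  have inK: "i \<in> K" "i + n \<in> K" "i + n \<in> J" "i + n \<notin> I" if "i \<in> I" for i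
    using that by (auto simp: I_def J_def K_def)
  let ?PI = "PiM I (\<lambda>_. D)" and ?PJ = "PiM J (\<lambda>_. D)" and ?PK = "PiM K (\<lambda>_. D)"
  interpret PJ: prob_space ?PJ by (intro prob_space_PiM D.prob_space_axioms)
  interpret PK: prob_space ?PK by (intro prob_space_PiM D.prob_space_axioms)
  let ?dev = "\<lambda>x f. \<Sum>i\<in>I. f (x i) - (LINT y|D. f y)"
  have comp: "(\<lambda>z. f (z i)) \<in> borel_measurable (PiM L (\<lambda>_. D))" if "f \<in> F" "i \<in> L" for f i and L :: "nat set"
    by (rule measurable_compose[OF measurable_component_singleton[OF that(2)] F(3)[OF that(1)]])
  define G where "G \<sigma> z = max_abs F (\<lambda>f. \<Sum>i\<in>I. \<sigma> i * (f (z i) - f (z (i + n))))" for \<sigma> z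
  define H where "H \<sigma> z = max_abs F (\<lambda>f. \<Sum>i\<in>I. \<sigma> i * f (z i))" for \<sigma> z
  have G_meas: "G \<sigma> \<in> borel_measurable ?PK" for \<sigma>
    unfolding G_def using F comp inK
    by (intro borel_measurable_max_abs borel_measurable_sum borel_measurable_times borel_measurable_diff
        borel_measurable_const) auto
  define u where "u = (\<lambda>i. if i \<in> I then 1 else undefined :: real)"
  have u: "u \<in> signs I" by (auto simp: u_def signs_def PiE_iff extensional_def)
  have u1: "u i = 1" if "i \<in> I" for i using that by (simp add: u_def)
  have swap: "(\<integral>\<^sup>+z. ennreal (G u z) \<partial>?PK) = (\<integral>\<^sup>+z. ennreal (G \<sigma> z) \<partial>?PK)" if \<sigma>: "\<sigma> \<in> signs I" for \<sigma>
  proof -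
    define \<pi> where "\<pi> k = (if k \<in> I then (if \<sigma> k = 1 then k else k + n) else (if \<sigma> (k - n) = 1 then k else k - n))" for k
    have \<sigma>_cases: "\<sigma> i = 1 \<or> \<sigma> i = -1" if "i \<in> I" for i using \<sigma> that by (auto simp: signs_def PiE_iff)
    have \<pi>K: "\<pi> \<in> K \<rightarrow> K" by (auto simp: \<pi>_def K_def I_def J_def)
    have inv: "\<pi> (\<pi> k) = k" if "k \<in> K" for k using that by (auto simp: \<pi>_def K_def I_def J_def)
    have inj: "inj_on \<pi> K" using inv by (metis inj_on_inverseI)
    have distr: "distr ?PK ?PK (\<lambda>z. \<lambda>k\<in>K. z (\<pi> k)) = ?PK"
      using distr_PiM_reindex[of K "\<lambda>_. D" \<pi> K] inj \<pi>K D.prob_space_axioms by simp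
    have "(\<integral>\<^sup>+z. ennreal (G u z) \<partial>?PK) = (\<integral>\<^sup>+z. ennreal (G u (\<lambda>k\<in>K. z (\<pi> k))) \<partial>?PK)"
      using \<pi>K by (subst distr[symmetric], subst nn_integral_distr)
        (auto intro!: G_meas measurable_compose[OF _ measurable_ennreal] measurable_restrict measurable_component_singleton)
    also have "\<dots> = (\<integral>\<^sup>+z. ennreal (G \<sigma> z) \<partial>?PK)"
    proof (rule nn_integral_cong)
      fix z :: "nat \<Rightarrow> 'a"
      have "u i * (f ((\<lambda>k\<in>K. z (\<pi> k)) i) - f ((\<lambda>k\<in>K. z (\<pi> k)) (i + n))) = \<sigma> i * (f (z i) - f (z (i + n)))"
        if "i \<in> I" for i and f :: "'a \<Rightarrow> real"
        using \<sigma>_cases[OF that] u1[OF that] inK[OF that] that by (auto simp: \<pi>_def)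
      then show "ennreal (G u (\<lambda>k\<in>K. z (\<pi> k))) = ennreal (G \<sigma> z)" unfolding G_def by (simp cong: sum.cong)
    qed
    finally show ?thesis .
  qed
  have GH: "G \<sigma> z \<le> H \<sigma> z + H \<sigma> (\<lambda>i. z (i + n))" for \<sigma> z
    unfolding G_def
  proof (rule max_abs_le[OF F(1,2)])
    fix f assume f: "f \<in> F"
    have "\<bar>\<Sum>i\<in>I. \<sigma> i * (f (z i) - f (z (i + n)))\<bar> \<le> \<bar>\<Sum>i\<in>I. \<sigma> i * f (z i)\<bar> + \<bar>\<Sum>i\<in>I. \<sigma> i * f (z (i + n))\<bar>"
      unfolding right_diff_distrib sum_subtractf by (rule abs_triangle_ineq4)
    also have "\<dots> \<le> H \<sigma> z + H \<sigma> (\<lambda>i. z (i + n))"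
      unfolding H_def using max_abs_ge[OF F(1) f, of "\<lambda>f. \<Sum>i\<in>I. \<sigma> i * f (z i)"]
        max_abs_ge[OF F(1) f, of "\<lambda>f. \<Sum>i\<in>I. \<sigma> i * f (z (i + n))"] by (rule add_mono)
    finally show "\<bar>\<Sum>i\<in>I. \<sigma> i * (f (z i) - f (z (i + n)))\<bar> \<le> \<dots>" .
  qed
  have "ennreal (2 ^ n) * (\<integral>\<^sup>+z. ennreal (G u z) \<partial>?PK) = (\<Sum>\<sigma>\<in>signs I. \<integral>\<^sup>+z. ennreal (G u z) \<partial>?PK)"
    using IJ by (simp add: card_signs ennreal_power[symmetric])
  also have "\<dots> = (\<Sum>\<sigma>\<in>signs I. \<integral>\<^sup>+z. ennreal (G \<sigma> z) \<partial>?PK)" by (intro sum.cong swap refl)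
  also have "\<dots> = (\<integral>\<^sup>+z. (\<Sum>\<sigma>\<in>signs I. ennreal (G \<sigma> z)) \<partial>?PK)"
    using G_meas by (intro nn_integral_sum[symmetric]) simp
  also have "\<dots> \<le> (\<integral>\<^sup>+z. ennreal (2 ^ n * (2 * R)) \<partial>?PK)"
  proof (rule nn_integral_mono)
    fix z
    have "(\<Sum>\<sigma>\<in>signs I. G \<sigma> z) \<le> (\<Sum>\<sigma>\<in>signs I. H \<sigma> z) + (\<Sum>\<sigma>\<in>signs I. H \<sigma> (\<lambda>i. z (i + n)))"
      unfolding sum.distrib[symmetric] by (intro sum_mono GH)
    then have "(\<Sum>\<sigma>\<in>signs I. G \<sigma> z) \<le> 2 ^ n * (2 * R)"
      using rad[of z] rad[of "\<lambda>i. z (i + n)"] unfolding H_def I_def by linarith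
    moreover have "(\<Sum>\<sigma>\<in>signs I. ennreal (G \<sigma> z)) = ennreal (\<Sum>\<sigma>\<in>signs I. G \<sigma> z)"
      unfolding G_def by (intro sum_ennreal max_abs_nonneg F)
    ultimately show "(\<Sum>\<sigma>\<in>signs I. ennreal (G \<sigma> z)) \<le> ennreal (2 ^ n * (2 * R))" by (simp add: ennreal_leI)
  qed
  also have "\<dots> = ennreal (2 ^ n) * ennreal (2 * R)" by (simp add: PK.emeasure_space_1 ennreal_mult')
  finally have upper: "(\<integral>\<^sup>+z. ennreal (G u z) \<partial>?PK) \<le> ennreal (2 * R)"
    by (subst (asm) ennreal_mult_le_mult_iff) auto
  have "(\<integral>\<^sup>+x. ennreal (max_abs F (?dev x)) \<partial>?PI)
      \<le> (\<integral>\<^sup>+x. (\<integral>\<^sup>+y. ennreal (G u (merge I J (x, y))) \<partial>?PJ) \<partial>?PI)"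
  proof (rule nn_integral_mono)
    fix x
    obtain f where f: "f \<in> F" and max: "max_abs F (?dev x) = \<bar>?dev x f\<bar>"
      using max_abs_attained[OF F(1,2)] .
    let ?d = "\<lambda>y. \<Sum>i\<in>I. f (x i) - f (y (i + n))"
    have fJ_int: "integrable ?PJ (\<lambda>y. f (y k))" if "k \<in> J" for k
      using bd[OF f] comp[OF f that] by (intro PJ.integrable_const_bound[where B=B]) auto
    have mean: "(LINT y|?PJ. f (y k)) = (LINT y|D. f y)" if "k \<in> J" for k
    proof -
      have "distr ?PJ D (\<lambda>\<omega>. \<omega> k) = D"
        using distr_PiM_component[of J "\<lambda>_. D" k] D.prob_space_axioms that by simp
      then show ?thesis
        using integral_distr[of "\<lambda>\<omega>. \<omega> k" ?PJ D f] F(3)[OF f]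
          measurable_component_singleton[OF that, of "\<lambda>_. D"] by simp
    qed
    have d_int: "integrable ?PJ ?d"
      using fJ_int inK by (intro Bochner_Integration.integrable_sum Bochner_Integration.integrable_diff) auto
    have "(\<Sum>i\<in>I. f (x i) - (LINT y|D. f y)) = (\<Sum>i\<in>I. LINT y|?PJ. f (x i) - f (y (i + n)))"
      using fJ_int inK mean by (intro sum.cong refl) (simp add: PJ.prob_space)
    also have "\<dots> = (LINT y|?PJ. ?d y)"
      using fJ_int inK by (subst Bochner_Integration.integral_sum) auto
    finally have "ennreal (max_abs F (?dev x)) \<le> (\<integral>\<^sup>+y. ennreal \<bar>?d y\<bar> \<partial>?PJ)"
      unfolding max using integral_norm_bound_ennreal[OF d_int] by simp
    also have "\<dots> \<le> (\<integral>\<^sup>+y. ennreal (G u (merge I J (x, y))) \<partial>?PJ)"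
    proof (rule nn_integral_mono)
      fix y
      have "?d y = (\<Sum>i\<in>I. u i * (f (merge I J (x, y) i) - f (merge I J (x, y) (i + n))))"
        using inK u1 by (intro sum.cong refl) (simp add: merge_def)
      then show "ennreal \<bar>?d y\<bar> \<le> ennreal (G u (merge I J (x, y)))"
        unfolding G_def using max_abs_ge[OF F(1) f] by (intro ennreal_leI) simp
    qed
    finally show "ennreal (max_abs F (?dev x)) \<le> \<dots>" .
  qed
  also have "\<dots> = (\<integral>\<^sup>+z. ennreal (G u z) \<partial>?PK)"
    unfolding K_def by (rule P.product_nn_integral_fold[symmetric]) (use IJ G_meas[of u] in \<open>auto simp: K_def\<close>)
  also have "\<dots> \<le> ennreal (2 * R)" by (rule upper)
  finally show ?thesis by (simp add: I_def)
qed

section \<open>Square-integrable functions\<close>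

abbreviation L2_sq :: "('a::euclidean_space \<Rightarrow> real) \<Rightarrow> real" where
  "L2_sq f \<equiv> LINT x|lborel. (f x)\<^sup>2"

lemma L2_sq_nonneg: "0 \<le> L2_sq f"
  by (rule Bochner_Integration.integral_nonneg) simp

lemma L2_measurable: "f \<in> L2_functions \<Longrightarrow> f \<in> borel_measurable borel"
  and L2_integrable: "f \<in> L2_functions \<Longrightarrow> integrable lborel (\<lambda>x. (f x)\<^sup>2)"
  by (auto simp: L2_functions_def)

lemma square_add_le: "(a + b)\<^sup>2 \<le> 2 * a\<^sup>2 + 2 * b\<^sup>2" for a b :: real
  using sum_squares_bound[of a b] by (simp add: power2_sum)

lemma L2_bounded_by:
  assumes "f \<in> borel_measurable borel" "g \<in> L2_functions" "\<And>x. \<bar>f x\<bar> \<le> \<bar>g x\<bar>"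
  shows "f \<in> L2_functions"
proof -
  have "(f x)\<^sup>2 \<le> (g x)\<^sup>2" for x using power_mono[OF assms(3) abs_ge_zero, of x 2] by simp
  then have "integrable lborel (\<lambda>x. (f x)\<^sup>2)"
    using assms(1) by (intro Bochner_Integration.integrable_bound[OF L2_integrable[OF assms(2)]]) auto
  then show ?thesis using assms(1) by (simp add: L2_functions_def)
qed

lemma L2_add:
  assumes "f \<in> L2_functions" "g \<in> L2_functions"
  shows "(\<lambda>x. f x + g x) \<in> L2_functions"
proof -
  have m: "(\<lambda>x. f x + g x) \<in> borel_measurable borel" using assms[THEN L2_measurable] by simp
  have "integrable lborel (\<lambda>x. (f x + g x)\<^sup>2)"
  proof (rule Bochner_Integration.integrable_bound)
    show "integrable lborel (\<lambda>x. 2 * (f x)\<^sup>2 + 2 * (g x)\<^sup>2)" using assms[THEN L2_integrable] by simp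
    show "AE x in lborel. norm ((f x + g x)\<^sup>2) \<le> norm (2 * (f x)\<^sup>2 + 2 * (g x)\<^sup>2)"
      using square_add_le by (auto simp: abs_of_nonneg)
  qed (use m in simp)
  then show ?thesis using m by (simp add: L2_functions_def)
qed

lemma L2_cmult: "f \<in> L2_functions \<Longrightarrow> (\<lambda>x. c * f x) \<in> L2_functions"
  by (auto simp: L2_functions_def power_mult_distrib)

lemma L2_diff: "f \<in> L2_functions \<Longrightarrow> g \<in> L2_functions \<Longrightarrow> (\<lambda>x. f x - g x) \<in> L2_functions"
  using L2_add[of f "\<lambda>x. - 1 * g x"] L2_cmult[of g "- 1"] by simp

lemma L2_mult_integrable:
  assumes "f \<in> L2_functions" "g \<in> L2_functions"
  shows "integrable lborel (\<lambda>x. f x * g x)"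
proof (rule Bochner_Integration.integrable_bound)
  show "integrable lborel (\<lambda>x. (f x)\<^sup>2 + (g x)\<^sup>2)" using assms[THEN L2_integrable] by simp
  have "\<bar>a * b\<bar> \<le> a\<^sup>2 + b\<^sup>2" for a b :: real
  proof -
    have "2 * (\<bar>a\<bar> * \<bar>b\<bar>) \<le> a\<^sup>2 + b\<^sup>2" using sum_squares_bound[of "\<bar>a\<bar>" "\<bar>b\<bar>"] by simp
    moreover have "0 \<le> \<bar>a\<bar> * \<bar>b\<bar>" by simp
    ultimately show ?thesis unfolding abs_mult by linarith
  qed
  then show "AE x in lborel. norm (f x * g x) \<le> norm ((f x)\<^sup>2 + (g x)\<^sup>2)" by (auto simp: abs_of_nonneg)
qed (use assms[THEN L2_measurable] in simp)

lemma L2_sq_diff: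
  assumes "f \<in> L2_functions" "g \<in> L2_functions"
  shows "L2_sq (\<lambda>x. f x - g x) = L2_sq f - 2 * (LINT x|lborel. f x * g x) + L2_sq g"
proof -
  have "L2_sq (\<lambda>x. f x - g x) = (LINT x|lborel. (f x)\<^sup>2 - 2 * (f x * g x) + (g x)\<^sup>2)"
    by (intro Bochner_Integration.integral_cong refl) (simp add: power2_eq_square algebra_simps)
  then show ?thesis using assms[THEN L2_integrable] L2_mult_integrable[OF assms] by simp
qed

lemma L2_sq_diff_le:
  assumes "f \<in> L2_functions" "g \<in> L2_functions" "h \<in> L2_functions"
  shows "L2_sq (\<lambda>x. f x - h x) \<le> 2 * L2_sq (\<lambda>x. f x - g x) + 2 * L2_sq (\<lambda>x. g x - h x)"
proof -
  have i: "integrable lborel (\<lambda>x. (f x - g x)\<^sup>2)" "integrable lborel (\<lambda>x. (g x - h x)\<^sup>2)"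
    "integrable lborel (\<lambda>x. (f x - h x)\<^sup>2)"
    using assms by (auto intro: L2_integrable L2_diff)
  have "L2_sq (\<lambda>x. f x - h x) \<le> (LINT x|lborel. 2 * (f x - g x)\<^sup>2 + 2 * (g x - h x)\<^sup>2)"
  proof (rule integral_mono[OF i(3)])
    show "(f x - h x)\<^sup>2 \<le> 2 * (f x - g x)\<^sup>2 + 2 * (g x - h x)\<^sup>2" for x
      using square_add_le[of "f x - g x" "g x - h x"] by simp
  qed (use i in auto)
  then show ?thesis using i by simp
qed

lemma L2_Cauchy_Schwarz:
  assumes f: "f \<in> L2_functions" and g: "g \<in> L2_functions"
  shows "(LINT x|lborel. f x * g x)\<^sup>2 \<le> L2_sq f * L2_sq g"
proof -
  let ?b = "LINT x|lborel. f x * g x"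
  have quad: "0 \<le> L2_sq f - 2 * t * ?b + t\<^sup>2 * L2_sq g" for t
    using L2_sq_diff[OF f L2_cmult[OF g, of t]] L2_sq_nonneg[of "\<lambda>x. f x - t * g x"]
    by (simp add: power_mult_distrib mult.left_commute mult.assoc)
  show ?thesis
  proof (cases "L2_sq g = 0")
    case True
    have "?b = 0"
    proof (rule ccontr)
      assume b: "?b \<noteq> 0"
      have "0 \<le> L2_sq f - 2 * ((L2_sq f + 1) / ?b) * ?b" using quad[of "(L2_sq f + 1) / ?b"] True by simp
      then have "0 \<le> L2_sq f - 2 * (L2_sq f + 1)" using b by simp
      moreover have "0 \<le> L2_sq f" by (rule L2_sq_nonneg)
      ultimately show False by simp
    qed
    then show ?thesis using True by simp
  next
    case False
    then have c: "0 < L2_sq g" using L2_sq_nonneg[of g] by (auto simp: less_le)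
    have "0 \<le> L2_sq f - 2 * (?b / L2_sq g) * ?b + (?b / L2_sq g)\<^sup>2 * L2_sq g" by (rule quad)
    also have "\<dots> = L2_sq f - ?b\<^sup>2 / L2_sq g" using c by (simp add: power2_eq_square field_simps)
    finally show ?thesis using c by (simp add: field_simps)
  qed
qed

lemma nn_integral_L2_sq: "f \<in> L2_functions \<Longrightarrow> (\<integral>\<^sup>+x. ennreal ((f x)\<^sup>2) \<partial>lborel) = ennreal (L2_sq f)"
  by (intro nn_integral_eq_integral L2_integrable) auto

lemma L2_functionsI:
  assumes "f \<in> borel_measurable borel" "(\<integral>\<^sup>+x. ennreal ((f x)\<^sup>2) \<partial>lborel) < \<infinity>"
  shows "f \<in> L2_functions"
proof -
  have "integrable lborel (\<lambda>x. (f x)\<^sup>2)" using assms by (intro integrableI_nonneg) auto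
  then show ?thesis using assms(1) by (simp add: L2_functions_def)
qed

lemma L2_indicator:
  assumes "A \<in> sets borel" "emeasure lborel A < \<infinity>"
  shows "(indicator A :: 'a::euclidean_space \<Rightarrow> real) \<in> L2_functions"
proof -
  have "(indicator A x :: real)\<^sup>2 = indicator A x" for x by (simp add: indicator_def)
  then show ?thesis using assms by (simp add: L2_functions_def)
qed

section \<open>Translations in the mean-square norm\<close>

lemma nn_integral_shift:
  fixes c :: "'a::euclidean_space"
  assumes [measurable]: "f \<in> borel_measurable borel"
  shows "(\<integral>\<^sup>+x. f (x + c) \<partial>lborel) = (\<integral>\<^sup>+x. f x \<partial>lborel)"
  by (subst lborel_distr_plus[of c, symmetric], subst nn_integral_distr) (auto simp: add.commute)

lemma integral_shift:
  fixes c :: "'a::euclidean_space" and f :: "'a \<Rightarrow> real"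
  assumes [measurable]: "f \<in> borel_measurable borel"
  shows "(LINT x|lborel. f (x + c)) = (LINT x|lborel. f x)"
  by (subst lborel_distr_plus[of c, symmetric], subst integral_distr) (auto simp: add.commute)

lemma L2_shift:
  fixes c :: "'a::euclidean_space"
  assumes "f \<in> L2_functions"
  shows "(\<lambda>x. f (x + c)) \<in> L2_functions"
proof (rule L2_functionsI)
  show m: "(\<lambda>x. f (x + c)) \<in> borel_measurable borel"
    by (rule measurable_compose[OF _ L2_measurable[OF assms]]) simp
  have "(\<integral>\<^sup>+x. ennreal ((f (x + c))\<^sup>2) \<partial>lborel) = (\<integral>\<^sup>+x. ennreal ((f x)\<^sup>2) \<partial>lborel)"
    using L2_measurable[OF assms] by (intro nn_integral_shift[where f="\<lambda>x. ennreal ((f x)\<^sup>2)"]) simp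
  then show "(\<integral>\<^sup>+x. ennreal ((f (x + c))\<^sup>2) \<partial>lborel) < \<infinity>" by (simp add: nn_integral_L2_sq[OF assms])
qed

text \<open>The squared \<open>L2\<close> modulus of continuity. Extended nonnegative values let Fubini's theorem and
  monotonicity be applied without integrability conditions.\<close>

definition shift_modulus :: "('a::euclidean_space \<Rightarrow> real) \<Rightarrow> 'a \<Rightarrow> ennreal" where
  "shift_modulus f h = (\<integral>\<^sup>+x. ennreal ((f (x + h) - f x)\<^sup>2) \<partial>lborel)"

lemma shift_modulus_zero [simp]: "shift_modulus f 0 = 0"
  by (simp add: shift_modulus_def)

lemma shift_modulus_measurable [measurable]:
  fixes f :: "'a::euclidean_space \<Rightarrow> real"
  assumes [measurable]: "f \<in> borel_measurable borel"
  shows "shift_modulus f \<in> borel_measurable borel"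
  unfolding shift_modulus_def by measurable

lemma shift_modulus_add_le:
  fixes f :: "'a::euclidean_space \<Rightarrow> real"
  assumes [measurable]: "f \<in> borel_measurable borel"
  shows "shift_modulus f (u + v) \<le> 2 * shift_modulus f u + 2 * shift_modulus f v"
proof -
  have "shift_modulus f (u + v)
      \<le> (\<integral>\<^sup>+x. 2 * ennreal ((f (x + v + u) - f (x + v))\<^sup>2) + 2 * ennreal ((f (x + v) - f x)\<^sup>2) \<partial>lborel)"
    unfolding shift_modulus_def
  proof (rule nn_integral_mono)
    fix x
    have "(f (x + (u + v)) - f x)\<^sup>2 \<le> 2 * (f (x + v + u) - f (x + v))\<^sup>2 + 2 * (f (x + v) - f x)\<^sup>2"
      using square_add_le[of "f (x + v + u) - f (x + v)" "f (x + v) - f x"] by (simp add: add_ac)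
    then show "ennreal ((f (x + (u + v)) - f x)\<^sup>2)
        \<le> 2 * ennreal ((f (x + v + u) - f (x + v))\<^sup>2) + 2 * ennreal ((f (x + v) - f x)\<^sup>2)"
      by (simp add: ennreal_mult'[symmetric] flip: ennreal_plus ennreal_numeral)
  qed
  also have "\<dots> = 2 * (\<integral>\<^sup>+x. ennreal ((f (x + v + u) - f (x + v))\<^sup>2) \<partial>lborel) + 2 * shift_modulus f v"
    unfolding shift_modulus_def by (simp add: nn_integral_add nn_integral_cmult)
  also have "(\<integral>\<^sup>+x. ennreal ((f (x + v + u) - f (x + v))\<^sup>2) \<partial>lborel) = shift_modulus f u"
    unfolding shift_modulus_def by (rule nn_integral_shift[where c=v]) simp
  finally show ?thesis .
qed

lemma nn_integral_reflect:
  fixes c :: "'a::euclidean_space"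
  assumes [measurable]: "f \<in> borel_measurable borel"
  shows "(\<integral>\<^sup>+x. f (c - x) \<partial>lborel) = (\<integral>\<^sup>+x. f x \<partial>lborel)"
proof -
  have "lborel = distr lborel borel (\<lambda>x::'a. c - x)"
    using lborel_affine[of "-1" c] by (simp add: density_1 one_ennreal_def[symmetric])
  then have "(\<integral>\<^sup>+x. f x \<partial>lborel) = (\<integral>\<^sup>+x. f x \<partial>distr lborel borel (\<lambda>x::'a. c - x))" by simp
  also have "\<dots> = (\<integral>\<^sup>+x. f (c - x) \<partial>lborel)" by (rule nn_integral_distr) auto
  finally show ?thesis by simp
qed

text \<open>After the substitution \<open>y = x + z\<close> the Gagliardo seminorm is the integral of the modulus against
  \<open>|z| powr (- d - 2 s)\<close>. To pass from this average to a single \<open>h\<close>, average the triangle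
  inequality between \<open>h\<close>, \<open>z\<close> and \<open>h - z\<close> over the ball of radius \<open>|h|\<close>: both points stay in the
  ball of radius \<open>2 |h|\<close>, where the weight is bounded below.\<close>

lemma shift_modulus_sobolev_frac:
  fixes f :: "'a::euclidean_space \<Rightarrow> real"
  assumes f: "f \<in> sobolev_frac s" and s: "0 < s"
  shows "\<exists>C\<ge>0. \<forall>h. shift_modulus f h \<le> ennreal (C * norm h powr (2 * s))"
proof -
  define p where "p = - real DIM('a) - 2 * s"
  have p: "p < 0" using s by (simp add: p_def)
  have [measurable]: "f \<in> borel_measurable borel"
    using f by (simp add: sobolev_frac_def L2_functions_def)
  let ?W = "shift_modulus f"
  define G where "G = (\<integral>\<^sup>+z. ennreal (norm z powr p) * ?W z \<partial>lborel)"
  have "(\<integral>\<^sup>+x. (\<integral>\<^sup>+y. ennreal (\<bar>f x - f y\<bar>\<^sup>2 * norm (x - y) powr p) \<partial>lborel) \<partial>lborel)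
      = (\<integral>\<^sup>+x. (\<integral>\<^sup>+z. ennreal (norm z powr p) * ennreal ((f (x + z) - f x)\<^sup>2) \<partial>lborel) \<partial>lborel)"
  proof (rule nn_integral_cong)
    fix x :: 'a
    have "(\<integral>\<^sup>+y. ennreal (\<bar>f x - f y\<bar>\<^sup>2 * norm (x - y) powr p) \<partial>lborel)
        = (\<integral>\<^sup>+z. ennreal (\<bar>f x - f (z + x)\<bar>\<^sup>2 * norm (x - (z + x)) powr p) \<partial>lborel)"
      by (rule nn_integral_shift[symmetric]) simp
    also have "\<dots> = (\<integral>\<^sup>+z. ennreal (norm z powr p) * ennreal ((f (x + z) - f x)\<^sup>2) \<partial>lborel)"
      by (intro nn_integral_cong)
        (simp add: ennreal_mult[symmetric] power2_commute add.commute mult.commute)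
    finally show "(\<integral>\<^sup>+y. ennreal (\<bar>f x - f y\<bar>\<^sup>2 * norm (x - y) powr p) \<partial>lborel) = \<dots>" .
  qed
  also have "\<dots> = (\<integral>\<^sup>+z. (\<integral>\<^sup>+x. ennreal (norm z powr p) * ennreal ((f (x + z) - f x)\<^sup>2) \<partial>lborel) \<partial>lborel)"
    by (rule lborel_pair.Fubini'[symmetric]) measurable
  also have "\<dots> = G"
    unfolding G_def shift_modulus_def by (intro nn_integral_cong nn_integral_cmult) simp
  finally have "G < \<infinity>" using f by (simp add: sobolev_frac_def p_def)
  then obtain g where g: "0 \<le> g" "G = ennreal g" by (cases G) auto
  define c where "c = unit_ball_vol (real DIM('a))"
  have c: "0 < c" by (simp add: c_def unit_ball_vol_pos)
  define C where "C = 4 * (2 powr (- p) * g) / c"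
  have bound: "?W h \<le> ennreal (C * norm h powr (2 * s))" for h
  proof (cases "h = 0")
    case False
    define r where "r = norm h"
    have r: "0 < r" using False by (simp add: r_def)
    let ?B = "ball (0::'a) r" and ?B2 = "ball (0::'a) (2 * r)" and ?a = "(2 * r) powr (- p)"
    let ?V = "c * r ^ DIM('a)" and ?near = "\<integral>\<^sup>+z. ?W z * indicator ?B2 z \<partial>lborel"
    have near: "?near \<le> ennreal (?a * g)"
    proof -
      have "?W z * indicator ?B2 z \<le> ennreal ?a * (ennreal (norm z powr p) * ?W z)" for z
      proof (cases "z \<in> ?B2 \<and> z \<noteq> 0")
        case True
        then have "(2 * r) powr p \<le> norm z powr p"
          using p by (intro powr_mono2') auto
        then have "?a * (2 * r) powr p \<le> ?a * norm z powr p"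
          by (intro mult_left_mono) auto
        then have "1 \<le> ?a * norm z powr p"
          using r by (simp flip: powr_add)
        then have "1 \<le> ennreal ?a * ennreal (norm z powr p)"
          by (simp flip: ennreal_mult)
        then have "1 * ?W z \<le> ennreal ?a * ennreal (norm z powr p) * ?W z"
          by (rule mult_right_mono) simp
        then show ?thesis using True by (simp add: mult.assoc)
      qed (auto simp: indicator_def)
      then have "?near
          \<le> (\<integral>\<^sup>+z. ennreal ?a * (ennreal (norm z powr p) * ?W z) \<partial>lborel)"
        by (rule nn_integral_mono)
      also have "\<dots> = ennreal ?a * G"
        unfolding G_def by (rule nn_integral_cmult) measurable
      finally show ?thesis using g by (simp add: ennreal_mult)
    qed
    have m: "(\<lambda>z. ?W z * indicator ?B2 z) \<in> borel_measurable borel"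
      by (intro borel_measurable_times_ennreal borel_measurable_indicator shift_modulus_measurable) auto
    have "?W h * ennreal ?V = (\<integral>\<^sup>+z. ?W h * indicator ?B z \<partial>lborel)"
      using r by (simp add: nn_integral_cmult_indicator emeasure_ball c_def)
    also have "\<dots> \<le> (\<integral>\<^sup>+z. 2 * (?W (h - z) * indicator ?B2 (h - z)) + 2 * (?W z * indicator ?B2 z) \<partial>lborel)"
    proof (rule nn_integral_mono)
      fix z :: 'a
      show "?W h * indicator ?B z \<le> 2 * (?W (h - z) * indicator ?B2 (h - z)) + 2 * (?W z * indicator ?B2 z)"
      proof (cases "z \<in> ?B")
        case True
        then have "norm z < r" by simp
        then have "h - z \<in> ?B2" "z \<in> ?B2"
          using norm_triangle_ineq4[of h z] r by (auto simp flip: r_def)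
        then show ?thesis
          using True shift_modulus_add_le[of f "h - z" z] by simp
      qed simp
    qed
    also have "\<dots> = 2 * (\<integral>\<^sup>+z. ?W (h - z) * indicator ?B2 (h - z) \<partial>lborel) + 2 * ?near"
    proof -
      have m': "(\<lambda>z. ?W (h - z) * indicator ?B2 (h - z)) \<in> borel_measurable borel"
        by (rule measurable_compose[OF _ m]) simp
      show ?thesis using m m' by (simp add: nn_integral_add nn_integral_cmult del: mem_ball)
    qed
    also have "(\<integral>\<^sup>+z. ?W (h - z) * indicator ?B2 (h - z) \<partial>lborel) = ?near"
      by (rule nn_integral_reflect[OF m])
    also have "2 * \<dots> + 2 * \<dots> = 4 * ?near"
      by (simp flip: distrib_right)
    also have "\<dots> \<le> 4 * ennreal (?a * g)"
      by (intro mult_left_mono near) simp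
    also have "\<dots> = ennreal (4 * (?a * g))"
      using g by (simp add: ennreal_mult' flip: ennreal_numeral)
    also have "4 * (?a * g) = C * r powr (2 * s) * ?V"
    proof -
      have "?a = 2 powr (- p) * (r ^ DIM('a) * r powr (2 * s))"
        using r by (simp add: powr_mult p_def powr_add powr_realpow)
      then show ?thesis using c by (simp add: C_def)
    qed
    also have "ennreal (C * r powr (2 * s) * ?V) = ennreal (C * r powr (2 * s)) * ennreal ?V"
      using c r g by (intro ennreal_mult) (auto simp: C_def)
    finally have "?W h * ennreal ?V \<le> ennreal (C * r powr (2 * s)) * ennreal ?V" .
    moreover have "0 < ennreal ?V" "ennreal ?V < \<infinity>" using c r by auto
    ultimately show ?thesis
      using ennreal_mult_le_mult_iff[of "ennreal ?V" "?W h" "ennreal (C * r powr (2 * s))"] c r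
      unfolding r_def by (simp only: mult.commute) simp
  qed simp
  show ?thesis
    using bound c g by (intro exI[of _ C]) (auto simp: C_def)
qed

section \<open>Smooth functions with bounded support\<close>

text \<open>The derivative of \<open>flat_exp j\<close> is a combination of \<open>flat_exp (j + 1)\<close> and \<open>flat_exp (j + 2)\<close>, so the
  family with all powers \<open>j\<close> contains all derivatives of the flat function \<open>exp (- 1 / y)\<close>.\<close>

definition flat_exp :: "nat \<Rightarrow> real \<Rightarrow> real" where
  "flat_exp j y = (if 0 < y then exp (- 1 / y) / y ^ j else 0)"

text \<open>The exponential series at \<open>u = 1 / y\<close> gives \<open>exp u \<ge> u ^ (j + 2) / fact (j + 2)\<close>.\<close>

lemma flat_exp_le_square:
  "\<bar>flat_exp j y\<bar> \<le> fact (j + 2) * y\<^sup>2"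
proof (cases "0 < y")
  case True
  define u where "u = 1 / y"
  have u: "0 < u" using True by (simp add: u_def)
  have "u ^ (j + 2) / fact (j + 2) \<le> exp u"
  proof -
    have "(\<Sum>i\<in>{j + 2}. inverse (fact i) *\<^sub>R u ^ i) \<le> (\<Sum>i. inverse (fact i) *\<^sub>R u ^ i)"
      using u summable_exp_generic[of u] by (intro sum_le_suminf) auto
    then show ?thesis by (simp add: exp_def divide_inverse mult.commute)
  qed
  then have "u ^ (j + 2) \<le> fact (j + 2) * exp u"
    by (simp only: divide_le_eq fact_gt_zero if_True mult.commute)
  then have "u ^ (j + 2) * exp (- u) \<le> fact (j + 2) * exp u * exp (- u)"
    by (rule mult_right_mono) simp
  then have "u ^ (j + 2) * exp (- u) \<le> fact (j + 2)"
    by (simp only: mult.assoc exp_add[symmetric] add.right_inverse exp_zero mult_1_right)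
  then have "(u ^ j * exp (- u)) * (u\<^sup>2 * y\<^sup>2) \<le> fact (j + 2) * y\<^sup>2"
    using mult_right_mono[of "u ^ (j + 2) * exp (- u)" "fact (j + 2)" "y\<^sup>2"]
    by (simp add: power_add mult_ac power2_eq_square)
  moreover have "u\<^sup>2 * y\<^sup>2 = 1" using True by (simp add: u_def power_divide)
  moreover have "flat_exp j y = u ^ j * exp (- u)" using True by (simp add: flat_exp_def u_def power_divide)
  ultimately show ?thesis using u by simp
qed (simp add: flat_exp_def)

text \<open>Derivatives are obtained from a quadratic remainder estimate twice below: for the flat functions at
  the origin and for differentiation under an integral.\<close>

lemma DERIV_of_quadratic_error:
  fixes f :: "real \<Rightarrow> real"
  assumes "0 < \<delta>" and err: "\<And>u. \<bar>u\<bar> < \<delta> \<Longrightarrow> \<bar>f (t + u) - f t - L * u\<bar> \<le> K * u\<^sup>2"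
  shows "(f has_real_derivative L) (at t)"
  unfolding DERIV_def
proof (rule Lim_null[THEN iffD2], rule Lim_null_comparison)
  show "\<forall>\<^sub>F u in at 0. norm ((f (t + u) - f t) / u - L) \<le> \<bar>K\<bar> * \<bar>u\<bar>"
    unfolding eventually_at
  proof (intro exI[of _ \<delta>] conjI ballI impI assms(1))
    fix u :: real assume u: "u \<noteq> 0 \<and> dist u 0 < \<delta>"
    have "\<bar>f (t + u) - f t - L * u\<bar> \<le> \<bar>K\<bar> * u\<^sup>2"
      using u by (intro order_trans[OF err mult_right_mono]) (auto simp: dist_real_def)
    then have "\<bar>f (t + u) - f t - L * u\<bar> / \<bar>u\<bar> \<le> \<bar>K\<bar> * \<bar>u\<bar>"
      using u by (simp add: divide_le_eq power2_eq_square abs_mult_self_eq mult.assoc flip: abs_mult)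
    moreover have "\<bar>f (t + u) - f t - L * u\<bar> / \<bar>u\<bar> = norm ((f (t + u) - f t) / u - L)"
      using u by (simp add: abs_divide[symmetric] diff_divide_distrib)
    ultimately show "norm ((f (t + u) - f t) / u - L) \<le> \<bar>K\<bar> * \<bar>u\<bar>" by simp
  qed
  show "((\<lambda>u. \<bar>K\<bar> * \<bar>u\<bar>) \<longlongrightarrow> 0) (at 0)"
    by (auto intro!: tendsto_eq_intros)
qed

lemma flat_exp_deriv:
  "(flat_exp j has_real_derivative (flat_exp (j + 2) y - real j * flat_exp (j + 1) y)) (at y)"
proof -
  consider "0 < y" | "y = 0" | "y < 0" by linarith
  then show ?thesis
  proof cases
    case 1
    have "((\<lambda>y. exp (- 1 / y) / y ^ j) has_real_derivative (flat_exp (j + 2) y - real j * flat_exp (j + 1) y)) (at y)"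
    proof -
      have e: "real j * y ^ (j - Suc 0) = real j * y ^ j / y" using 1 by (cases j) auto
      have "((\<lambda>y. exp (- 1 / y) / y ^ j) has_real_derivative
          (exp (- 1 / y) * (1 / y\<^sup>2) * y ^ j - exp (- 1 / y) * (real j * y ^ (j - Suc 0))) / (y ^ j * y ^ j)) (at y)"
        using 1 by (auto intro!: derivative_eq_intros simp: power2_eq_square)
      moreover have "(exp (- 1 / y) * (1 / y\<^sup>2) * y ^ j - exp (- 1 / y) * (real j * y ^ (j - Suc 0))) / (y ^ j * y ^ j)
          = flat_exp (j + 2) y - real j * flat_exp (j + 1) y"
        unfolding e using 1 by (simp add: flat_exp_def field_simps power2_eq_square)
      ultimately show ?thesis by simp
    qed
    then show ?thesis
      by (rule has_field_derivative_transform_within_open[of _ _ _ "{0<..}"]) (use 1 in \<open>auto simp: flat_exp_def\<close>)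
  next
    case 2
    have "(flat_exp j has_real_derivative 0) (at 0)"
      by (rule DERIV_of_quadratic_error[of 1 _ _ _ "fact (j + 2)"])
        (use flat_exp_le_square in \<open>auto simp: flat_exp_def\<close>)
    then show ?thesis using 2 by (simp add: flat_exp_def)
  next
    case 3
    have "((\<lambda>y. 0) has_real_derivative 0) (at y)" by simp
    then have "(flat_exp j has_real_derivative 0) (at y)"
      by (rule has_field_derivative_transform_within_open[of _ _ _ "{..<0}"]) (use 3 in \<open>auto simp: flat_exp_def\<close>)
    then show ?thesis using 3 by (simp add: flat_exp_def)
  qed
qed

text \<open>This set is closed under partial derivatives, so a single induction on the order shows that its
  members are smooth; no calculus of higher derivatives is needed. It is also rich enough
  to contain approximations to the indicators of all boxes.\<close>

inductive_set smooth_algebra :: "('a::euclidean_space \<Rightarrow> real) set" where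
  const: "(\<lambda>x. c) \<in> smooth_algebra"
| ridge: "(\<lambda>x. flat_exp j (x \<bullet> v + d)) \<in> smooth_algebra"
| add: "f \<in> smooth_algebra \<Longrightarrow> g \<in> smooth_algebra \<Longrightarrow> (\<lambda>x. f x + g x) \<in> smooth_algebra"
| mult: "f \<in> smooth_algebra \<Longrightarrow> g \<in> smooth_algebra \<Longrightarrow> (\<lambda>x. f x * g x) \<in> smooth_algebra"

lemma smooth_algebra_derivative:
  assumes "f \<in> smooth_algebra"
  shows "\<exists>D. (\<forall>x. (f has_derivative (\<lambda>v. D v x)) (at x)) \<and> (\<forall>v. D v \<in> smooth_algebra)"
  using assms
proof induction
  case (const c)
  show ?case by (rule exI[of _ "\<lambda>v x. 0"]) (auto intro: smooth_algebra.const)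
next
  case (ridge j w d)
  let ?D = "\<lambda>v x. (v \<bullet> w) * (flat_exp (j + 2) (x \<bullet> w + d) + (- real j) * flat_exp (j + 1) (x \<bullet> w + d))"
  have "((\<lambda>x. flat_exp j (x \<bullet> w + d)) has_derivative (\<lambda>v. ?D v x)) (at x)" for x
  proof -
    have "((\<lambda>x. x \<bullet> w + d) has_derivative (\<lambda>v. v \<bullet> w)) (at x)"
      by (auto intro!: derivative_eq_intros)
    from has_derivative_compose[OF this flat_exp_deriv[unfolded has_field_derivative_def]]
    show ?thesis by (simp add: mult.commute)
  qed
  moreover have "?D v \<in> smooth_algebra" for v
    by (intro smooth_algebra.intros)
  ultimately show ?case by (intro exI[of _ ?D]) simp
next
  case (add f g)
  then obtain D E where "\<forall>x. (f has_derivative (\<lambda>v. D v x)) (at x)" "\<forall>v. D v \<in> smooth_algebra"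
    "\<forall>x. (g has_derivative (\<lambda>v. E v x)) (at x)" "\<forall>v. E v \<in> smooth_algebra" by blast
  then show ?case
    by (intro exI[of _ "\<lambda>v x. D v x + E v x"]) (auto intro!: has_derivative_add smooth_algebra.add)
next
  case (mult f g)
  then obtain D E where "\<forall>x. (f has_derivative (\<lambda>v. D v x)) (at x)" "\<forall>v. D v \<in> smooth_algebra"
    "\<forall>x. (g has_derivative (\<lambda>v. E v x)) (at x)" "\<forall>v. E v \<in> smooth_algebra" by blast
  then show ?case using mult.hyps
    by (intro exI[of _ "\<lambda>v x. f x * E v x + D v x * g x"])
      (auto intro!: has_derivative_mult smooth_algebra.add smooth_algebra.mult)
qed

lemma smooth_algebra_C_class:
  assumes "f \<in> smooth_algebra" shows "C_class k f"
  using assms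
proof (induction k arbitrary: f)
  case 0
  then obtain D where "\<forall>x. (f has_derivative (\<lambda>v. D v x)) (at x)"
    using smooth_algebra_derivative by blast
  then show ?case by (auto intro!: continuous_at_imp_continuous_on has_derivative_continuous)
next
  case (Suc k)
  obtain D where D: "\<And>x. (f has_derivative (\<lambda>v. D v x)) (at x)" "\<And>v. D v \<in> smooth_algebra"
    using smooth_algebra_derivative[OF Suc.prems] by blast
  have *: "frechet_derivative f (at x) = (\<lambda>v. D v x)" for x
    by (rule frechet_derivative_at[OF D(1), symmetric])
  have "f differentiable (at x)" for x using D(1) by (rule differentiableI)
  then show ?case using Suc.IH[OF D(2)] by (simp add: *)
qed

lemma smooth_algebra_shift: "f \<in> smooth_algebra \<Longrightarrow> (\<lambda>x. f (x + h)) \<in> smooth_algebra"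
proof (induction rule: smooth_algebra.induct)
  case (ridge j v d)
  then show ?case using smooth_algebra.ridge[of j v "h \<bullet> v + d"] by (simp add: inner_add_left add.assoc)
qed (auto intro: smooth_algebra.intros)

lemma smooth_algebra_prod:
  assumes "finite I" "\<And>i. i \<in> I \<Longrightarrow> f i \<in> smooth_algebra"
  shows "(\<lambda>x. \<Prod>i\<in>I. f i x) \<in> smooth_algebra"
  using assms by (induction rule: finite_induct) (auto intro: smooth_algebra.intros)

definition smooth_bump :: "('a::euclidean_space \<Rightarrow> real) set" where
  "smooth_bump = {f \<in> smooth_algebra. \<exists>R. \<forall>x. R < norm x \<longrightarrow> f x = 0}"

lemma smooth_bump_test: "f \<in> smooth_bump \<Longrightarrow> f \<in> test_functions"
proof -
  assume f: "f \<in> smooth_bump"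
  then obtain R where R: "\<forall>x. R < norm x \<longrightarrow> f x = 0" by (auto simp: smooth_bump_def)
  have "bounded {x. f x \<noteq> 0}"
    using R by (intro boundedI[where B=R]) (auto simp: not_less[symmetric])
  then show ?thesis
    using f smooth_algebra_C_class by (auto simp: test_functions_def smooth_bump_def compact_closure)
qed

lemma smooth_bump_continuous:
  assumes "f \<in> smooth_bump" shows "continuous_on A f"
  using smooth_algebra_C_class[of f 0] assms
  by (auto simp: smooth_bump_def intro: continuous_on_subset)

lemma smooth_bump_measurable:
  "f \<in> smooth_bump \<Longrightarrow> f \<in> borel_measurable borel"
  by (intro borel_measurable_continuous_onI smooth_bump_continuous)

lemma smooth_bump_bound:
  assumes "f \<in> smooth_bump"
  shows "\<exists>B R. 0 \<le> B \<and> 0 < R \<and> (\<forall>x. \<bar>f x\<bar> \<le> B * indicator (cball 0 R) x)"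
proof -
  obtain R where R: "\<forall>x. R < norm x \<longrightarrow> f x = 0" using assms by (auto simp: smooth_bump_def)
  have "compact (f ` cball 0 (max R 1))"
    by (intro compact_continuous_image smooth_bump_continuous[OF assms] compact_cball)
  then obtain B where B: "\<forall>y\<in>f ` cball 0 (max R 1). norm y \<le> B"
    using compact_imp_bounded bounded_iff by metis
  have "\<bar>f x\<bar> \<le> \<bar>B\<bar> * indicator (cball 0 (max R 1)) x" for x
  proof (cases "norm x \<le> max R 1")
    case True
    then have "norm (f x) \<le> B" using B by (intro bspec[OF B] imageI) simp
    then show ?thesis using True by simp
  next
    case False
    then have "f x = 0" using R by simp
    then show ?thesis by simp
  qed
  then show ?thesis by (intro exI[of _ "\<bar>B\<bar>"] exI[of _ "max R 1"]) auto
qed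

lemma smooth_bump_L2:
  assumes "f \<in> smooth_bump"
  shows "f \<in> L2_functions"
proof -
  obtain B R where B: "0 \<le> B" "\<And>x. \<bar>f x\<bar> \<le> B * indicator (cball 0 R) x"
    using smooth_bump_bound[OF assms] by blast
  have "emeasure lborel (cball (0::'a) R) < \<infinity>" by (rule emeasure_bounded_finite) simp
  then have "(\<lambda>x::'a. B * indicator (cball 0 R) x) \<in> L2_functions"
    by (intro L2_cmult L2_indicator) auto
  then show ?thesis
    using B by (intro L2_bounded_by[OF smooth_bump_measurable[OF assms]])
      (auto simp: abs_mult)
qed

lemma smooth_bump_add:
  assumes "f \<in> smooth_bump" "g \<in> smooth_bump"
  shows "(\<lambda>x. f x + g x) \<in> smooth_bump"
proof -
  obtain R S where "\<forall>x. R < norm x \<longrightarrow> f x = 0" "\<forall>x. S < norm x \<longrightarrow> g x = 0"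
    using assms by (auto simp: smooth_bump_def)
  then have "\<exists>R. \<forall>x. R < norm x \<longrightarrow> f x + g x = 0" by (intro exI[of _ "max R S"]) auto
  then show ?thesis using assms by (simp add: smooth_bump_def smooth_algebra.add)
qed

lemma smooth_bump_cmult:
  "f \<in> smooth_bump \<Longrightarrow> (\<lambda>x. c * f x) \<in> smooth_bump"
  by (auto simp: smooth_bump_def intro: smooth_algebra.intros) 

lemma smooth_bump_shift:
  assumes "f \<in> smooth_bump"
  shows "(\<lambda>x. f (x + h)) \<in> smooth_bump"
proof -
  obtain R where R: "\<forall>x. R < norm x \<longrightarrow> f x = 0" using assms by (auto simp: smooth_bump_def)
  have "f (x + h) = 0" if "R + norm h < norm x" for x
    using R norm_triangle_ineq4[of "x + h" h] that by force
  then show ?thesis using assms by (auto simp: smooth_bump_def intro: smooth_algebra_shift)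
qed

lemma smooth_bump_partial:
  assumes "f \<in> smooth_bump"
  shows "\<exists>g\<in>smooth_bump. (\<forall>x. frechet_derivative f (at x) b = g x) \<and>
     (\<forall>x t. ((\<lambda>t. f (x + t *\<^sub>R b)) has_real_derivative g (x + t *\<^sub>R b)) (at t))"
proof -
  obtain D where D: "\<And>x. (f has_derivative (\<lambda>v. D v x)) (at x)" "\<And>v. D v \<in> smooth_algebra"
    using smooth_algebra_derivative[of f] assms unfolding smooth_bump_def by blast
  obtain R where R: "\<forall>x. R < norm x \<longrightarrow> f x = 0" using assms by (auto simp: smooth_bump_def)
  have "D b x = 0" if x: "R < norm x" for x
  proof -
    have "((\<lambda>x. 0) has_derivative (\<lambda>v. D v x)) (at x)"
      by (rule has_derivative_transform_within_open[OF D(1), of "{x. R < norm x}"])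
        (use R x in \<open>auto intro: open_Collect_less continuous_intros\<close>)
    moreover have "((\<lambda>x. 0) has_derivative (\<lambda>v. 0)) (at x)" by simp
    ultimately have "(\<lambda>v. D v x) = (\<lambda>v. 0)" by (rule has_derivative_unique)
    then show ?thesis by metis
  qed
  then have "D b \<in> smooth_bump" using D(2) by (auto simp: smooth_bump_def)
  moreover have "frechet_derivative f (at x) b = D b x" for x
    by (simp flip: frechet_derivative_at[OF D(1)])
  moreover have "((\<lambda>t. f (x + t *\<^sub>R b)) has_real_derivative D b (x + t *\<^sub>R b)) (at t)" for x t
  proof -
    have "((\<lambda>t. x + t *\<^sub>R b) has_derivative (\<lambda>u. u *\<^sub>R b)) (at t)"
      by (auto intro!: derivative_eq_intros)
    from has_derivative_compose[OF this D(1)]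
    have "((\<lambda>t. f (x + t *\<^sub>R b)) has_derivative (\<lambda>u. D (u *\<^sub>R b) (x + t *\<^sub>R b))) (at t)" by simp
    moreover have "D (u *\<^sub>R b) y = D b y * u" for u y
      using linear_scale[OF has_derivative_linear[OF D(1)[of y]], of u b] by simp
    ultimately show ?thesis by (simp add: has_field_derivative_def)
  qed
  ultimately show ?thesis by blast
qed

section \<open>Density of smooth functions in the square-integrable functions\<close>

definition L2_approx :: "('a::euclidean_space \<Rightarrow> real) \<Rightarrow> bool" where
  "L2_approx f \<longleftrightarrow> f \<in> L2_functions \<and>
     (\<forall>e>0. \<exists>\<psi>\<in>smooth_bump. L2_sq (\<lambda>x. f x - \<psi> x) < e)"

lemma L2_approx_limit:
  assumes f: "f \<in> L2_functions"
    and lim: "\<And>e. 0 < e \<Longrightarrow> \<exists>g. L2_approx g \<and> L2_sq (\<lambda>x. f x - g x) < e"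
  shows "L2_approx f"
  unfolding L2_approx_def
proof (intro conjI allI impI f)
  fix e :: real assume "0 < e"
  then have e: "0 < e / 4" by simp
  obtain g where g: "L2_approx g" "L2_sq (\<lambda>x. f x - g x) < e / 4" using lim[OF e] by blast
  obtain \<psi> where \<psi>: "\<psi> \<in> smooth_bump" "L2_sq (\<lambda>x. g x - \<psi> x) < e / 4"
    using g(1) e unfolding L2_approx_def by blast
  have "L2_sq (\<lambda>x. f x - \<psi> x) < e"
    using L2_sq_diff_le[OF f _ smooth_bump_L2[OF \<psi>(1)], of g] g \<psi>(2)
    by (simp add: L2_approx_def)
  then show "\<exists>\<psi>\<in>smooth_bump. L2_sq (\<lambda>x. f x - \<psi> x) < e" using \<psi>(1) by blast
qed

lemma L2_approx_dominated_limit: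
  fixes f g :: "'a::euclidean_space \<Rightarrow> real"
  assumes F: "\<And>k::nat. L2_approx (F k)" and lim: "\<And>x. (\<lambda>k. F k x) \<longlonglongrightarrow> f x"
    and bd: "\<And>k x. \<bar>F k x\<bar> \<le> g x" and g: "g \<in> L2_functions"
  shows "L2_approx f"
proof (rule L2_approx_limit)
  have Fm [measurable]: "F k \<in> borel_measurable borel" for k
    using F by (simp add: L2_approx_def L2_measurable)
  have fm [measurable]: "f \<in> borel_measurable borel" by (rule borel_measurable_LIMSEQ_real[OF lim Fm])
  have fb: "\<bar>f x\<bar> \<le> g x" for x
    by (rule LIMSEQ_le_const2[OF tendsto_rabs[OF lim]]) (use bd in auto)
  show "f \<in> L2_functions"
    by (rule L2_bounded_by[OF fm g]) (use fb abs_ge_self order_trans in blast)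
  have "(\<lambda>k. L2_sq (\<lambda>x. f x - F k x)) \<longlonglongrightarrow> (LINT x|(lborel::'a measure). (0::real))"
  proof (rule integral_dominated_convergence[where w="\<lambda>x. 4 * (g x)\<^sup>2"])
    have "(\<lambda>k. f x - F k x) \<longlonglongrightarrow> 0" for x
      using tendsto_diff[OF tendsto_const[of "f x"] lim[of x]] by simp
    then show "AE x in lborel. (\<lambda>k. (f x - F k x)\<^sup>2) \<longlonglongrightarrow> 0" by simp
    show "AE x in lborel. norm ((f x - F k x)\<^sup>2) \<le> 4 * (g x)\<^sup>2" for k
    proof (intro AE_I2)
      fix x
      have "\<bar>f x - F k x\<bar> \<le> 2 * g x" using fb[of x] bd[of k x] by linarith
      then have "\<bar>f x - F k x\<bar>\<^sup>2 \<le> (2 * g x)\<^sup>2" by (rule power_mono) simp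
      then show "norm ((f x - F k x)\<^sup>2) \<le> 4 * (g x)\<^sup>2" by (simp add: power_mult_distrib)
    qed
  qed (use L2_integrable[OF g] in auto)
  then have lim0: "(\<lambda>k. L2_sq (\<lambda>x. f x - F k x)) \<longlonglongrightarrow> 0" by simp
  show "\<exists>g. L2_approx g \<and> L2_sq (\<lambda>x. f x - g x) < e" if e: "0 < e" for e
  proof -
    have "\<forall>\<^sub>F k in sequentially. L2_sq (\<lambda>x. f x - F k x) < e" by (rule order_tendstoD(2)[OF lim0 e])
    from eventually_happens'[OF _ this] obtain k where "L2_sq (\<lambda>x. f x - F k x) < e"
      by (rule exE) simp
    then show ?thesis using F by blast
  qed
qed

lemma L2_approx_smooth: "\<psi> \<in> smooth_bump \<Longrightarrow> L2_approx \<psi>"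
  unfolding L2_approx_def using smooth_bump_L2 by (auto intro!: bexI[of _ \<psi>])

lemma L2_approx_add:
  assumes f: "L2_approx f" and g: "L2_approx g"
  shows "L2_approx (\<lambda>x. f x + g x)"
  unfolding L2_approx_def
proof (intro conjI allI impI)
  have L2: "f \<in> L2_functions" "g \<in> L2_functions" using f g by (auto simp: L2_approx_def)
  then show fg: "(\<lambda>x. f x + g x) \<in> L2_functions" by (rule L2_add)
  fix e :: real assume e: "0 < e"
  then have "0 < e / 4" by simp
  then obtain \<psi> \<eta> where \<psi>: "\<psi> \<in> smooth_bump" "L2_sq (\<lambda>x. f x - \<psi> x) < e / 4"
    and \<eta>: "\<eta> \<in> smooth_bump" "L2_sq (\<lambda>x. g x - \<eta> x) < e / 4"
    using f g unfolding L2_approx_def by blast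
  note \<psi>\<eta> = smooth_bump_L2[OF \<psi>(1)] smooth_bump_L2[OF \<eta>(1)]
  have "L2_sq (\<lambda>x. f x + g x - (\<psi> x + \<eta> x))
      \<le> 2 * L2_sq (\<lambda>x. f x + g x - (\<psi> x + g x)) + 2 * L2_sq (\<lambda>x. \<psi> x + g x - (\<psi> x + \<eta> x))"
    by (intro L2_sq_diff_le fg L2_add \<psi>\<eta> L2)
  also have "\<dots> < e" using \<psi>(2) \<eta>(2) by simp
  finally show "\<exists>\<psi>\<in>smooth_bump. L2_sq (\<lambda>x. f x + g x - \<psi> x) < e"
    using smooth_bump_add[OF \<psi>(1) \<eta>(1)] by (intro bexI) auto
qed

lemma L2_approx_cmult:
  assumes f: "L2_approx f"
  shows "L2_approx (\<lambda>x. c * f x)"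
  unfolding L2_approx_def
proof (intro conjI allI impI)
  show "(\<lambda>x. c * f x) \<in> L2_functions" using f by (simp add: L2_approx_def L2_cmult)
  fix e :: real assume e: "0 < e"
  have c: "0 < c\<^sup>2 + 1" by (simp add: add_nonneg_pos)
  then have "0 < e / (c\<^sup>2 + 1)" using e by simp
  then obtain \<psi> where \<psi>: "\<psi> \<in> smooth_bump" "L2_sq (\<lambda>x. f x - \<psi> x) < e / (c\<^sup>2 + 1)"
    using f unfolding L2_approx_def by blast
  have "L2_sq (\<lambda>x. c * f x - c * \<psi> x) = c\<^sup>2 * L2_sq (\<lambda>x. f x - \<psi> x)"
    by (simp add: power_mult_distrib flip: right_diff_distrib)
  also have "\<dots> \<le> (c\<^sup>2 + 1) * L2_sq (\<lambda>x. f x - \<psi> x)"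
    by (intro mult_right_mono L2_sq_nonneg) simp
  also have "\<dots> < e" using \<psi>(2) c by (simp only: pos_less_divide_eq mult.commute)
  finally show "\<exists>\<psi>\<in>smooth_bump. L2_sq (\<lambda>x. c * f x - \<psi> x) < e"
    using smooth_bump_cmult[OF \<psi>(1), of c] by (intro bexI) auto
qed

lemma L2_approx_zero: "L2_approx (\<lambda>x. 0)"
proof (rule L2_approx_smooth)
  show "(\<lambda>x. 0) \<in> smooth_bump"
    by (auto simp: smooth_bump_def intro: smooth_algebra.const)
qed

lemma flat_exp_zero_le_one: "0 \<le> flat_exp 0 y" "flat_exp 0 y \<le> 1"
  by (auto simp: flat_exp_def)

lemma flat_exp_zero_scaled: "(\<lambda>k. flat_exp 0 (real k * y)) \<longlonglongrightarrow> (if 0 < y then 1 else 0)"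
proof (cases "0 < y")
  case True
  have "(\<lambda>k. exp (- ((1 / y) * inverse (real k)))) \<longlonglongrightarrow> exp (- ((1 / y) * 0))"
    by (intro tendsto_intros lim_inverse_n)
  moreover have "\<forall>\<^sub>F k in sequentially. exp (- ((1 / y) * inverse (real k))) = flat_exp 0 (real k * y)"
    using eventually_gt_at_top[of 0] by eventually_elim (use True in \<open>simp add: flat_exp_def field_simps\<close>)
  ultimately have "(\<lambda>k. flat_exp 0 (real k * y)) \<longlonglongrightarrow> exp (- ((1 / y) * 0))"
    by (rule Lim_transform_eventually)
  then show ?thesis using True by simp
next
  case False
  then have "flat_exp 0 (real k * y) = 0" for k by (simp add: flat_exp_def zero_less_mult_iff)
  then show ?thesis using False by simp
qed

text \<open>As \<open>k\<close> grows, \<open>flat_exp 0 (k y)\<close> tends to the indicator of \<open>y > 0\<close>, so the products below tend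
  to the indicator of the open box while vanishing off it.\<close>

lemma L2_approx_box:
  fixes a c :: "'a::euclidean_space"
  shows "L2_approx (indicator (box a c))"
proof -
  let ?l = "\<lambda>k b x. flat_exp 0 (real k * (x \<bullet> b - a \<bullet> b))" and ?r = "\<lambda>k b x. flat_exp 0 (real k * (c \<bullet> b - x \<bullet> b))"
  define \<psi> :: "nat \<Rightarrow> 'a \<Rightarrow> real" where
    "\<psi> k x = (\<Prod>b\<in>Basis. ?l k b x * ?r k b x)" for k x
  have zero: "\<psi> k x = 0" if x: "x \<notin> box a c" for k x
  proof -
    obtain b where "b \<in> Basis" "x \<bullet> b \<le> a \<bullet> b \<or> c \<bullet> b \<le> x \<bullet> b"
      using x by (auto simp: mem_box not_less)
    then have "?l k b x * ?r k b x = 0"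
      by (auto simp: flat_exp_def zero_less_mult_iff)
    then show ?thesis using \<open>b \<in> Basis\<close> unfolding \<psi>_def by (intro prod_zero) auto
  qed
  have smooth: "\<psi> k \<in> smooth_bump" for k
  proof -
    have ridge: "?l k b \<in> smooth_algebra" "?r k b \<in> smooth_algebra" for b
      using smooth_algebra.ridge[of 0 "real k *\<^sub>R b" "- real k * (a \<bullet> b)"]
        smooth_algebra.ridge[of 0 "- real k *\<^sub>R b" "real k * (c \<bullet> b)"]
      by (simp_all add: algebra_simps)
    have "\<psi> k \<in> smooth_algebra"
      unfolding \<psi>_def by (intro smooth_algebra_prod smooth_algebra.mult ridge) simp
    moreover obtain R where "\<forall>x\<in>box a c. norm x \<le> R"
      using bounded_box[of a c] bounded_iff by metis
    then have "\<forall>x. R < norm x \<longrightarrow> \<psi> k x = 0" using zero by (meson not_le)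
    ultimately show ?thesis by (auto simp: smooth_bump_def)
  qed
  have \<psi>01: "0 \<le> \<psi> k x" "\<psi> k x \<le> 1" for k x
    unfolding \<psi>_def using flat_exp_zero_le_one
    by (auto intro!: prod_nonneg prod_le_1 mult_nonneg_nonneg mult_le_one)
  show ?thesis
  proof (rule L2_approx_dominated_limit[where F=\<psi> and g="indicator (box a c)"])
    show "L2_approx (\<psi> k)" for k by (intro L2_approx_smooth smooth)
    show "(\<lambda>k. \<psi> k x) \<longlonglongrightarrow> indicator (box a c) x" for x
    proof (cases "x \<in> box a c")
      case True
      have "(\<lambda>k. \<psi> k x) \<longlonglongrightarrow> (\<Prod>b\<in>(Basis::'a set). 1 * 1)"
        unfolding \<psi>_def
      proof (intro tendsto_prod tendsto_mult)
        fix b :: 'a assume "b \<in> Basis"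
        then show "(\<lambda>k. ?l k b x) \<longlonglongrightarrow> 1" "(\<lambda>k. ?r k b x) \<longlonglongrightarrow> 1"
          using True flat_exp_zero_scaled[of "x \<bullet> b - a \<bullet> b"] flat_exp_zero_scaled[of "c \<bullet> b - x \<bullet> b"]
          by (auto simp: mem_box)
      qed
      then show ?thesis using True by simp
    qed (simp add: zero)
    show "\<bar>\<psi> k x\<bar> \<le> indicator (box a c) x" for k x
      using zero[of x k] \<psi>01[of k x] by (cases "x \<in> box a c") auto
    show "(indicator (box a c) :: 'a \<Rightarrow> real) \<in> L2_functions"
      using emeasure_bounded_finite[OF bounded_box, of a c] by (intro L2_indicator) auto
  qed
qed

text \<open>Boxes form an intersection-stable generator of the Borel sets, and intersecting with a fixed box
  keeps all indicators square-integrable, so the approximable sets form a Dynkin system.\<close>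

lemma L2_approx_indicator_bounded:
  fixes A :: "'a::euclidean_space set"
  assumes "A \<in> sets borel"
  shows "L2_approx (indicator (A \<inter> box p q))"
proof -
  let ?G = "range (\<lambda>(a, b). box a b :: 'a set)" and ?Q = "box p q"
  have "Int_stable ?G" by (auto simp: Int_stable_def box_Int_box)
  moreover have "?G \<subseteq> Pow UNIV" by simp
  moreover have "A \<in> sigma_sets UNIV ?G" using assms by (simp add: borel_eq_box)
  ultimately show ?thesis
  proof (induction rule: sigma_sets_induct_disjoint)
    case (basic A)
    then show ?case using L2_approx_box by (auto simp: box_Int_box)
  next
    case empty
    have "indicator ({} \<inter> ?Q) = (\<lambda>x::'a. 0::real)" by (simp add: fun_eq_iff)
    then show ?case using L2_approx_zero by (simp only:)
  next
    case (compl A)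
    have "(indicator ((UNIV - A) \<inter> ?Q) :: 'a \<Rightarrow> real) = (\<lambda>x. indicator ?Q x + (-1) * indicator (A \<inter> ?Q) x)"
      by (auto simp: indicator_def fun_eq_iff)
    then show ?case using L2_approx_add[OF L2_approx_box L2_approx_cmult[OF compl(2)]] by metis
  next
    case (union A)
    have partial: "L2_approx (\<lambda>x. \<Sum>i<k. indicator (A i \<inter> ?Q) x)" for k
    proof (induction k)
      case (Suc k)
      then show ?case using L2_approx_add[OF Suc.IH union(3)[of k]] by simp
    qed (simp add: L2_approx_zero)
    show ?case
    proof (rule L2_approx_dominated_limit[OF partial, where g="indicator ?Q"])
      have partial_eq: "(\<Sum>i<k. indicator (A i \<inter> ?Q) x :: real) = indicator (\<Union>i<k. A i \<inter> ?Q) x" for k x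
      proof -
        have "disjoint_family_on (\<lambda>i. A i \<inter> ?Q) {..<k}" using union(1) by (auto simp: disjoint_family_on_def)
        then show ?thesis by (intro indicator_UN_disjoint[symmetric]) simp_all
      qed
      show "(\<lambda>k. \<Sum>i<k. indicator (A i \<inter> ?Q) x :: real) \<longlonglongrightarrow> indicator (\<Union> (range A) \<inter> ?Q) x" for x
        unfolding partial_eq using LIMSEQ_indicator_UN[of "\<lambda>i. A i \<inter> ?Q" x] by simp
      show "\<bar>\<Sum>i<k. indicator (A i \<inter> ?Q) x\<bar> \<le> (indicator ?Q x :: real)" for k x
        unfolding partial_eq by (auto simp: indicator_def)
      show "(indicator ?Q :: 'a \<Rightarrow> real) \<in> L2_functions"
        using L2_approx_box[of p q] unfolding L2_approx_def by blast
    qed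
  qed
qed

text \<open>Induction on measurable functions, with \<open>f \<in> L2_functions\<close> kept inside the claim, because
  it holds for all functions met on the way only once it is known for the larger one.\<close>

lemma L2_approx_nonneg:
  fixes f :: "'a::euclidean_space \<Rightarrow> real"
  assumes "f \<in> L2_functions" "\<And>x. 0 \<le> f x"
  shows "L2_approx f"
proof -
  have "f \<in> L2_functions \<longrightarrow> L2_approx f"
    using L2_measurable[OF assms(1)] assms(2)
  proof (induction rule: borel_measurable_induct_real)
    case (set A)
    show ?case
    proof
      assume L2: "(indicator A :: 'a \<Rightarrow> real) \<in> L2_functions"
      let ?Q = "\<lambda>k. box (- real k *\<^sub>R One) (real k *\<^sub>R One) :: 'a set"
      show "L2_approx (indicator A)"
      proof (rule L2_approx_dominated_limit[where F="\<lambda>k. indicator (A \<inter> ?Q k)", OF _ _ _ L2])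
        show "L2_approx (indicator (A \<inter> ?Q k))" for k
          by (rule L2_approx_indicator_bounded[OF set])
        show "(\<lambda>k. indicator (A \<inter> ?Q k) x :: real) \<longlonglongrightarrow> indicator A x" for x
        proof -
          obtain k0 where "norm x < real k0" using reals_Archimedean2 by blast
          then have "x \<in> ?Q k" if "k0 \<le> k" for k
            using that Basis_le_norm[of _ x] by (force simp: mem_box abs_le_iff)
          then have "\<forall>\<^sub>F k in sequentially. (indicator A x :: real) = indicator (A \<inter> ?Q k) x"
            unfolding eventually_sequentially by (intro exI[of _ k0]) (auto simp: indicator_def)
          then show ?thesis by (rule Lim_transform_eventually[OF tendsto_const])
        qed
      qed (auto simp: indicator_def)
    qed
  next
    case (mult u c)
    show ?case
    proof
      assume L2: "(\<lambda>x. c * u x) \<in> L2_functions"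
      show "L2_approx (\<lambda>x. c * u x)"
      proof (cases "c = 0")
        case False
        then have "u \<in> L2_functions" using L2_cmult[OF L2, of "1 / c"] by simp
        then show ?thesis using mult.IH by (intro L2_approx_cmult) simp
      qed (simp add: L2_approx_zero)
    qed
  next
    case (add u v)
    show ?case
    proof
      assume L2: "(\<lambda>x. v x + u x) \<in> L2_functions"
      have "u \<in> L2_functions" "v \<in> L2_functions"
        using add.hyps by (auto intro!: L2_bounded_by[OF _ L2])
      then show "L2_approx (\<lambda>x. v x + u x)" using add.IH by (intro L2_approx_add) simp_all
    qed
  next
    case (seq U)
    show ?case
    proof
      assume L2: "f \<in> L2_functions"
      have le: "U i x \<le> f x" for i x
        by (rule LIMSEQ_le_const[OF seq.hyps(4)]) (use seq.hyps(3) in \<open>auto simp: incseq_def le_fun_def\<close>)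
      show "L2_approx f"
      proof (rule L2_approx_dominated_limit[where F=U, OF _ _ _ L2])
        have "U i \<in> L2_functions" for i
          by (rule L2_bounded_by[OF seq.hyps(1) L2]) (use le seq.hyps(2) assms(2) in simp)
        then show "L2_approx (U i)" for i using seq.IH by simp
        show "\<bar>U i x\<bar> \<le> f x" for i x using le[of i x] seq.hyps(2)[of i x] by simp
      qed (use seq.hyps in auto)
    qed
  qed
  then show ?thesis using assms(1) by simp
qed

lemma L2_approx:
  fixes f :: "'a::euclidean_space \<Rightarrow> real"
  assumes f: "f \<in> L2_functions"
  shows "L2_approx f"
proof -
  have "L2_approx (\<lambda>x. max 0 (f x))" "L2_approx (\<lambda>x. max 0 (- f x))"
    using L2_measurable[OF f] by (auto intro!: L2_approx_nonneg L2_bounded_by[OF _ f])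
  from L2_approx_add[OF this(1) L2_approx_cmult[OF this(2), of "-1"]]
  have "L2_approx (\<lambda>x. max 0 (f x) + (-1) * max 0 (- f x))" .
  moreover have "(\<lambda>x. max 0 (f x) + (-1) * max 0 (- f x)) = f" by (auto simp: max_def)
  ultimately show ?thesis by simp
qed

text \<open>For smooth \<open>\<psi>\<close> near \<open>f\<close>, expanding \<open>L2_sq (f - \<psi>)\<close> and the inequality between arithmetic and
  geometric means give \<open>L2_sq f + L2_sq \<psi> \<approx> 2 \<integral> f \<psi> \<le> c + L2_sq \<psi>\<close>.\<close>

lemma L2_bound_by_duality:
  assumes f: "f \<in> L2_functions" and c: "0 \<le> c"
    and dual: "\<And>\<psi>. \<psi> \<in> smooth_bump \<Longrightarrow> (LINT x|lborel. f x * \<psi> x)\<^sup>2 \<le> c * L2_sq \<psi>"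
  shows "L2_sq f \<le> c"
proof (rule field_le_epsilon)
  fix e :: real assume "0 < e"
  then obtain \<psi> where \<psi>: "\<psi> \<in> smooth_bump" "L2_sq (\<lambda>x. f x - \<psi> x) < e"
    using L2_approx[OF f] unfolding L2_approx_def by blast
  have "(LINT x|lborel. f x * \<psi> x) \<le> sqrt (c * L2_sq \<psi>)"
    using real_sqrt_le_mono[OF dual[OF \<psi>(1)]] by simp
  also have "\<dots> \<le> (c + L2_sq \<psi>) / 2" using c L2_sq_nonneg by (rule arith_geo_mean_sqrt)
  finally have pair: "(LINT x|lborel. f x * \<psi> x) \<le> (c + L2_sq \<psi>) / 2" .
  have "L2_sq f = L2_sq (\<lambda>x. f x - \<psi> x) + 2 * (LINT x|lborel. f x * \<psi> x) - L2_sq \<psi>"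
    using L2_sq_diff[OF f smooth_bump_L2[OF \<psi>(1)]] by simp
  also have "\<dots> \<le> e + 2 * ((c + L2_sq \<psi>) / 2) - L2_sq \<psi>"
    using pair \<psi>(2) by (intro diff_right_mono add_mono mult_left_mono) simp_all
  also have "\<dots> = c + e" by (simp add: add_divide_distrib)
  finally show "L2_sq f \<le> c + e" .
qed

section \<open>Translations of Sobolev functions\<close>

text \<open>Differentiation under the integral. For increments \<open>|u| < 1\<close> the second-order remainder of \<open>\<psi>\<close> is
  at most a multiple of \<open>u\<^sup>2\<close> and vanishes off a fixed ball \<open>Q\<close>, on which \<open>f\<close> is integrable.\<close>

lemma weak_partial_pairing_derivative:
  fixes f :: "'a::euclidean_space \<Rightarrow> real"
  assumes f: "f \<in> L2_functions" and \<psi>: "\<psi> \<in> smooth_bump"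
    and \<psi>': "\<psi>' \<in> smooth_bump"
      "\<And>x t. ((\<lambda>t. \<psi> (x + t *\<^sub>R b)) has_real_derivative \<psi>' (x + t *\<^sub>R b)) (at t)"
  shows "((\<lambda>t. LINT x|lborel. f x * \<psi> (x + t *\<^sub>R b)) has_real_derivative
      (LINT x|lborel. f x * \<psi>' (x + t *\<^sub>R b))) (at t)"
proof -
  have fm [measurable]: "f \<in> borel_measurable borel" by (rule L2_measurable[OF f])
  obtain \<psi>'' where \<psi>'': "\<psi>'' \<in> smooth_bump"
    "\<And>x t. ((\<lambda>t. \<psi>' (x + t *\<^sub>R b)) has_real_derivative \<psi>'' (x + t *\<^sub>R b)) (at t)"
    using smooth_bump_partial[OF \<psi>'(1), of b] by blast
  obtain B R where B: "0 \<le> B" "\<And>x. \<bar>\<psi>'' x\<bar> \<le> B * indicator (cball 0 R) x"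
    using smooth_bump_bound[OF \<psi>''(1)] by blast
  have pair: "integrable lborel (\<lambda>x. f x * \<eta> (x + h))" if "\<eta> \<in> smooth_bump" for \<eta> h
    by (intro L2_mult_integrable[OF f] smooth_bump_L2 smooth_bump_shift that)
  define Q :: "'a set" where "Q = cball 0 (R + (\<bar>t\<bar> + 1) * norm b)"
  have "emeasure lborel Q < \<infinity>" unfolding Q_def by (rule emeasure_bounded_finite) simp
  then have Q: "(indicator Q :: 'a \<Rightarrow> real) \<in> L2_functions"
    by (intro L2_indicator) (auto simp: Q_def)
  have "(\<lambda>x. \<bar>f x\<bar>) \<in> L2_functions" by (rule L2_bounded_by[OF _ f]) simp_all
  then have fQ: "integrable lborel (\<lambda>x. \<bar>f x\<bar> * indicator Q x)" using Q by (rule L2_mult_integrable)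
  define K where "K = B * (LINT x|lborel. \<bar>f x\<bar> * indicator Q x)"
  let ?I = "\<lambda>\<eta> \<tau>. LINT x|lborel. f x * \<eta> (x + \<tau> *\<^sub>R b)"
  show ?thesis
  proof (rule DERIV_of_quadratic_error[of 1 _ _ _ K])
    fix u :: real assume u: "\<bar>u\<bar> < 1"
    define e where "e x = \<psi> (x + (t + u) *\<^sub>R b) - \<psi> (x + t *\<^sub>R b) - \<psi>' (x + t *\<^sub>R b) * u" for x
    have e_bound: "\<bar>e x\<bar> \<le> u\<^sup>2 * (B * indicator Q x)" for x
    proof -
      let ?T = "{t - \<bar>u\<bar>..t + \<bar>u\<bar>}" and ?M = "B * indicator Q x"
      have second: "\<bar>\<psi>'' (x + \<zeta> *\<^sub>R b)\<bar> \<le> ?M" if "\<zeta> \<in> ?T" for \<zeta>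
      proof (cases "x \<in> Q")
        case True
        have "\<bar>\<psi>'' (x + \<zeta> *\<^sub>R b)\<bar> \<le> B * indicator (cball 0 R) (x + \<zeta> *\<^sub>R b)" by (rule B(2))
        also have "\<dots> \<le> B * 1" using B(1) by (intro mult_left_mono) (auto simp: indicator_def)
        finally show ?thesis using True by simp
      next
        case False
        have "\<bar>\<zeta>\<bar> \<le> \<bar>t\<bar> + 1" using that u by auto
        then have "norm (\<zeta> *\<^sub>R b) \<le> (\<bar>t\<bar> + 1) * norm b" by (simp add: mult_right_mono)
        then have "R < norm (x + \<zeta> *\<^sub>R b)"
          using False norm_triangle_ineq4[of "x + \<zeta> *\<^sub>R b" "\<zeta> *\<^sub>R b"] by (simp add: Q_def)
        then show ?thesis using B(2)[of "x + \<zeta> *\<^sub>R b"] False by simp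
      qed
      have first: "\<bar>\<psi>' (x + \<xi> *\<^sub>R b) - \<psi>' (x + t *\<^sub>R b)\<bar> \<le> ?M * \<bar>u\<bar>" if \<xi>: "\<xi> \<in> ?T" for \<xi>
      proof -
        have "\<bar>\<psi>' (x + \<xi> *\<^sub>R b) - \<psi>' (x + t *\<^sub>R b)\<bar> \<le> ?M * \<bar>\<xi> - t\<bar>"
          using field_differentiable_bound[of ?T "\<lambda>\<tau>. \<psi>' (x + \<tau> *\<^sub>R b)" "\<lambda>\<tau>. \<psi>'' (x + \<tau> *\<^sub>R b)" ?M \<xi> t]
            \<psi>''(2) second \<xi> by (auto intro: has_field_derivative_at_within)
        also have "\<dots> \<le> ?M * \<bar>u\<bar>" using \<xi> B(1) by (intro mult_left_mono) auto
        finally show ?thesis .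
      qed
      have "\<bar>(\<psi> (x + (t + u) *\<^sub>R b) - \<psi>' (x + t *\<^sub>R b) * (t + u)) - (\<psi> (x + t *\<^sub>R b) - \<psi>' (x + t *\<^sub>R b) * t)\<bar>
          \<le> ?M * \<bar>u\<bar> * \<bar>(t + u) - t\<bar>"
      proof (rule field_differentiable_bound[of ?T "\<lambda>\<tau>. \<psi> (x + \<tau> *\<^sub>R b) - \<psi>' (x + t *\<^sub>R b) * \<tau>", unfolded real_norm_def])
        show "((\<lambda>\<tau>. \<psi> (x + \<tau> *\<^sub>R b) - \<psi>' (x + t *\<^sub>R b) * \<tau>) has_field_derivative
            \<psi>' (x + \<xi> *\<^sub>R b) - \<psi>' (x + t *\<^sub>R b)) (at \<xi> within ?T)" for \<xi>
          by (auto intro!: derivative_eq_intros has_field_derivative_at_within[OF \<psi>'(2)])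
      qed (use first in auto)
      then show ?thesis by (simp add: e_def power2_eq_square algebra_simps abs_mult_self_eq flip: abs_mult)
    qed
    have split: "f x * e x = f x * \<psi> (x + (t + u) *\<^sub>R b) - f x * \<psi> (x + t *\<^sub>R b) - f x * \<psi>' (x + t *\<^sub>R b) * u" for x
      by (simp add: e_def algebra_simps)
    have e_int: "integrable lborel (\<lambda>x. f x * e x)"
      unfolding split using pair \<psi> \<psi>'(1) by simp
    have "?I \<psi> (t + u) - ?I \<psi> t - ?I \<psi>' t * u = (LINT x|lborel. f x * e x)"
      unfolding split using pair \<psi> \<psi>'(1) by simp
    also have "\<bar>\<dots>\<bar> \<le> (LINT x|lborel. \<bar>f x * e x\<bar>)" by (rule integral_abs_bound)
    also have "\<dots> \<le> (LINT x|lborel. u\<^sup>2 * B * (\<bar>f x\<bar> * indicator Q x))"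
    proof (rule integral_mono)
      show "\<bar>f x * e x\<bar> \<le> u\<^sup>2 * B * (\<bar>f x\<bar> * indicator Q x)" for x
        using mult_left_mono[OF e_bound[of x], of "\<bar>f x\<bar>"] by (simp add: abs_mult mult_ac)
    qed (use e_int fQ in auto)
    also have "\<dots> = K * u\<^sup>2" by (simp add: K_def)
    finally show "\<bar>?I \<psi> (t + u) - ?I \<psi> t - ?I \<psi>' t * u\<bar> \<le> K * u\<^sup>2" .
  qed simp
qed

text \<open>Moving the translation to the test function turns the pairing of \<open>f (x + t b) - f x\<close> with \<open>\<psi>\<close> into
  an increment of \<open>\<Phi> \<tau> = \<integral> f(x) \<psi>(x + \<tau> b) dx\<close>. By the weak derivative,
  the derivative of \<open>\<Phi>\<close> is the negative pairing of \<open>g\<close> with a translate of \<open>\<psi>\<close>, hence bounded by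
  the product of the norms, and duality gives the claim.\<close>

lemma shift_modulus_weak_partial:
  assumes f: "f \<in> L2_functions" and g: "g \<in> L2_functions" and weak: "is_weak_partial f b g"
  shows "shift_modulus f (t *\<^sub>R b) \<le> ennreal (t\<^sup>2 * L2_sq g)"
proof -
  have fm [measurable]: "f \<in> borel_measurable borel" by (rule L2_measurable[OF f])
  let ?F = "\<lambda>x. f (x + t *\<^sub>R b) - f x"
  have F: "?F \<in> L2_functions" by (intro L2_diff L2_shift f)
  have "L2_sq ?F \<le> t\<^sup>2 * L2_sq g"
  proof (rule L2_bound_by_duality[OF F])
    fix \<psi> :: "'a \<Rightarrow> real" assume \<psi>: "\<psi> \<in> smooth_bump"
    define \<Phi> where "\<Phi> \<tau> = (LINT x|lborel. f x * \<psi> (x + \<tau> *\<^sub>R b))" for \<tau>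
    obtain \<psi>' where \<psi>': "\<psi>' \<in> smooth_bump"
      "\<And>x t. ((\<lambda>t. \<psi> (x + t *\<^sub>R b)) has_real_derivative \<psi>' (x + t *\<^sub>R b)) (at t)"
      using smooth_bump_partial[OF \<psi>, of b] by blast
    have \<psi>L2: "\<psi> \<in> L2_functions" by (rule smooth_bump_L2[OF \<psi>])
    have \<psi>m [measurable]: "\<psi> \<in> borel_measurable borel" by (rule L2_measurable[OF \<psi>L2])
    have deriv: "(\<Phi> has_real_derivative (LINT x|lborel. f x * \<psi>' (x + \<tau> *\<^sub>R b))) (at \<tau>)" for \<tau>
      unfolding \<Phi>_def by (rule weak_partial_pairing_derivative[OF f \<psi> \<psi>'])
    have deriv_bound: "\<bar>LINT x|lborel. f x * \<psi>' (x + \<tau> *\<^sub>R b)\<bar> \<le> sqrt (L2_sq g * L2_sq \<psi>)" for \<tau>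
    proof -
      let ?\<eta> = "\<lambda>x. \<psi> (x + \<tau> *\<^sub>R b)"
      have \<eta>: "?\<eta> \<in> smooth_bump" by (rule smooth_bump_shift[OF \<psi>])
      obtain \<eta>' where \<eta>': "\<And>x. frechet_derivative ?\<eta> (at x) b = \<eta>' x"
        "\<And>x t. ((\<lambda>t. ?\<eta> (x + t *\<^sub>R b)) has_real_derivative \<eta>' (x + t *\<^sub>R b)) (at t)"
        using smooth_bump_partial[OF \<eta>, of b] by blast
      have "\<eta>' x = \<psi>' (x + \<tau> *\<^sub>R b)" for x
      proof -
        have "((\<lambda>t. \<psi> (x + \<tau> *\<^sub>R b + t *\<^sub>R b)) has_real_derivative \<psi>' (x + \<tau> *\<^sub>R b)) (at 0)"
          using \<psi>'(2)[of "x + \<tau> *\<^sub>R b" 0] by simp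
        moreover have "((\<lambda>t. \<psi> (x + \<tau> *\<^sub>R b + t *\<^sub>R b)) has_real_derivative \<eta>' x) (at 0)"
          using \<eta>'(2)[of x 0] by (simp add: add_ac)
        ultimately show ?thesis by (rule DERIV_unique[symmetric])
      qed
      then have "(LINT x|lborel. f x * \<psi>' (x + \<tau> *\<^sub>R b)) = - (LINT x|lborel. g x * ?\<eta> x)"
        using bspec[OF weak[unfolded is_weak_partial_def] smooth_bump_test[OF \<eta>]]
        unfolding \<eta>'(1) by simp
      moreover have "(LINT x|lborel. g x * ?\<eta> x)\<^sup>2 \<le> L2_sq g * L2_sq ?\<eta>"
        by (rule L2_Cauchy_Schwarz[OF g smooth_bump_L2[OF \<eta>]])
      moreover have "L2_sq ?\<eta> = L2_sq \<psi>"
        by (rule integral_shift[where f="\<lambda>x. (\<psi> x)\<^sup>2"]) simp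
      ultimately have "(LINT x|lborel. f x * \<psi>' (x + \<tau> *\<^sub>R b))\<^sup>2 \<le> L2_sq g * L2_sq \<psi>" by simp
      then show ?thesis using real_sqrt_le_mono by fastforce
    qed
    have "\<bar>\<Phi> (- t) - \<Phi> 0\<bar> \<le> sqrt (L2_sq g * L2_sq \<psi>) * \<bar>- t - 0\<bar>"
      using field_differentiable_bound[of UNIV \<Phi> "\<lambda>\<tau>. LINT x|lborel. f x * \<psi>' (x + \<tau> *\<^sub>R b)"
          "sqrt (L2_sq g * L2_sq \<psi>)" "- t" 0] deriv deriv_bound by auto
    then have "(\<Phi> (- t) - \<Phi> 0)\<^sup>2 \<le> (sqrt (L2_sq g * L2_sq \<psi>) * \<bar>t\<bar>)\<^sup>2"
      using power_mono[of "\<bar>\<Phi> (- t) - \<Phi> 0\<bar>" _ 2] by simp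
    also have "\<dots> = t\<^sup>2 * L2_sq g * L2_sq \<psi>"
      by (simp add: power_mult_distrib L2_sq_nonneg)
    also have "\<Phi> (- t) - \<Phi> 0 = (LINT x|lborel. ?F x * \<psi> x)"
    proof -
      have "\<Phi> (- t) = (LINT x|lborel. f (x + t *\<^sub>R b) * \<psi> (x + t *\<^sub>R b + (- t) *\<^sub>R b))"
        unfolding \<Phi>_def by (rule integral_shift[symmetric, where f="\<lambda>x. f x * \<psi> (x + (- t) *\<^sub>R b)"]) simp
      then have "\<Phi> (- t) = (LINT x|lborel. f (x + t *\<^sub>R b) * \<psi> x)" by simp
      moreover have "integrable lborel (\<lambda>x. f (x + t *\<^sub>R b) * \<psi> x)" "integrable lborel (\<lambda>x. f x * \<psi> x)"
        by (intro L2_mult_integrable L2_shift f \<psi>L2)+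
      ultimately show ?thesis by (simp add: \<Phi>_def left_diff_distrib)
    qed
    finally show "(LINT x|lborel. ?F x * \<psi> x)\<^sup>2 \<le> t\<^sup>2 * L2_sq g * L2_sq \<psi>" .
  qed (simp add: L2_sq_nonneg)
  moreover have "shift_modulus f (t *\<^sub>R b) = ennreal (L2_sq ?F)"
    unfolding shift_modulus_def by (rule nn_integral_L2_sq[OF F])
  ultimately show ?thesis by (simp add: ennreal_leI)
qed

text \<open>The translation is performed one coordinate at a time. Every step doubles the constant, which is
  harmless in a fixed dimension.\<close>

lemma shift_modulus_W12:
  fixes f :: "'a::euclidean_space \<Rightarrow> real"
  assumes f: "f \<in> sobolev_W12"
  shows "\<exists>C\<ge>0. \<forall>h. shift_modulus f h \<le> ennreal (C * (norm h)\<^sup>2)"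
proof -
  have L2: "f \<in> L2_functions" using f by (simp add: sobolev_W12_def)
  then have fm: "f \<in> borel_measurable borel" by (simp add: L2_functions_def)
  have "\<exists>C\<ge>0. \<forall>h. shift_modulus f (\<Sum>b\<in>B. (h \<bullet> b) *\<^sub>R b) \<le> ennreal (C * (norm h)\<^sup>2)"
    if "finite B" "B \<subseteq> Basis" for B :: "'a set"
    using that
  proof (induction B rule: finite_induct)
    case empty
    show ?case by (intro exI[of _ 0]) simp
  next
    case (insert b B)
    then obtain C where C: "0 \<le> C" "\<And>h. shift_modulus f (\<Sum>b\<in>B. (h \<bullet> b) *\<^sub>R b) \<le> ennreal (C * (norm h)\<^sup>2)"
      by auto
    have "b \<in> Basis" using insert.prems by simp
    then obtain g where g: "g \<in> L2_functions" "is_weak_partial f b g"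
      using f by (auto simp: sobolev_W12_def)
    let ?G = "L2_sq g"
    have G: "0 \<le> ?G" by (rule L2_sq_nonneg)
    have "shift_modulus f (\<Sum>b\<in>insert b B. (h \<bullet> b) *\<^sub>R b) \<le> ennreal ((2 * ?G + 2 * C) * (norm h)\<^sup>2)" for h
    proof -
      have "(h \<bullet> b)\<^sup>2 \<le> (norm h)\<^sup>2"
        using Basis_le_norm[OF \<open>b \<in> Basis\<close>, of h] power_mono[of "\<bar>h \<bullet> b\<bar>" "norm h" 2] by simp
      then have "(h \<bullet> b)\<^sup>2 * ?G \<le> ?G * (norm h)\<^sup>2" using mult_right_mono[OF _ G] by (simp add: mult.commute)
      then have *: "shift_modulus f ((h \<bullet> b) *\<^sub>R b) \<le> ennreal (?G * (norm h)\<^sup>2)"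
        using shift_modulus_weak_partial[OF L2 g, of "h \<bullet> b"] by (meson ennreal_leI order_trans)
      have "shift_modulus f (\<Sum>b\<in>insert b B. (h \<bullet> b) *\<^sub>R b)
          = shift_modulus f ((h \<bullet> b) *\<^sub>R b + (\<Sum>b\<in>B. (h \<bullet> b) *\<^sub>R b))"
        using insert.hyps by simp
      also have "\<dots> \<le> 2 * shift_modulus f ((h \<bullet> b) *\<^sub>R b) + 2 * shift_modulus f (\<Sum>b\<in>B. (h \<bullet> b) *\<^sub>R b)"
        by (rule shift_modulus_add_le[OF fm])
      also have "\<dots> \<le> 2 * ennreal (?G * (norm h)\<^sup>2) + 2 * ennreal (C * (norm h)\<^sup>2)"
        by (intro add_mono mult_left_mono * C(2)) auto
      also have "\<dots> = ennreal ((2 * ?G + 2 * C) * (norm h)\<^sup>2)"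
        using G C(1) by (simp add: ennreal_mult'[symmetric] distrib_right mult.assoc flip: ennreal_plus ennreal_numeral)
      finally show ?thesis .
    qed
    then show ?case using G C(1) by (intro exI[of _ "2 * ?G + 2 * C"]) auto
  qed
  from this[of Basis] show ?thesis by (simp add: euclidean_representation)
qed

theorem shift_modulus_sobolev:
  fixes f :: "'a::euclidean_space \<Rightarrow> real"
  assumes "0 < s" "f \<in> sobolev s"
  shows "\<exists>C\<ge>0. \<forall>h. shift_modulus f h \<le> ennreal (C * norm h powr (2 * s))"
proof (cases "s = 1")
  case True
  then show ?thesis using shift_modulus_W12[of f] assms by (simp add: sobolev_def)
next
  case False
  then show ?thesis using shift_modulus_sobolev_frac[of f s] assms by (simp add: sobolev_def)
qed

section \<open>Approximation by mixtures at a fixed scale\<close>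

lemma nn_integral_scale:
  fixes f :: "'a::euclidean_space \<Rightarrow> ennreal"
  assumes [measurable]: "f \<in> borel_measurable borel" and c: "0 < c"
  shows "(\<integral>\<^sup>+x. ennreal (c ^ DIM('a)) * f (c *\<^sub>R x) \<partial>lborel) = (\<integral>\<^sup>+x. f x \<partial>lborel)"
proof -
  have "lborel = density (distr lborel borel (\<lambda>x::'a. 0 + c *\<^sub>R x)) (\<lambda>_. ennreal (\<bar>c\<bar> ^ DIM('a)))"
    by (rule lborel_affine) (use c in simp)
  then have "(\<integral>\<^sup>+x. f x \<partial>lborel) = (\<integral>\<^sup>+x. f x \<partial>density (distr lborel borel (\<lambda>x::'a. 0 + c *\<^sub>R x)) (\<lambda>_. ennreal (\<bar>c\<bar> ^ DIM('a))))"
    by simp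
  also have "\<dots> = (\<integral>\<^sup>+x. ennreal (c ^ DIM('a)) * f x \<partial>distr lborel borel (\<lambda>x::'a. 0 + c *\<^sub>R x))"
    using c by (subst nn_integral_density) auto
  also have "\<dots> = (\<integral>\<^sup>+x. ennreal (c ^ DIM('a)) * f (c *\<^sub>R x) \<partial>lborel)"
    by (subst nn_integral_distr) auto
  finally show ?thesis by simp
qed

text \<open>The smoothing error at \<open>x\<close> is the average of \<open>f \<mu> - f x\<close> with weight \<open>k (x - \<mu>)\<close>. Splitting the
  weight, with \<open>z = x - \<mu>\<close>, into the square roots of \<open>|z| powr s * k z\<close> and \<open>|z| powr (- s) * k z\<close> and applying
  Cauchy--Schwarz, the first factor is the moment. The second integrates, by Fubini's theorem, to
  at most \<open>C\<close> times the same moment, because the modulus contributes \<open>|z| powr (2 s)\<close>. Convexity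
  of the square alone would require the moment of order \<open>2 s\<close>.\<close>

lemma smoothing_bias:
  fixes k f :: "'a::euclidean_space \<Rightarrow> real"
  assumes km [measurable]: "k \<in> borel_measurable borel" and k: "\<And>x. 0 \<le> k x" "\<And>x. k x \<le> B"
    and k1: "(\<integral>\<^sup>+x. ennreal (k x) \<partial>lborel) = 1"
    and moment: "(\<integral>\<^sup>+x. ennreal (norm x powr s * k x) \<partial>lborel) \<le> ennreal \<kappa>" and \<kappa>: "0 < \<kappa>"
    and fm [measurable]: "f \<in> borel_measurable borel" and fi: "integrable lborel f"
    and C: "0 \<le> C" "\<And>h. shift_modulus f h \<le> ennreal (C * norm h powr (2 * s))"
  shows "(\<integral>\<^sup>+x. ennreal (((LINT \<mu>|lborel. k (x - \<mu>) * f \<mu>) - f x)\<^sup>2) \<partial>lborel) \<le> ennreal (C * \<kappa>\<^sup>2)"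
proof -
  let ?g = "\<lambda>x. LINT \<mu>|lborel. k (x - \<mu>) * f \<mu>"
  have B: "0 \<le> B" using k order_trans by blast
  let ?w = "\<lambda>z. norm z powr (- s) * k z"
  define J where "J x = (\<integral>\<^sup>+z. ennreal (?w z) * ennreal ((f (x + (- z)) - f x)\<^sup>2) \<partial>lborel)" for x
  have kk_int: "integrable lborel (\<lambda>\<mu>. k (x - \<mu>))" and kk_1: "(LINT \<mu>|lborel. k (x - \<mu>)) = 1" for x
  proof -
    have "(\<integral>\<^sup>+\<mu>. ennreal (k (x - \<mu>)) \<partial>lborel) = ennreal 1"
      using k1 by (subst nn_integral_reflect[where f="\<lambda>x. ennreal (k x)"]) auto
    then have "has_bochner_integral lborel (\<lambda>\<mu>. k (x - \<mu>)) 1"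
      using k by (intro has_bochner_integral_nn_integral) auto
    then show "integrable lborel (\<lambda>\<mu>. k (x - \<mu>))" "(LINT \<mu>|lborel. k (x - \<mu>)) = 1"
      by (auto simp: has_bochner_integral_iff)
  qed
  have kf_int: "integrable lborel (\<lambda>\<mu>. k (x - \<mu>) * f \<mu>)" for x
  proof (rule Bochner_Integration.integrable_bound)
    show "integrable lborel (\<lambda>\<mu>. B * f \<mu>)" using fi by simp
    show "AE \<mu> in lborel. norm (k (x - \<mu>) * f \<mu>) \<le> norm (B * f \<mu>)"
      using k B by (intro AE_I2) (auto simp: abs_mult intro!: mult_right_mono)
  qed simp
  have pointwise: "ennreal ((?g x - f x)\<^sup>2) \<le> ennreal \<kappa> * J x" for x
  proof (cases "J x < \<infinity>")
    case False
    then have "J x = \<infinity>" by (simp add: less_top[symmetric])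
    then show ?thesis using \<kappa> by (simp add: ennreal_mult_top)
  next
    case True
    define u where "u \<mu> = sqrt (norm (x - \<mu>) powr s * k (x - \<mu>))" for \<mu>
    define v where "v \<mu> = sqrt (?w (x - \<mu>)) * (f \<mu> - f x)" for \<mu>
    have um [measurable]: "u \<in> borel_measurable borel" and vm [measurable]: "v \<in> borel_measurable borel"
      unfolding u_def v_def by measurable
    have u2: "(u \<mu>)\<^sup>2 = norm (x - \<mu>) powr s * k (x - \<mu>)" for \<mu> using k by (simp add: u_def)
    have v2: "(v \<mu>)\<^sup>2 = ?w (x - \<mu>) * (f \<mu> - f x)\<^sup>2" for \<mu>
      using k by (simp add: v_def power_mult_distrib)
    have uv: "u \<mu> * v \<mu> = k (x - \<mu>) * (f \<mu> - f x)" for \<mu>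
    proof (cases "x = \<mu>")
      case False
      have "u \<mu> * v \<mu> = sqrt ((norm (x - \<mu>) powr s * norm (x - \<mu>) powr (- s)) * (k (x - \<mu>))\<^sup>2) * (f \<mu> - f x)"
        by (simp add: u_def v_def real_sqrt_mult[symmetric] power2_eq_square mult_ac)
      also have "norm (x - \<mu>) powr s * norm (x - \<mu>) powr (- s) = 1"
        using False by (simp flip: powr_add)
      finally show ?thesis using k by simp
    qed (simp add: v_def)
    have "(\<integral>\<^sup>+\<mu>. ennreal ((u \<mu>)\<^sup>2) \<partial>lborel) = (\<integral>\<^sup>+x. ennreal (norm x powr s * k x) \<partial>lborel)"
      unfolding u2 by (rule nn_integral_reflect) simp
    then have U: "(\<integral>\<^sup>+\<mu>. ennreal ((u \<mu>)\<^sup>2) \<partial>lborel) \<le> ennreal \<kappa>" using moment by simp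
    have "J x = (\<integral>\<^sup>+\<mu>. ennreal (?w (x - \<mu>)) * ennreal ((f (x + (- (x - \<mu>))) - f x)\<^sup>2) \<partial>lborel)"
      unfolding J_def by (rule nn_integral_reflect[symmetric]) simp
    also have "\<dots> = (\<integral>\<^sup>+\<mu>. ennreal ((v \<mu>)\<^sup>2) \<partial>lborel)"
      using k by (simp add: v2 ennreal_mult)
    finally have V: "J x = (\<integral>\<^sup>+\<mu>. ennreal ((v \<mu>)\<^sup>2) \<partial>lborel)" .
    have uL2: "u \<in> L2_functions"
      by (rule L2_functionsI[OF um]) (use U in \<open>auto intro: order_le_less_trans\<close>)
    have vL2: "v \<in> L2_functions"
      by (rule L2_functionsI[OF vm]) (use V True in simp)
    have "?g x - f x = (LINT \<mu>|lborel. k (x - \<mu>) * (f \<mu> - f x))"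
      using kf_int[of x] kk_int[of x] kk_1[of x] by (simp add: right_diff_distrib)
    also have "\<dots> = (LINT \<mu>|lborel. u \<mu> * v \<mu>)" by (simp add: uv)
    finally have "(?g x - f x)\<^sup>2 \<le> L2_sq u * L2_sq v"
      using L2_Cauchy_Schwarz[OF uL2 vL2] by simp
    then have "ennreal ((?g x - f x)\<^sup>2) \<le> ennreal (L2_sq u) * ennreal (L2_sq v)"
      by (simp add: ennreal_leI L2_sq_nonneg flip: ennreal_mult)
    also have "\<dots> = (\<integral>\<^sup>+\<mu>. ennreal ((u \<mu>)\<^sup>2) \<partial>lborel) * J x"
      by (simp only: V nn_integral_L2_sq[OF uL2] nn_integral_L2_sq[OF vL2])
    also have "\<dots> \<le> ennreal \<kappa> * J x" using U by (rule mult_right_mono) simp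
    finally show ?thesis .
  qed
  have J_total: "(\<integral>\<^sup>+x. J x \<partial>lborel) \<le> ennreal C * ennreal \<kappa>"
  proof -
    have "(\<integral>\<^sup>+x. J x \<partial>lborel)
        = (\<integral>\<^sup>+z. (\<integral>\<^sup>+x. ennreal (?w z) * ennreal ((f (x + (- z)) - f x)\<^sup>2) \<partial>lborel) \<partial>lborel)"
      unfolding J_def by (rule lborel_pair.Fubini'[symmetric]) measurable
    also have "\<dots> = (\<integral>\<^sup>+z. ennreal (?w z) * shift_modulus f (- z) \<partial>lborel)"
      unfolding shift_modulus_def by (intro nn_integral_cong nn_integral_cmult) simp
    also have "\<dots> \<le> (\<integral>\<^sup>+z. ennreal C * ennreal (norm z powr s * k z) \<partial>lborel)"
    proof (rule nn_integral_mono)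
      fix z :: 'a
      have "ennreal (?w z) * shift_modulus f (- z)
          \<le> ennreal (?w z) * ennreal (C * norm z powr (2 * s))"
        using C(2)[of "- z"] by (intro mult_left_mono) simp_all
      also have "\<dots> = ennreal (C * (norm z powr s * k z))"
      proof -
        have "norm z powr (- s) * norm z powr (2 * s) = norm z powr s" by (simp flip: powr_add)
        then have "?w z * (C * norm z powr (2 * s)) = C * (norm z powr s * k z)"
          by (simp add: mult_ac)
        then show ?thesis using k C(1) by (simp flip: ennreal_mult)
      qed
      finally show "ennreal (?w z) * shift_modulus f (- z)
          \<le> ennreal C * ennreal (norm z powr s * k z)"
        using k C(1) by (simp flip: ennreal_mult)
    qed
    also have "\<dots> = ennreal C * (\<integral>\<^sup>+z. ennreal (norm z powr s * k z) \<partial>lborel)"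
      by (rule nn_integral_cmult) simp
    also have "\<dots> \<le> ennreal C * ennreal \<kappa>" using moment by (rule mult_left_mono) simp
    finally show ?thesis .
  qed
  have "(\<integral>\<^sup>+x. ennreal ((?g x - f x)\<^sup>2) \<partial>lborel) \<le> (\<integral>\<^sup>+x. ennreal \<kappa> * J x \<partial>lborel)"
    by (rule nn_integral_mono) (rule pointwise)
  also have "\<dots> = ennreal \<kappa> * (\<integral>\<^sup>+x. J x \<partial>lborel)"
    unfolding J_def by (rule nn_integral_cmult) measurable
  also have "\<dots> \<le> ennreal \<kappa> * (ennreal C * ennreal \<kappa>)" using J_total by (rule mult_left_mono) simp
  also have "\<dots> = ennreal (C * \<kappa>\<^sup>2)"
    using \<kappa> C(1) by (simp add: power2_eq_square mult_ac flip: ennreal_mult)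
  finally show ?thesis .
qed

lemma (in prob_space) exists_le_nn_expectation:
  assumes [measurable]: "h \<in> borel_measurable M" and le: "(\<integral>\<^sup>+x. h x \<partial>M) \<le> c" and c: "c < \<infinity>"
  shows "\<exists>x\<in>space M. h x \<le> c"
proof (rule ccontr)
  assume "\<not> ?thesis"
  then have less: "\<And>x. x \<in> space M \<Longrightarrow> c < h x" by (auto simp: not_le)
  have "(\<integral>\<^sup>+x. c \<partial>M) < (\<integral>\<^sup>+x. h x \<partial>M)"
  proof (rule nn_integral_less)
    show "(\<integral>\<^sup>+x. c \<partial>M) \<noteq> \<infinity>" using c by (simp add: emeasure_space_1)
    show "AE x in M. c \<le> h x" using less by (auto intro: less_imp_le)
    show "\<not> (AE x in M. h x \<le> c)"
    proof
      assume "AE x in M. h x \<le> c"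
      then have "AE x in M. False" using less by (auto elim!: AE_mp intro!: AE_I2 simp: not_le[symmetric])
      then show False by simp
    qed
  qed simp_all
  then show False using le by (simp add: emeasure_space_1)
qed

text \<open>Maurey's method, one translate at a time. If \<open>y\<close> is drawn from the density \<open>f\<close>, then
  \<open>k (x - y) - g x\<close> is centred for every \<open>x\<close>, so adding it raises the expected squared norm of the partial
  sum by at most \<open>c\<close>; some \<open>y\<close> does no worse than the average.\<close>

lemma maurey_translates:
  fixes k f :: "'a::euclidean_space \<Rightarrow> real"
  assumes km [measurable]: "k \<in> borel_measurable borel" and k: "\<And>x. 0 \<le> k x" "\<And>x. k x \<le> B"
    and k2: "(\<integral>\<^sup>+x. ennreal ((k x)\<^sup>2) \<partial>lborel) \<le> ennreal c" and c: "0 \<le> c"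
    and f: "f \<in> prob_densities"
  defines "g \<equiv> \<lambda>x. LINT \<mu>|lborel. k (x - \<mu>) * f \<mu>"
  shows "\<exists>\<mu> :: nat \<Rightarrow> 'a. (\<integral>\<^sup>+x. ennreal ((\<Sum>j=1..m. k (x - \<mu> j) - g x)\<^sup>2) \<partial>lborel) \<le> ennreal (m * c)"
proof (induction m)
  case (Suc m)
  then obtain \<mu> :: "nat \<Rightarrow> 'a" where IH:
    "(\<integral>\<^sup>+x. ennreal ((\<Sum>j=1..m. k (x - \<mu> j) - g x)\<^sup>2) \<partial>lborel) \<le> ennreal (m * c)" by blast
  have fm [measurable]: "f \<in> borel_measurable borel" and f0: "\<And>x. 0 \<le> f x"
    and fi: "integrable lborel f" "(LINT x|lborel. f x) = 1"
    using f by (auto simp: prob_densities_def)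
  define D where "D = density lborel (\<lambda>x. ennreal (f x))"
  have sD [measurable_cong, simp]: "sets D = sets borel" by (simp add: D_def)
  have "emeasure D (space D) = 1"
    using fi f0 by (simp add: D_def emeasure_density nn_integral_eq_integral)
  then interpret D: prob_space D by (rule prob_spaceI)
  interpret DL: pair_sigma_finite D lborel ..
  have gD: "g x = (LINT \<mu>|D. k (x - \<mu>))" for x
    unfolding g_def D_def using f0 by (subst integral_density) (auto simp: mult.commute)
  have gm [measurable]: "g \<in> borel_measurable borel"
    unfolding g_def by measurable
  let ?c = "ennreal (Suc m * c)"
  define S where "S x = (\<Sum>j=1..m. k (x - \<mu> j) - g x)" for x
  let ?v = "\<lambda>x. \<integral>\<^sup>+y. ennreal ((k (x - y))\<^sup>2) \<partial>D" and ?T = "\<lambda>x y. S x + (k (x - y) - g x)"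
  have Sm [measurable]: "S \<in> borel_measurable borel" unfolding S_def by measurable
  have k_int: "integrable D (\<lambda>y. k (x - y))" and k2_int: "integrable D (\<lambda>y. (k (x - y))\<^sup>2)" for x
  proof -
    show "integrable D (\<lambda>y. k (x - y))"
      using k by (intro D.integrable_const_bound[where B=B]) auto
    show "integrable D (\<lambda>y. (k (x - y))\<^sup>2)"
      using k by (intro D.integrable_const_bound[where B="B\<^sup>2"]) (auto intro!: power_mono)
  qed
  have variance: "(\<integral>\<^sup>+y. ennreal ((?T x y)\<^sup>2) \<partial>D)
      \<le> ennreal ((S x)\<^sup>2) + ?v x" for x
  proof -
    have eq: "(?T x y)\<^sup>2 = (S x - g x)\<^sup>2 + 2 * (S x - g x) * k (x - y) + (k (x - y))\<^sup>2" for y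
      by (simp add: power2_eq_square algebra_simps)
    have int: "integrable D (\<lambda>y. (?T x y)\<^sup>2)"
      unfolding eq using k_int k2_int by simp
    have "(LINT y|D. (?T x y)\<^sup>2) = (S x - g x)\<^sup>2 + 2 * (S x - g x) * g x + (LINT y|D. (k (x - y))\<^sup>2)"
      unfolding eq using k_int k2_int by (simp add: gD D.prob_space)
    also have "\<dots> = (S x)\<^sup>2 - (g x)\<^sup>2 + (LINT y|D. (k (x - y))\<^sup>2)" by (simp add: power2_eq_square algebra_simps)
    also have "\<dots> \<le> (S x)\<^sup>2 + (LINT y|D. (k (x - y))\<^sup>2)" by simp
    finally have "ennreal (LINT y|D. (?T x y)\<^sup>2) \<le> ennreal ((S x)\<^sup>2) + ennreal (LINT y|D. (k (x - y))\<^sup>2)"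
      by (simp add: ennreal_leI flip: ennreal_plus)
    then show ?thesis using int k2_int by (simp add: nn_integral_eq_integral)
  qed
  let ?h = "\<lambda>y. \<integral>\<^sup>+x. ennreal ((?T x y)\<^sup>2) \<partial>lborel"
  have "(\<integral>\<^sup>+y. ?h y \<partial>D) = (\<integral>\<^sup>+x. (\<integral>\<^sup>+y. ennreal ((?T x y)\<^sup>2) \<partial>D) \<partial>lborel)"
    by (rule DL.Fubini'[symmetric]) measurable
  also have "\<dots> \<le> (\<integral>\<^sup>+x. ennreal ((S x)\<^sup>2) + ?v x \<partial>lborel)"
    by (rule nn_integral_mono) (rule variance)
  also have "\<dots> = (\<integral>\<^sup>+x. ennreal ((S x)\<^sup>2) \<partial>lborel) + (\<integral>\<^sup>+x. ?v x \<partial>lborel)"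
    by (rule nn_integral_add) measurable
  also have "(\<integral>\<^sup>+x. ?v x \<partial>lborel) = (\<integral>\<^sup>+y. (\<integral>\<^sup>+x. ennreal ((k (x - y))\<^sup>2) \<partial>lborel) \<partial>D)"
    by (rule DL.Fubini') measurable
  also have "\<dots> = (\<integral>\<^sup>+y. (\<integral>\<^sup>+x. ennreal ((k x)\<^sup>2) \<partial>lborel) \<partial>D)"
  proof (rule nn_integral_cong)
    fix y :: 'a
    show "(\<integral>\<^sup>+x. ennreal ((k (x - y))\<^sup>2) \<partial>lborel) = (\<integral>\<^sup>+x. ennreal ((k x)\<^sup>2) \<partial>lborel)"
      using nn_integral_shift[of "\<lambda>x. ennreal ((k x)\<^sup>2)" "- y"] by simp
  qed
  also have "\<dots> = (\<integral>\<^sup>+x. ennreal ((k x)\<^sup>2) \<partial>lborel)" by (simp add: D.emeasure_space_1)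
  also have "(\<integral>\<^sup>+x. ennreal ((S x)\<^sup>2) \<partial>lborel) + \<dots> \<le> ennreal (m * c) + ennreal c"
    using IH k2 unfolding S_def by (rule add_mono)
  also have "\<dots> = ?c" using c by (simp add: algebra_simps flip: ennreal_plus)
  finally have "(\<integral>\<^sup>+y. ?h y \<partial>D) \<le> ?c" .
  then obtain y where y: "?h y \<le> ?c"
  proof -
    have "?h \<in> borel_measurable D" by measurable
    then have "\<exists>y\<in>space D. ?h y \<le> ?c"
      by (rule D.exists_le_nn_expectation) (use \<open>(\<integral>\<^sup>+y. ?h y \<partial>D) \<le> ?c\<close> in simp_all)
    then show ?thesis using that by blast
  qed
  have "(\<Sum>j=1..Suc m. k (x - (\<mu>(Suc m := y)) j) - g x) = S x + (k (x - y) - g x)" for x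
    by (simp add: S_def)
  then show ?case using y by (intro exI[of _ "\<mu>(Suc m := y)"]) simp
qed (use c in simp)

section \<open>Uniform deviations of the empirical measure\<close>

text \<open>For iid data the sample has the product law on which the symmetrization is carried out; the
  Rademacher averages are bounded by \<open>V\<close> alone, uniformly in the sample.\<close>

lemma expected_max_deviation:
  fixes X :: "nat \<Rightarrow> 'w \<Rightarrow> 'a::euclidean_space"
  assumes P: "prob_space P" and indep: "prob_space.indep_vars P (\<lambda>_. borel) X {1..}"
    and D: "\<And>i. 1 \<le> i \<Longrightarrow> distr P borel (X i) = D" and n: "1 \<le> n"
    and F: "finite F" "F \<noteq> {}" "\<And>f. f \<in> F \<Longrightarrow> f \<in> borel_measurable borel \<and> (\<forall>x. 0 \<le> f x \<and> f x \<le> B)"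
    and VC: "VC_at_most V F"
  shows "(\<integral>\<^sup>+\<omega>. ennreal (max_abs F (\<lambda>f. empirical X n \<omega> f - (LINT y|D. f y))) \<partial>P)
    \<le> ennreal (2 * chaining_constant V * B / sqrt n)"
proof -
  let ?dev = "\<lambda>\<omega> f. empirical X n \<omega> f - (LINT y|D. f y)"
  interpret P: prob_space P by fact
  let ?I = "{1..n}"
  have indepI: "P.indep_vars (\<lambda>_. borel) X ?I"
    by (rule P.indep_vars_subset[OF indep]) auto
  have Xm: "X i \<in> measurable P borel" if "i \<in> ?I" for i
    using indepI that by (auto simp: P.indep_vars_def)
  have sD: "sets D = sets borel" and pD: "prob_space D"
    using D[of 1] P.prob_space_distr[OF Xm[of 1]] n by auto
  interpret D: prob_space D by (rule pD)
  let ?PI = "PiM ?I (\<lambda>_. D)"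
  have Fm: "f \<in> borel_measurable D" if "f \<in> F" for f
    using F(3)[OF that] measurable_cong_sets[OF sD refl] by blast
  have bd: "\<bar>f x\<bar> \<le> B" if "f \<in> F" for f x using F(3)[OF that] by (simp add: abs_of_nonneg)
  obtain f\<^sub>1 where "f\<^sub>1 \<in> F" using F(2) by blast
  have B: "0 \<le> B" using order_trans[OF abs_ge_zero bd[OF \<open>f\<^sub>1 \<in> F\<close>]] .
  let ?X = "\<lambda>\<omega>. \<lambda>i\<in>?I. X i \<omega>"
  have law: "distr P ?PI ?X = ?PI"
  proof -
    have "distr P (PiM ?I (\<lambda>_. borel)) ?X = PiM ?I (\<lambda>i. distr P borel (X i))"
      using indepI n Xm P.indep_vars_iff_distr_eq_PiM'[where I="?I" and M'="\<lambda>_. borel" and X=X] by auto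
    also have "\<dots> = ?PI" by (intro PiM_cong) (auto simp: D)
    finally have *: "distr P (PiM ?I (\<lambda>_. borel)) ?X = ?PI" .
    have "distr P ?PI ?X = distr P (PiM ?I (\<lambda>_. borel)) ?X"
      by (intro distr_cong sets_PiM_cong) (auto simp: sD)
    then show ?thesis using * by simp
  qed
  have XmD: "?X \<in> measurable P ?PI"
    using Xm measurable_cong_sets[OF refl sD] by (intro measurable_restrict) blast
  let ?h = "\<lambda>x. max_abs F (\<lambda>f. \<Sum>i=1..n. f (x i) - (LINT y|D. f y))"
  have hm: "?h \<in> borel_measurable ?PI"
    using F(1)
  proof (intro borel_measurable_max_abs borel_measurable_sum borel_measurable_diff borel_measurable_const)
    show "(\<lambda>x. f (x i)) \<in> borel_measurable ?PI" if "f \<in> F" "i \<in> ?I" for f i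
      by (rule measurable_compose[OF measurable_component_singleton[OF that(2)] Fm[OF that(1)]])
  qed
  have h0: "0 \<le> ?h x" for x by (rule max_abs_nonneg[OF F(1,2)])
  have eq: "max_abs F (?dev \<omega>) = ?h (?X \<omega>) / n" for \<omega>
  proof -
    have "?dev \<omega> f = (\<Sum>i=1..n. f (?X \<omega> i) - (LINT y|D. f y)) / n" for f
      using n by (simp add: empirical_def sum_subtractf diff_divide_distrib)
    then have "max_abs F (?dev \<omega>) = Max ((\<lambda>t. t / n) ` (\<lambda>f. \<bar>\<Sum>i=1..n. f (?X \<omega> i) - (LINT y|D. f y)\<bar>) ` F)"
      by (simp only: max_abs_def image_image abs_divide abs_of_nat)
    also have "\<dots> = ?h (?X \<omega>) / n"
      unfolding max_abs_def using F by (intro mono_Max_commute[symmetric]) (auto simp: mono_def divide_right_mono)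
    finally show ?thesis .
  qed
  have "(\<integral>\<^sup>+\<omega>. ennreal (max_abs F (?dev \<omega>)) \<partial>P) = (\<integral>\<^sup>+\<omega>. ennreal (?h (?X \<omega>) / n) \<partial>P)" by (simp only: eq)
  also have "\<dots> = (\<integral>\<^sup>+x. ennreal (?h x / n) \<partial>distr P ?PI ?X)"
    using hm by (intro nn_integral_distr[OF XmD, symmetric]) simp
  also have "\<dots> = (\<integral>\<^sup>+x. ennreal (?h x / n) \<partial>?PI)" by (simp only: law)
  also have "\<dots> = (\<integral>\<^sup>+x. ennreal (1 / n) * ennreal (?h x) \<partial>?PI)"
    using h0 by (simp flip: ennreal_mult')
  also have "\<dots> = ennreal (1 / n) * (\<integral>\<^sup>+x. ennreal (?h x) \<partial>?PI)"
    using hm by (intro nn_integral_cmult) simp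
  also have "\<dots> \<le> ennreal (1 / n) * ennreal (2 * (chaining_constant V * B * sqrt n))"
  proof (rule mult_left_mono)
    have "(\<Sum>\<sigma>\<in>signs ?I. max_abs F (\<lambda>f. \<Sum>i=1..n. \<sigma> i * f (x i))) \<le> 2 ^ n * (chaining_constant V * B * sqrt n)"
      for x :: "nat \<Rightarrow> 'a"
      using rademacher_VC_functions[of ?I F V x B] F VC B by simp
    with F(1,2) Fm bd show "(\<integral>\<^sup>+x. ennreal (?h x) \<partial>?PI) \<le> ennreal (2 * (chaining_constant V * B * sqrt n))"
      by (rule symmetrization[OF pD])
  qed simp
  also have "\<dots> = ennreal (2 * (chaining_constant V * B * sqrt n) / n)"
    by (simp flip: ennreal_mult')
  also have "2 * (chaining_constant V * B * sqrt n) / n = 2 * chaining_constant V * B / sqrt n"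
    using n by (simp add: field_simps)
  finally show ?thesis .
qed

text \<open>Pointwise measurability turns the supremum over the class into a countable one, the limit of
  maxima over finite subclasses. The random bound \<open>Z\<close> takes values in the extended reals so that
  monotone convergence applies to it directly.\<close>

theorem expected_sup_deviation:
  fixes X :: "nat \<Rightarrow> 'w \<Rightarrow> 'a::euclidean_space"
  assumes P: "prob_space P" and indep: "prob_space.indep_vars P (\<lambda>_. borel) X {1..}"
    and D: "\<And>i. 1 \<le> i \<Longrightarrow> distr P borel (X i) = D" and n: "1 \<le> n"
    and pm: "pointwise_measurable F"
    and F: "\<And>f. f \<in> F \<Longrightarrow> f \<in> borel_measurable borel \<and> (\<forall>x. 0 \<le> f x \<and> f x \<le> B)"
    and VC: "VC_at_most V F"
  shows "\<exists>Z\<in>borel_measurable P. (\<integral>\<^sup>+\<omega>. Z \<omega> \<partial>P) \<le> ennreal (2 * chaining_constant V * B / sqrt n) \<and>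
    (\<forall>f\<in>F. \<forall>\<omega>\<in>space P. ennreal \<bar>empirical X n \<omega> f - (LINT y|D. f y)\<bar> \<le> Z \<omega>)"
proof (cases "F = {}")
  case True
  then show ?thesis by (intro bexI[of _ "\<lambda>_. 0"]) auto
next
  case False
  interpret P: prob_space P by fact
  have Xm: "X i \<in> measurable P borel" if "1 \<le> i" for i
    using indep that by (auto simp: P.indep_vars_def)
  have sD: "sets D = sets borel" and pD: "prob_space D"
    using D[of 1] P.prob_space_distr[OF Xm[of 1]] by auto
  interpret D: prob_space D by (rule pD)
  let ?dev = "\<lambda>\<omega> f. empirical X n \<omega> f - (LINT y|D. f y)"
  let ?bound = "ennreal (2 * chaining_constant V * B / sqrt n)"
  obtain f\<^sub>1 where "f\<^sub>1 \<in> F" using False by blast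
  obtain F0 where F0: "F0 \<subseteq> F" "countable F0"
    and dense: "\<And>f. f \<in> F \<Longrightarrow> \<exists>g. (\<forall>k::nat. g k \<in> F0) \<and> (\<forall>x. (\<lambda>k. g k x) \<longlonglongrightarrow> f x)"
    using pm unfolding pointwise_measurable_def by blast
  have "F0 \<noteq> {}" using dense[OF \<open>f\<^sub>1 \<in> F\<close>] by blast
  define e where "e = from_nat_into F0"
  have e: "range e = F0" unfolding e_def using range_from_nat_into[OF \<open>F0 \<noteq> {}\<close> F0(2)] .
  have eF: "e k \<in> F" for k using e F0(1) by blast
  have Fm: "f \<in> borel_measurable borel" if "f \<in> F" for f using F that by blast
  have emp_m: "(\<lambda>\<omega>. empirical X n \<omega> f) \<in> borel_measurable P" if "f \<in> F" for f
    unfolding empirical_def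
    by (intro borel_measurable_divide borel_measurable_sum borel_measurable_const
        measurable_compose[OF Xm Fm[OF that]]) auto
  define A where "A N \<omega> = ennreal (max_abs (e ` {..N}) (?dev \<omega>))" for N \<omega>
  have Am: "A N \<in> borel_measurable P" for N
    unfolding A_def using emp_m eF
    by (intro measurable_compose[OF _ measurable_ennreal] borel_measurable_max_abs borel_measurable_diff
        borel_measurable_const) auto
  have A_bound: "(\<integral>\<^sup>+\<omega>. A N \<omega> \<partial>P) \<le> ?bound" for N
    unfolding A_def
  proof (rule expected_max_deviation[OF P indep D n])
    have sub: "e ` {..N} \<subseteq> F" using eF by auto
    show "f \<in> borel_measurable borel \<and> (\<forall>x. 0 \<le> f x \<and> f x \<le> B)" if "f \<in> e ` {..N}" for f
      using F that sub by blast
    show "VC_at_most V (e ` {..N})" using VC sub by (rule VC_at_most_subset)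
  qed auto
  have A_mono: "incseq A"
    unfolding A_def by (intro incseq_SucI le_funI ennreal_leI max_abs_mono) auto
  define Z where "Z \<omega> = (SUP N. A N \<omega>)" for \<omega>
  have Zm: "Z \<in> borel_measurable P" unfolding Z_def using Am by measurable
  have "(\<integral>\<^sup>+\<omega>. Z \<omega> \<partial>P) = (SUP N. \<integral>\<^sup>+\<omega>. A N \<omega> \<partial>P)"
    unfolding Z_def using A_mono Am by (rule nn_integral_monotone_convergence_SUP)
  also have "\<dots> \<le> ?bound" by (rule SUP_least) (rule A_bound)
  finally have Z_bound: "(\<integral>\<^sup>+\<omega>. Z \<omega> \<partial>P) \<le> ?bound" .
  have Z_ge: "ennreal \<bar>?dev \<omega> f\<bar> \<le> Z \<omega>" if f: "f \<in> F" for f \<omega>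
  proof -
    have Z_e: "ennreal \<bar>?dev \<omega> h\<bar> \<le> Z \<omega>" if "h \<in> F0" for h
    proof -
      have "h \<in> range e" using that e by simp
      then obtain k where "h = e k" by blast
      then have "ennreal \<bar>?dev \<omega> h\<bar> \<le> A k \<omega>"
        unfolding A_def using max_abs_ge[of "e ` {..k}" h "?dev \<omega>"] by (intro ennreal_leI) auto
      also have "\<dots> \<le> Z \<omega>" unfolding Z_def by (rule SUP_upper) simp
      finally show ?thesis .
    qed
    obtain g where g: "\<And>k::nat. g k \<in> F0" "\<And>x. (\<lambda>k. g k x) \<longlonglongrightarrow> f x" using dense[OF f] by blast
    have gF: "g k \<in> F" for k using g F0 by blast
    have DM: "h \<in> borel_measurable D" if "h \<in> F" for h
      using Fm[OF that] measurable_cong_sets[OF sD refl] by blast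
    have "(\<lambda>k. empirical X n \<omega> (g k)) \<longlonglongrightarrow> empirical X n \<omega> f"
      unfolding empirical_def using g(2) n by (intro tendsto_divide tendsto_sum tendsto_const) auto
    moreover have "(\<lambda>k. LINT y|D. g k y) \<longlonglongrightarrow> (LINT y|D. f y)"
    proof (rule integral_dominated_convergence[where w="\<lambda>_. B"])
      show "AE x in D. norm (g k x) \<le> B" for k using F gF[of k] by (simp add: abs_of_nonneg)
    qed (use DM f gF g(2) in auto)
    ultimately have "(\<lambda>k. ennreal \<bar>?dev \<omega> (g k)\<bar>) \<longlonglongrightarrow> ennreal \<bar>?dev \<omega> f\<bar>"
      by (intro tendsto_ennrealI tendsto_rabs tendsto_diff)
    then show ?thesis by (rule LIMSEQ_le_const2) (use Z_e g(1) in auto)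
  qed
  show ?thesis using Zm Z_bound Z_ge by blast
qed

section \<open>Mixtures of rescaled translates\<close>

lemma rescale_kernel:
  fixes \<phi> :: "'a::euclidean_space \<Rightarrow> real"
  assumes \<phi>: "\<phi> \<in> L2_functions \<inter> prob_densities" and B: "\<And>x. \<phi> x \<le> B" and \<nu>: "0 < \<nu>"
  shows rescale_measurable: "rescale \<phi> \<nu> \<in> borel_measurable borel"
    and rescale_nonneg: "0 \<le> rescale \<phi> \<nu> x"
    and rescale_le: "rescale \<phi> \<nu> x \<le> \<nu> ^ DIM('a) * B"
    and rescale_integral: "(\<integral>\<^sup>+x. ennreal (rescale \<phi> \<nu> x) \<partial>lborel) = 1"
    and rescale_square: "(\<integral>\<^sup>+x. ennreal ((rescale \<phi> \<nu> x)\<^sup>2) \<partial>lborel) = ennreal (\<nu> ^ DIM('a) * L2_sq \<phi>)"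
    and rescale_moment: "(\<integral>\<^sup>+x. ennreal (norm x powr s * rescale \<phi> \<nu> x) \<partial>lborel)
      = ennreal (\<nu> powr (- s)) * (\<integral>\<^sup>+x. ennreal (norm x powr s * \<phi> x) \<partial>lborel)"
proof -
  have \<phi>m [measurable]: "\<phi> \<in> borel_measurable borel" and \<phi>0: "\<And>x. 0 \<le> \<phi> x"
    and \<phi>i: "integrable lborel \<phi>" "(LINT x|lborel. \<phi> x) = 1" "integrable lborel (\<lambda>x. (\<phi> x)\<^sup>2)"
    using \<phi> by (auto simp: L2_functions_def prob_densities_def)
  let ?d = "DIM('a)"
  have r: "rescale \<phi> \<nu> = (\<lambda>x. \<nu> ^ ?d * \<phi> (\<nu> *\<^sub>R x))" by (auto simp: rescale_def)
  show "rescale \<phi> \<nu> \<in> borel_measurable borel" unfolding r by measurable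
  show "0 \<le> rescale \<phi> \<nu> x" "rescale \<phi> \<nu> x \<le> \<nu> ^ ?d * B" using \<phi>0 B \<nu> by (auto simp: r)
  have "(\<integral>\<^sup>+x. ennreal (rescale \<phi> \<nu> x) \<partial>lborel) = (\<integral>\<^sup>+x. ennreal (\<nu> ^ ?d) * ennreal (\<phi> (\<nu> *\<^sub>R x)) \<partial>lborel)"
    using \<nu> \<phi>0 by (simp add: r ennreal_mult)
  also have "\<dots> = (\<integral>\<^sup>+x. ennreal (\<phi> x) \<partial>lborel)"
    using nn_integral_scale[of "\<lambda>x. ennreal (\<phi> x)" \<nu>] \<nu> by simp
  also have "\<dots> = 1" using \<phi>i \<phi>0 by (simp add: nn_integral_eq_integral)
  finally show "(\<integral>\<^sup>+x. ennreal (rescale \<phi> \<nu> x) \<partial>lborel) = 1" .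
  have "(\<integral>\<^sup>+x. ennreal ((rescale \<phi> \<nu> x)\<^sup>2) \<partial>lborel)
      = (\<integral>\<^sup>+x. ennreal (\<nu> ^ ?d) * ennreal (\<nu> ^ ?d * (\<phi> (\<nu> *\<^sub>R x))\<^sup>2) \<partial>lborel)"
    using \<nu> by (simp add: r power_mult_distrib power2_eq_square mult_ac flip: ennreal_mult)
  also have "\<dots> = (\<integral>\<^sup>+x. ennreal (\<nu> ^ ?d * (\<phi> x)\<^sup>2) \<partial>lborel)"
    using nn_integral_scale[of "\<lambda>x. ennreal (\<nu> ^ ?d * (\<phi> x)\<^sup>2)" \<nu>] \<nu> by simp
  also have "\<dots> = ennreal (\<nu> ^ ?d * L2_sq \<phi>)"
    using \<phi>i \<nu> by (subst nn_integral_eq_integral) auto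
  finally show "(\<integral>\<^sup>+x. ennreal ((rescale \<phi> \<nu> x)\<^sup>2) \<partial>lborel) = \<dots>" .
  have "(\<integral>\<^sup>+x. ennreal (norm x powr s * rescale \<phi> \<nu> x) \<partial>lborel)
      = (\<integral>\<^sup>+x. ennreal (\<nu> ^ ?d) * (ennreal (\<nu> powr (- s)) * ennreal (norm (\<nu> *\<^sub>R x) powr s * \<phi> (\<nu> *\<^sub>R x))) \<partial>lborel)"
  proof (rule nn_integral_cong)
    fix x :: 'a
    have e: "\<nu> powr (- s) * \<nu> powr s = 1" using \<nu> by (simp flip: powr_add)
    have "\<nu> ^ ?d * (\<nu> powr (- s) * (norm (\<nu> *\<^sub>R x) powr s * \<phi> (\<nu> *\<^sub>R x)))
        = (\<nu> powr (- s) * \<nu> powr s) * (norm x powr s * (\<nu> ^ ?d * \<phi> (\<nu> *\<^sub>R x)))"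
      using \<nu> by (simp add: powr_mult mult_ac)
    then have "norm x powr s * rescale \<phi> \<nu> x = \<nu> ^ ?d * (\<nu> powr (- s) * (norm (\<nu> *\<^sub>R x) powr s * \<phi> (\<nu> *\<^sub>R x)))"
      unfolding e r by (simp only: mult_1_left)
    then show "ennreal (norm x powr s * rescale \<phi> \<nu> x)
        = ennreal (\<nu> ^ ?d) * (ennreal (\<nu> powr (- s)) * ennreal (norm (\<nu> *\<^sub>R x) powr s * \<phi> (\<nu> *\<^sub>R x)))"
      using \<nu> \<phi>0 by (simp flip: ennreal_mult)
  qed
  also have "\<dots> = (\<integral>\<^sup>+x. ennreal (\<nu> powr (- s)) * ennreal (norm x powr s * \<phi> x) \<partial>lborel)"
    using nn_integral_scale[of "\<lambda>x. ennreal (\<nu> powr (- s)) * ennreal (norm x powr s * \<phi> x)" \<nu>] \<nu> by simp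
  also have "\<dots> = ennreal (\<nu> powr (- s)) * (\<integral>\<^sup>+x. ennreal (norm x powr s * \<phi> x) \<partial>lborel)"
    by (rule nn_integral_cmult) simp
  finally show "(\<integral>\<^sup>+x. ennreal (norm x powr s * rescale \<phi> \<nu> x) \<partial>lborel) = \<dots>" .
qed

text \<open>The factors \<open>2\<close> come from splitting the error of the mixture at the smoothed density \<open>g\<close>.\<close>

lemma mixture_approximation:
  fixes \<phi> f :: "'a::euclidean_space \<Rightarrow> real"
  assumes \<phi>: "\<phi> \<in> L2_functions \<inter> prob_densities" and B: "\<And>x. \<phi> x \<le> B" and \<nu>: "0 < \<nu>" and m: "1 \<le> m"
    and moment: "(\<integral>\<^sup>+x. ennreal (norm x powr s * \<phi> x) \<partial>lborel) \<le> ennreal K" and K: "0 < K"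
    and f: "f \<in> prob_densities"
    and C: "0 \<le> C" "\<And>h. shift_modulus f h \<le> ennreal (C * norm h powr (2 * s))"
  shows "\<exists>q\<in>mixtures m (fixed_scale_class \<phi> \<nu>). (\<integral>\<^sup>+x. ennreal ((q x - f x)\<^sup>2) \<partial>lborel)
    \<le> ennreal (2 * (\<nu> ^ DIM('a) * L2_sq \<phi> / m) + 2 * (C * (\<nu> powr (- s) * K)\<^sup>2))"
proof -
  let ?bias = "C * (\<nu> powr (- s) * K)\<^sup>2"
  define k where "k = rescale \<phi> \<nu>"
  define c where "c = \<nu> ^ DIM('a) * L2_sq \<phi>"
  note kernel = rescale_kernel[OF \<phi> B \<nu>, folded k_def]
  have km [measurable]: "k \<in> borel_measurable borel" by (rule kernel(1))
  have fm [measurable]: "f \<in> borel_measurable borel" and fi: "integrable lborel f"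
    using f by (auto simp: prob_densities_def)
  have c: "0 \<le> c" unfolding c_def using \<nu> by (intro mult_nonneg_nonneg Bochner_Integration.integral_nonneg) auto
  define g where "g x = (LINT \<mu>|lborel. k (x - \<mu>) * f \<mu>)" for x
  have gm [measurable]: "g \<in> borel_measurable borel" unfolding g_def by measurable
  have bias: "(\<integral>\<^sup>+x. ennreal ((g x - f x)\<^sup>2) \<partial>lborel) \<le> ennreal ?bias"
    unfolding g_def
  proof (rule smoothing_bias[OF km kernel(2,3,4)])
    have "(\<integral>\<^sup>+x. ennreal (norm x powr s * k x) \<partial>lborel) \<le> ennreal (\<nu> powr (- s)) * ennreal K"
      unfolding kernel(6) using moment by (rule mult_left_mono) simp
    then show "(\<integral>\<^sup>+x. ennreal (norm x powr s * k x) \<partial>lborel) \<le> ennreal (\<nu> powr (- s) * K)"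
      using K by (simp add: ennreal_mult)
  qed (use K \<nu> fi C in auto)
  have "(\<integral>\<^sup>+x. ennreal ((k x)\<^sup>2) \<partial>lborel) \<le> ennreal c" unfolding kernel(5) c_def by simp
  from maurey_translates[OF km kernel(2,3) this c f, of m] obtain \<mu> :: "nat \<Rightarrow> 'a" where
    \<mu>: "(\<integral>\<^sup>+x. ennreal ((\<Sum>j=1..m. k (x - \<mu> j) - g x)\<^sup>2) \<partial>lborel) \<le> ennreal (m * c)"
    unfolding g_def by blast
  define q where "q x = (\<Sum>j=1..m. (1 / m) * k (x - \<mu> j))" for x
  have "q \<in> mixtures m (fixed_scale_class \<phi> \<nu>)"
    unfolding mixtures_def mem_Collect_eq
    by (rule exI[of _ "\<lambda>_. 1 / m"], rule exI[of _ "\<lambda>j x. k (x - \<mu> j)"])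
      (use m in \<open>auto simp: q_def fixed_scale_class_def k_def\<close>)
  moreover have "(\<integral>\<^sup>+x. ennreal ((q x - f x)\<^sup>2) \<partial>lborel) \<le> ennreal (2 * (c / m) + 2 * ?bias)"
  proof -
    let ?S = "\<lambda>x. \<Sum>j=1..m. k (x - \<mu> j) - g x"
    have qg: "q x - g x = ?S x / m" for x
      using m by (simp add: q_def sum_subtractf sum_divide_distrib diff_divide_distrib)
    have "(\<integral>\<^sup>+x. ennreal ((q x - f x)\<^sup>2) \<partial>lborel)
        \<le> (\<integral>\<^sup>+x. ennreal (2 / m ^ 2) * ennreal ((?S x)\<^sup>2) + ennreal 2 * ennreal ((g x - f x)\<^sup>2) \<partial>lborel)"
    proof (rule nn_integral_mono)
      fix x
      have "(q x - f x)\<^sup>2 \<le> 2 * (q x - g x)\<^sup>2 + 2 * (g x - f x)\<^sup>2"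
        using square_add_le[of "q x - g x" "g x - f x"] by simp
      also have "2 * (q x - g x)\<^sup>2 = 2 / m ^ 2 * (?S x)\<^sup>2" unfolding qg by (simp add: power_divide)
      finally have "ennreal ((q x - f x)\<^sup>2) \<le> ennreal (2 / m ^ 2 * (?S x)\<^sup>2 + 2 * (g x - f x)\<^sup>2)" by (rule ennreal_leI)
      then show "ennreal ((q x - f x)\<^sup>2) \<le> ennreal (2 / m ^ 2) * ennreal ((?S x)\<^sup>2) + ennreal 2 * ennreal ((g x - f x)\<^sup>2)"
        by (simp only: ennreal_mult[symmetric] ennreal_plus[symmetric] zero_le_power2 zero_le_numeral
            divide_nonneg_nonneg mult_nonneg_nonneg zero_le_power of_nat_0_le_iff)
    qed
    also have "\<dots> = ennreal (2 / m ^ 2) * (\<integral>\<^sup>+x. ennreal ((?S x)\<^sup>2) \<partial>lborel) + ennreal 2 * (\<integral>\<^sup>+x. ennreal ((g x - f x)\<^sup>2) \<partial>lborel)"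
      by (simp add: nn_integral_add nn_integral_cmult)
    also have "\<dots> \<le> ennreal (2 / m ^ 2) * ennreal (m * c) + ennreal 2 * ennreal ?bias"
      by (intro add_mono mult_left_mono \<mu> bias) auto
    also have "\<dots> = ennreal (2 / m ^ 2 * (m * c) + 2 * ?bias)"
      using c C(1) by (simp add: ennreal_mult[symmetric] del: ennreal_numeral flip: ennreal_plus)
    also have "2 / m ^ 2 * (m * c) = 2 * (c / m)" using m by (simp add: power2_eq_square)
    finally show ?thesis .
  qed
  ultimately show ?thesis unfolding c_def by blast
qed


section \<open>The rate of the approximate least squares estimator\<close>

text \<open>The constant \<open>L2_sq f\<close> cancels. The deviation \<open>z\<close> enters twice for each of \<open>h\<close> and \<open>q\<close>, because
  means carry the factor \<open>2\<close> in the risk.\<close>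

lemma basic_inequality:
  fixes f q h :: "'a::euclidean_space \<Rightarrow> real"
  assumes f: "f \<in> L2_functions \<inter> prob_densities" and h: "h \<in> L2_functions" and q: "q \<in> L2_functions"
    and D: "D = density lborel (\<lambda>x. ennreal (f x))"
    and risk: "L2_risk X n \<omega> h \<le> L2_risk X n \<omega> q + \<epsilon>"
    and dh: "\<bar>empirical X n \<omega> h - (LINT y|D. h y)\<bar> \<le> z"
    and dq: "\<bar>empirical X n \<omega> q - (LINT y|D. q y)\<bar> \<le> z"
  shows "L2_sq (\<lambda>x. h x - f x) \<le> L2_sq (\<lambda>x. q x - f x) + 4 * z + \<epsilon>"
proof -
  have f0: "\<And>x. 0 \<le> f x" and fL2: "f \<in> L2_functions" using f by (auto simp: prob_densities_def)
  have expand: "L2_sq (\<lambda>x. p x - f x) = L2_sq p - 2 * (LINT y|D. p y) + L2_sq f"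
    if p: "p \<in> L2_functions" for p
  proof -
    have "(LINT y|D. p y) = (LINT x|lborel. f x * p x)"
      unfolding D using f0 L2_measurable[OF fL2] L2_measurable[OF p] by (subst integral_density) auto
    then show ?thesis by (simp add: L2_sq_diff[OF p fL2] mult.commute)
  qed
  show ?thesis
    using risk dh dq unfolding expand[OF h] expand[OF q] L2_risk_def by linarith
qed

text \<open>Empirical and true means are linear, so the deviation of a mixture is a convex combination of the
  deviations of its components, and the number of components does not matter.\<close>

lemma mixture_properties:
  fixes F :: "('a::euclidean_space \<Rightarrow> real) set"
  assumes components: "\<forall>f\<in>F. f \<in> L2_functions \<and> (\<forall>x. 0 \<le> f x \<and> f x \<le> B)"
    and D: "prob_space D" "sets D = sets borel" and q: "q \<in> mixtures m F"
  shows mixture_L2: "q \<in> L2_functions"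
    and mixture_le: "q x \<le> B"
    and mixture_deviation: "\<forall>f\<in>F. \<bar>empirical X n \<omega> f - (LINT y|D. f y)\<bar> \<le> z \<Longrightarrow>
      \<bar>empirical X n \<omega> q - (LINT y|D. q y)\<bar> \<le> z"
proof -
  interpret D: prob_space D by fact
  have F: "f \<in> L2_functions \<and> (\<forall>x. 0 \<le> f x \<and> f x \<le> B)" if "f \<in> F" for f using components that by blast
  obtain \<pi> p where p: "\<And>j. j \<in> {1..m} \<Longrightarrow> p j \<in> F" and \<pi>: "\<And>j. j \<in> {1..m} \<Longrightarrow> 0 \<le> \<pi> j"
    and \<pi>1: "(\<Sum>j=1..m. \<pi> j) = 1" and q_eq: "q = (\<lambda>x. \<Sum>j=1..m. \<pi> j * p j x)"
    using q unfolding mixtures_def by blast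
  have "(\<lambda>x. \<Sum>j\<in>J. \<pi> j * p j x) \<in> L2_functions" if "finite J" "J \<subseteq> {1..m}" for J
    using that
  proof (induction J rule: finite_induct)
    case (insert j J)
    then have "p j \<in> L2_functions" using p F by blast
    then show ?case using insert L2_add[OF L2_cmult[of "p j" "\<pi> j"]] by simp
  qed (simp add: L2_functions_def)
  from this[of "{1..m}"] show "q \<in> L2_functions" by (simp add: q_eq)
  have "q x \<le> (\<Sum>j=1..m. \<pi> j * B)" unfolding q_eq
    using p F \<pi> by (intro sum_mono mult_left_mono) auto
  also have "\<dots> = B" by (simp only: sum_distrib_right[symmetric] \<pi>1 mult_1_left)
  finally show "q x \<le> B" .
  assume dev: "\<forall>f\<in>F. \<bar>empirical X n \<omega> f - (LINT y|D. f y)\<bar> \<le> z"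
  have p_int: "integrable D (p j)" if "j \<in> {1..m}" for j
  proof (rule D.integrable_const_bound[where B=B])
    show "AE x in D. norm (p j x) \<le> B" using F[OF p[OF that]] by (simp add: abs_of_nonneg)
    show "p j \<in> borel_measurable D"
      using F[OF p[OF that]] measurable_cong_sets[OF D(2) refl] by (auto simp: L2_functions_def)
  qed
  have "empirical X n \<omega> q = (\<Sum>j=1..m. \<pi> j * empirical X n \<omega> (p j))"
    unfolding empirical_def q_eq by (subst sum.swap) (simp add: sum_distrib_left sum_divide_distrib)
  moreover have "(LINT y|D. q y) = (\<Sum>j=1..m. \<pi> j * (LINT y|D. p j y))"
    unfolding q_eq using p_int by (simp add: Bochner_Integration.integral_sum)
  ultimately have "\<bar>empirical X n \<omega> q - (LINT y|D. q y)\<bar>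
      = \<bar>\<Sum>j=1..m. \<pi> j * (empirical X n \<omega> (p j) - (LINT y|D. p j y))\<bar>"
    by (simp add: sum_subtractf right_diff_distrib)
  also have "\<dots> \<le> (\<Sum>j=1..m. \<bar>\<pi> j * (empirical X n \<omega> (p j) - (LINT y|D. p j y))\<bar>)" by (rule sum_abs)
  also have "\<dots> \<le> (\<Sum>j=1..m. \<pi> j * z)"
    using \<pi> dev p by (intro sum_mono) (simp add: abs_mult mult_left_mono)
  also have "\<dots> = z" by (simp only: sum_distrib_right[symmetric] \<pi>1 mult_1_left)
  finally show "\<bar>empirical X n \<omega> q - (LINT y|D. q y)\<bar> \<le> z" .
qed

text \<open>The estimator is measurable with respect to the sample, which is coarser than \<open>P\<close>; the identity map
  transfers joint measurability to the product with \<open>P\<close>, where the integral over \<open>x\<close> can be taken.\<close>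

lemma squared_error_measurable:
  fixes X :: "nat \<Rightarrow> 'w \<Rightarrow> 'a::euclidean_space" and h :: "'w \<Rightarrow> 'a \<Rightarrow> real"
  assumes X: "\<And>i. 1 \<le> i \<Longrightarrow> X i \<in> measurable P borel"
    and h: "(\<lambda>(\<omega>, x). h \<omega> x) \<in> borel_measurable (sample_algebra P X n \<Otimes>\<^sub>M borel)"
    and f [measurable]: "f \<in> borel_measurable borel"
  shows "(\<lambda>\<omega>. LINT x|lborel. (h \<omega> x - f x)\<^sup>2) \<in> borel_measurable P"
proof -
  have "(\<lambda>\<omega>. \<lambda>i\<in>{1..n}. X i \<omega>) \<in> measurable P (PiM {1..n} (\<lambda>_. borel))"
    using X by (intro measurable_restrict) auto
  then have id: "(\<lambda>\<omega>. \<omega>) \<in> measurable P (sample_algebra P X n)"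
    unfolding sample_algebra_def by (intro measurable_vimage_algebra2) auto
  have "(\<lambda>p. (fst p, snd p)) \<in> measurable (P \<Otimes>\<^sub>M lborel) (sample_algebra P X n \<Otimes>\<^sub>M borel)"
    by (intro measurable_Pair measurable_compose[OF measurable_fst id]) simp
  from measurable_compose[OF this h]
  have [measurable]: "(\<lambda>p. h (fst p) (snd p)) \<in> borel_measurable (P \<Otimes>\<^sub>M lborel)" by simp
  have "(\<lambda>(\<omega>, x). (h \<omega> x - f x)\<^sup>2) \<in> borel_measurable (P \<Otimes>\<^sub>M lborel)"
    unfolding case_prod_unfold by measurable
  then show ?thesis by (rule lborel.borel_measurable_lebesgue_integral)
qed

theorem theorem13:
  fixes P :: "'w measure"
    and X :: "nat \<Rightarrow> 'w \<Rightarrow> 'a::euclidean_space"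
    and \<phi> f\<^sub>0 :: "'a \<Rightarrow> real"
    and s K\<^sub>1 :: real
  assumes s: "0 < s" "s \<le> 1"
    and phi: "\<phi> \<in> bounded_functions \<inter> L2_functions \<inter> prob_densities"
    and f0: "f\<^sub>0 \<in> sobolev s \<inter> prob_densities"
    and prob: "prob_space P"
    and indep: "prob_space.indep_vars P (\<lambda>_. borel) X {1..}"
    and distr: "\<And>i. 1 \<le> i \<Longrightarrow> distributed P lborel (X i) (\<lambda>x. ennreal (f\<^sub>0 x))"
    and pm: "\<And>\<nu>. 0 < \<nu> \<Longrightarrow> pointwise_measurable (fixed_scale_class \<phi> \<nu>)"
    and VC: "VC_dim (scale_class \<phi>) < \<infinity>"
    and moment: "(\<integral>\<^sup>+x. ennreal (norm x powr s * \<phi> x) \<partial>lborel) \<le> ennreal K\<^sub>1"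
  shows "\<exists>M N :: real. \<exists>\<epsilon> :: nat \<Rightarrow> real.
    0 < M \<and> 0 < N \<and> (\<forall>n. 0 \<le> \<epsilon> n) \<and>
    \<epsilon> \<lesssim> (\<lambda>n. real n powr (- s / (2 * s + real DIM('a)))) \<and>
    (\<forall>m :: nat \<Rightarrow> nat. \<forall>\<nu> :: nat \<Rightarrow> real. \<forall>fhat :: nat \<Rightarrow> 'w \<Rightarrow> 'a \<Rightarrow> real.
      (\<forall>n\<ge>1. m n = nat \<lceil>M * real n powr (1/2)\<rceil>) \<longrightarrow>
      (\<forall>n\<ge>1. \<nu> n = N * real n powr (1 / (2 * (2 * s + real DIM('a))))) \<longrightarrow>
      approx_L2_minimizer P X (\<lambda>n. mixtures (m n) (fixed_scale_class \<phi> (\<nu> n))) \<epsilon> fhat \<longrightarrow>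
      (\<forall>n\<ge>1. integrable P (\<lambda>\<omega>. (L2_norm (\<lambda>x. fhat n \<omega> x - f\<^sub>0 x))\<^sup>2)) \<and>
      (\<lambda>n. prob_space.expectation P (\<lambda>\<omega>. (L2_norm (\<lambda>x. fhat n \<omega> x - f\<^sub>0 x))\<^sup>2))
        \<lesssim> (\<lambda>n. real n powr (- s / (2 * s + real DIM('a)))))"
proof -
  interpret P: prob_space P by fact
  let ?d = "DIM('a)"
  \<comment> \<open>The witnesses are \<open>M = N = 1\<close> and \<open>\<epsilon> = rate\<close>.\<close>
  define rate where "rate n = real n powr (- s / (2 * s + real ?d))" for n :: nat
  have f0_L2: "f\<^sub>0 \<in> L2_functions"
    using f0 by (auto simp: sobolev_def sobolev_W12_def sobolev_frac_def split: if_splits)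
  then have f0_both: "f\<^sub>0 \<in> L2_functions \<inter> prob_densities" using f0 by simp
  have f0m: "f\<^sub>0 \<in> borel_measurable borel" using f0_L2 by (simp add: L2_functions_def)
  have phi_both: "\<phi> \<in> L2_functions \<inter> prob_densities" using phi by simp
  obtain B where B: "0 < B" "\<And>x. \<phi> x \<le> B"
  proof -
    have "bounded (range \<phi>)" using phi by (simp add: bounded_functions_def)
    then obtain b where "0 < b" "\<forall>y\<in>range \<phi>. norm y \<le> b" by (auto simp: bounded_pos)
    then show ?thesis by (intro that[of b]) (auto simp: abs_le_iff)
  qed
  obtain C\<^sub>W where C\<^sub>W: "0 \<le> C\<^sub>W" "\<And>h. shift_modulus f\<^sub>0 h \<le> ennreal (C\<^sub>W * norm h powr (2 * s))"
    using shift_modulus_sobolev[of s f\<^sub>0] s f0 by auto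
  define K where "K = max K\<^sub>1 1"
  have K: "0 < K" "(\<integral>\<^sup>+x. ennreal (norm x powr s * \<phi> x) \<partial>lborel) \<le> ennreal K"
    using order_trans[OF moment ennreal_leI[of K\<^sub>1 K]] by (auto simp: K_def)
  obtain V where V: "VC_at_most V (scale_class \<phi>)" using VC by (rule VC_dim_finiteE)
  define D where "D = density lborel (\<lambda>x. ennreal (f\<^sub>0 x))"
  have Xm: "X i \<in> measurable P borel" if "1 \<le> i" for i
    using indep that by (auto simp: P.indep_vars_def)
  have law: "distr P borel (X i) = D" if "1 \<le> i" for i
  proof -
    have "distr P borel (X i) = distr P lborel (X i)" by (intro distr_cong) auto
    then show ?thesis using distr[OF that] by (simp add: distributed_def D_def)
  qed
  have D: "prob_space D" "sets D = sets borel"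
    using law[of 1] P.prob_space_distr[OF Xm[of 1]] by auto
  define C\<^sub>E where "C\<^sub>E = 2 * chaining_constant V"
  have "0 < C\<^sub>E" by (simp add: C\<^sub>E_def chaining_constant_pos)
  define c where "c = L2_sq \<phi>"
  have c: "0 \<le> c" unfolding c_def by (rule L2_sq_nonneg)
  define C where "C = 2 * c + 2 * (C\<^sub>W * K\<^sup>2) + 4 * (C\<^sub>E * B) + 1"
  have C: "0 < C" using c C\<^sub>W(1) \<open>0 < C\<^sub>E\<close> B(1) by (auto simp: C_def intro!: add_nonneg_pos)
  have main: "integrable P (\<lambda>\<omega>. (L2_norm (\<lambda>x. fhat n \<omega> x - f\<^sub>0 x))\<^sup>2) \<and>
      P.expectation (\<lambda>\<omega>. (L2_norm (\<lambda>x. fhat n \<omega> x - f\<^sub>0 x))\<^sup>2) \<le> C * rate n"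
    if m: "\<forall>n\<ge>1. m n = nat \<lceil>1 * real n powr (1/2)\<rceil>"
      and nu: "\<forall>n\<ge>1. \<nu> n = 1 * real n powr (1 / (2 * (2 * s + real ?d)))"
      and fhat: "approx_L2_minimizer P X (\<lambda>n. mixtures (m n) (fixed_scale_class \<phi> (\<nu> n))) rate fhat"
      and n: "1 \<le> n" for m :: "nat \<Rightarrow> nat" and \<nu> :: "nat \<Rightarrow> real" and fhat :: "nat \<Rightarrow> 'w \<Rightarrow> 'a \<Rightarrow> real" and n
  proof -
    let ?F = "fixed_scale_class \<phi> (\<nu> n)" and ?B = "\<nu> n ^ ?d * B"
    have n0: "0 < real n" using n by simp
    have \<nu>0: "0 < \<nu> n" using nu n by simp
    have m_ge: "real n powr (1/2) \<le> m n" using m n by (simp add: of_nat_ceiling)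
    have m1: "1 \<le> m n"
    proof -
      have "0 < real n powr (1/2)" using n0 by simp
      then have "0 < real (m n)" using m_ge by linarith
      then show ?thesis by simp
    qed
    have rate0: "0 < rate n" using n0 by (simp add: rate_def)
    have sd: "0 < 2 * s + real ?d" using s by (simp add: add_pos_nonneg)
    \<comment> \<open>The choice of \<open>\<nu>\<close> makes the stochastic order \<open>\<nu> ^ d / sqrt n\<close> equal to the bias order \<open>\<nu> powr (-2 s)\<close>.\<close>
    have \<nu>d: "\<nu> n ^ ?d / real n powr (1/2) = rate n"
    proof -
      have "\<nu> n ^ ?d / real n powr (1/2) = real n powr (real ?d / (2 * (2 * s + real ?d)) - 1/2)"
        using nu n \<nu>0 by (simp add: powr_diff powr_powr flip: powr_realpow)
      also have "real ?d / (2 * (2 * s + real ?d)) - 1/2 = - s / (2 * s + real ?d)"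
        using sd by (simp add: field_simps)
      finally show ?thesis by (simp add: rate_def)
    qed
    have \<nu>s: "(\<nu> n powr (- s))\<^sup>2 = rate n"
    proof -
      have "(\<nu> n powr (- s))\<^sup>2 = real n powr (1 / (2 * (2 * s + real ?d)) * (- s) * 2)"
        using nu n n0 by (simp add: powr_powr flip: powr_numeral)
      also have "1 / (2 * (2 * s + real ?d)) * (- s) * 2 = - s / (2 * s + real ?d)"
        using sd by (simp add: field_simps)
      finally show ?thesis by (simp add: rate_def)
    qed
    have F: "f \<in> L2_functions \<and> (\<forall>x. 0 \<le> f x \<and> f x \<le> ?B)" if f_in: "f \<in> ?F" for f
    proof -
      obtain \<mu> where "f = (\<lambda>x. rescale \<phi> (\<nu> n) (x - \<mu>))"
        using f_in unfolding fixed_scale_class_def by blast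
      then have f: "f = (\<lambda>x. rescale \<phi> (\<nu> n) (x + (- \<mu>)))" by simp
      note kernel = rescale_kernel[OF phi_both B(2) \<nu>0]
      have km: "rescale \<phi> (\<nu> n) \<in> borel_measurable borel" by (rule kernel(1))
      have "rescale \<phi> (\<nu> n) \<in> L2_functions" by (rule L2_functionsI[OF km]) (simp add: kernel(5))
      then have "f \<in> L2_functions" unfolding f by (rule L2_shift)
      then show ?thesis using kernel(2,3) by (simp add: f)
    qed
    have VCF: "VC_at_most V ?F"
      by (rule VC_at_most_subset[OF V]) (use \<nu>0 in \<open>auto simp: scale_class_def\<close>)
    have "\<exists>Z\<in>borel_measurable P. (\<integral>\<^sup>+\<omega>. Z \<omega> \<partial>P) \<le> ennreal (C\<^sub>E * ?B / sqrt n) \<and>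
        (\<forall>f\<in>?F. \<forall>\<omega>\<in>space P. ennreal \<bar>empirical X n \<omega> f - (LINT y|D. f y)\<bar> \<le> Z \<omega>)"
      unfolding C\<^sub>E_def using prob indep law n pm[OF \<nu>0] _ VCF
      by (rule expected_sup_deviation) (use F in \<open>auto simp: L2_functions_def\<close>)
    then obtain Z where Zm [measurable]: "Z \<in> borel_measurable P" and Z: "(\<integral>\<^sup>+\<omega>. Z \<omega> \<partial>P) \<le> ennreal (C\<^sub>E * ?B / sqrt n)"
      "\<And>f \<omega>. f \<in> ?F \<Longrightarrow> \<omega> \<in> space P \<Longrightarrow> ennreal \<bar>empirical X n \<omega> f - (LINT y|D. f y)\<bar> \<le> Z \<omega>"
      by blast
    let ?gap = "2 * (\<nu> n ^ ?d * c / m n) + 2 * (C\<^sub>W * (\<nu> n powr (- s) * K)\<^sup>2)"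
    obtain q where q: "q \<in> mixtures (m n) ?F"
      and q_le: "(\<integral>\<^sup>+x. ennreal ((q x - f\<^sub>0 x)\<^sup>2) \<partial>lborel) \<le> ennreal ?gap"
      using mixture_approximation[OF phi_both B(2) \<nu>0 m1 K(2,1) _ C\<^sub>W] f0 unfolding c_def by blast
    have "\<forall>f\<in>?F. f \<in> L2_functions \<and> (\<forall>x. 0 \<le> f x \<and> f x \<le> ?B)" using F by blast
    note mix = mixture_properties[OF this D]
    have q_L2: "q \<in> L2_functions" by (rule mix(1)[OF q])
    define a where "a = (2 * c + 2 * (C\<^sub>W * K\<^sup>2)) * rate n"
    have q_bound: "L2_sq (\<lambda>x. q x - f\<^sub>0 x) \<le> a"
    proof -
      have "ennreal (L2_sq (\<lambda>x. q x - f\<^sub>0 x)) \<le> ennreal ?gap"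
        using q_le by (simp only: nn_integral_L2_sq[OF L2_diff[OF q_L2 f0_L2]])
      then have "L2_sq (\<lambda>x. q x - f\<^sub>0 x) \<le> ?gap"
        using c C\<^sub>W(1) \<nu>0 by (subst (asm) ennreal_le_iff) auto
      also have "\<nu> n ^ ?d * c / m n \<le> \<nu> n ^ ?d * c / real n powr (1/2)"
        using m_ge n0 c \<nu>0 m1 by (intro divide_left_mono) auto
      also have "\<nu> n ^ ?d * c / real n powr (1/2) = rate n * c"
        unfolding \<nu>d[symmetric] by simp
      also have "(\<nu> n powr (- s) * K)\<^sup>2 = rate n * K\<^sup>2" by (simp add: power_mult_distrib \<nu>s)
      finally show ?thesis by (simp add: a_def algebra_simps)
    qed
    have a0: "0 \<le> a" using c C\<^sub>W(1) rate0 by (simp add: a_def)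
    let ?err = "\<lambda>\<omega>. LINT x|lborel. (fhat n \<omega> x - f\<^sub>0 x)\<^sup>2"
    have err0: "0 \<le> ?err \<omega>" for \<omega> by (rule L2_sq_nonneg)
    have fhat_m: "(\<lambda>(\<omega>, x). fhat n \<omega> x) \<in> borel_measurable (sample_algebra P X n \<Otimes>\<^sub>M borel)"
      and fhat_F: "\<And>\<omega>. \<omega> \<in> space P \<Longrightarrow> fhat n \<omega> \<in> mixtures (m n) ?F"
      and fhat_min: "AE \<omega> in P. L2_risk X n \<omega> (fhat n \<omega>) \<le> (INF f\<in>mixtures (m n) ?F. L2_risk X n \<omega> f) + rate n"
      using fhat n unfolding approx_L2_minimizer_def by auto
    have err_m [measurable]: "?err \<in> borel_measurable P"
      by (rule squared_error_measurable[OF Xm fhat_m f0m])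
    have err_le: "AE \<omega> in P. ennreal (?err \<omega>) \<le> ennreal (a + rate n) + 4 * Z \<omega>"
      using fhat_min
    proof (rule AE_mp, intro AE_I2 impI)
      fix \<omega> assume \<omega>: "\<omega> \<in> space P"
        and min: "L2_risk X n \<omega> (fhat n \<omega>) \<le> (INF f\<in>mixtures (m n) ?F. L2_risk X n \<omega> f) + rate n"
      show "ennreal (?err \<omega>) \<le> ennreal (a + rate n) + 4 * Z \<omega>"
      proof (cases "Z \<omega>")
        case (real z)
        have dev: "\<forall>f\<in>?F. \<bar>empirical X n \<omega> f - (LINT y|D. f y)\<bar> \<le> z"
          using Z(2)[OF _ \<omega>] real by simp
        \<comment> \<open>The infimum of an unbounded set of reals is unspecified, so comparing it with the risk of
          \<open>q\<close> requires a lower bound for the risks.\<close>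
        have "bdd_below ((\<lambda>f. L2_risk X n \<omega> f) ` mixtures (m n) ?F)"
        proof (rule bdd_belowI2)
          fix f assume f: "f \<in> mixtures (m n) ?F"
          have "empirical X n \<omega> f \<le> (\<Sum>i=1..n. ?B) / n"
            unfolding empirical_def by (intro divide_right_mono sum_mono mix(2)[OF f]) auto
          then have "empirical X n \<omega> f \<le> ?B" using n0 by simp
          moreover have "0 \<le> L2_sq f" by (rule L2_sq_nonneg)
          ultimately show "- 2 * ?B \<le> L2_risk X n \<omega> f" unfolding L2_risk_def by linarith
        qed
        then have "(INF f\<in>mixtures (m n) ?F. L2_risk X n \<omega> f) \<le> L2_risk X n \<omega> q"
          using q by (rule cINF_lower)
        then have risk: "L2_risk X n \<omega> (fhat n \<omega>) \<le> L2_risk X n \<omega> q + rate n" using min by linarith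
        have "?err \<omega> \<le> L2_sq (\<lambda>x. q x - f\<^sub>0 x) + 4 * z + rate n"
          by (rule basic_inequality[OF f0_both mix(1)[OF fhat_F[OF \<omega>]] q_L2 D_def risk
              mix(3)[OF fhat_F[OF \<omega>] dev] mix(3)[OF q dev]])
        then have "?err \<omega> \<le> (a + rate n) + 4 * z" using q_bound by linarith
        then have "ennreal (?err \<omega>) \<le> ennreal ((a + rate n) + 4 * z)" by (rule ennreal_leI)
        also have "\<dots> = ennreal (a + rate n) + 4 * Z \<omega>"
          using real a0 rate0 by (simp add: ennreal_mult')
        finally show ?thesis .
      next
        case top
        then show ?thesis by (simp add: ennreal_mult_top)
      qed
    qed
    have "(\<integral>\<^sup>+\<omega>. ennreal (?err \<omega>) \<partial>P) \<le> (\<integral>\<^sup>+\<omega>. ennreal (a + rate n) + 4 * Z \<omega> \<partial>P)"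
      using err_le by (rule nn_integral_mono_AE)
    also have "\<dots> = ennreal (a + rate n) + 4 * (\<integral>\<^sup>+\<omega>. Z \<omega> \<partial>P)"
      by (simp add: nn_integral_add nn_integral_cmult P.emeasure_space_1)
    also have "\<dots> \<le> ennreal (a + rate n) + 4 * ennreal (C\<^sub>E * ?B / sqrt n)"
      by (intro add_left_mono mult_left_mono Z(1)) simp
    also have "C\<^sub>E * ?B / sqrt n = C\<^sub>E * B * rate n"
      using n0 \<nu>d by (simp add: powr_half_sqrt mult_ac flip: times_divide_eq_right)
    also have "ennreal (a + rate n) + 4 * ennreal (C\<^sub>E * B * rate n) = ennreal (a + rate n + 4 * (C\<^sub>E * B * rate n))"
      using a0 rate0 \<open>0 < C\<^sub>E\<close> B(1) by (simp add: ennreal_mult')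
    also have "a + rate n + 4 * (C\<^sub>E * B * rate n) = C * rate n"
      by (simp add: a_def C_def algebra_simps)
    finally have total: "(\<integral>\<^sup>+\<omega>. ennreal (?err \<omega>) \<partial>P) \<le> ennreal (C * rate n)" .
    have err_int: "integrable P ?err"
      using total err0 by (intro integrableI_nonneg) (auto intro: order_le_less_trans)
    then have "P.expectation ?err \<le> C * rate n"
      using total err0 C rate0 by (simp add: nn_integral_eq_integral ennreal_le_iff)
    moreover have "(L2_norm (\<lambda>x. fhat n \<omega> x - f\<^sub>0 x))\<^sup>2 = ?err \<omega>" for \<omega>
      using err0 by (simp add: L2_norm_def)
    ultimately show ?thesis using err_int by simp
  qed
  have rate_self: "rate \<lesssim> rate" unfolding lesssim_def by (intro exI[of _ 1]) simp
  show ?thesis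
    unfolding rate_def[symmetric]
  proof (rule exI[of _ 1], rule exI[of _ 1], rule exI[of _ rate], intro conjI allI impI)
    show "0 \<le> rate n" for n by (simp add: rate_def)
    show "rate \<lesssim> (\<lambda>n. rate n)" by (rule rate_self)
    fix m :: "nat \<Rightarrow> nat" and \<nu> :: "nat \<Rightarrow> real" and fhat :: "nat \<Rightarrow> 'w \<Rightarrow> 'a \<Rightarrow> real"
    assume hyps: "\<forall>n\<ge>1. m n = nat \<lceil>1 * real n powr (1/2)\<rceil>"
      "\<forall>n\<ge>1. \<nu> n = 1 * real n powr (1 / (2 * (2 * s + real ?d)))"
      "approx_L2_minimizer P X (\<lambda>n. mixtures (m n) (fixed_scale_class \<phi> (\<nu> n))) rate fhat"
    show "integrable P (\<lambda>\<omega>. (L2_norm (\<lambda>x. fhat n \<omega> x - f\<^sub>0 x))\<^sup>2)" if "1 \<le> n" for n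
      using main[OF hyps that] by simp
    show "(\<lambda>n. P.expectation (\<lambda>\<omega>. (L2_norm (\<lambda>x. fhat n \<omega> x - f\<^sub>0 x))\<^sup>2)) \<lesssim> (\<lambda>n. rate n)"
      unfolding lesssim_def using C main[OF hyps] by (intro exI[of _ C]) simp
  qed simp_all
qed

end
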